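(* Let $K,K^*,L,L^*\ge 0$ be integers and let $\alpha_1,\dots,\alpha_K$, $\alpha^*_1,\dots,\alpha^*_{K^*}$, $\beta_1,\dots,\beta_L$, $\beta^*_1,\dots,\beta^*_{L^*}$ be complex numbers. Let $\Phi_n,\Phi^*_n,\Xi_n,\Xi^*_n$ (leading coefficient $\widehat\kappa_n$) be the bi-orthogonal system of the modified weight $$\widehat w(z)=\frac{\prod_{i=1}^{K}(z-\alpha_i)\prod_{j=1}^{K^*}(1-\alpha^*_jz^{-1})}{\prod_{k=1}^{L}(z-\beta_k)\prod_{l=1}^{L^*}(1-\beta^*_lz^{-1})}\,w(z).$$ For a sequence of functions $a=(a_m)$ let $v(a,z)$ be the row vector of length $K+K^*+L+L^*+1$ obtained by concatenating $$\big(z^{L-c}a_{n-L^*-L+c}(z)\big)_{c=0}^{L-1},\quad \big(a_{n-L^*+c}(z)\big)_{c=0}^{L^*-1},\quad \big(z^{-c}a_{n+c}(z)\big)_{c=0}^{K^*},\quad \big(z^{-K^*}a_{n+K^*+c}(z)\big)_{c=1}^{K},$$ and for sequences $a,p,x$ let $D[a;p,x](z)$ be the determinant of the square matrix whose rows are, in order, $v(a,z)$; $v(p,\alpha_r)$, $r=1,\dots,K$; $v(p,\alpha^*_r)$, $r=1,\dots,K^*$; $v(x,\beta_r)$, $r=1,\dots,L$; $v(x,\beta^*_r)$, $r=1,\dots,L^*$. Then, with $C,C^*$ constants independent of $z$, $$\prod_{i=1}^{K}(z-\alpha_i)\prod_{j=1}^{K^*}(1-\alpha^*_jz^{-1})\,\Phi_n(z)=C\,D[\phi;\phi,\xi](z),$$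 $$\prod_{i=1}^{K}(z-\alpha_i)\prod_{j=1}^{K^*}(1-\alpha^*_jz^{-1})\,\Phi^*_n(z)=C^*\,D[\phi^*;\phi^*,\xi^*](z),$$ $$\prod_{i=1}^{L}(z-\beta_i)\prod_{j=1}^{L^*}(1-\beta^*_jz^{-1})\,\Xi_n(z)=C\,D[\xi;\phi,\xi](z),$$ $$\prod_{i=1}^{L}(z-\beta_i)\prod_{j=1}^{L^*}(1-\beta^*_jz^{-1})\,\Xi^*_n(z)=C^*\,D[\xi^*;\phi^*,\xi^*](z).$$ The leading coefficient of the modified polynomials can be found from $$\widehat\kappa_n^2=\frac{2[z^n]\Phi_n(z)}{[z^n]\Xi_n(z)}=\frac{2\Phi^*_n(0)}{\lim_{z\to\infty}\Xi^*_n(z)},$$ where $[z^n]\Xi_n(z)$ is the coefficient of $z^n$ in the expansion of $\Xi_n$ at $z=0$.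
   Context: $\mathbb T$ is the unit circle. For a complex-valued weight $w$ on $\mathbb T$ put $w_k=\int_{\mathbb T}\frac{d\zeta}{2\pi i\zeta}w(\zeta)\zeta^{-k}$ and $I_n[w]=\det[w_{j-k}]_{j,k=0,\dots,n-1}$, $I_0=1$. If $I_n[w]\ne0$ for all $n\ge0$, the bi-orthogonal system of $w$ is: polynomials $\phi_n,\bar\phi_n$ of degree $n$ with the same leading coefficient $\kappa_n$ satisfying $\int_{\mathbb T}\frac{d\zeta}{2\pi i\zeta}w(\zeta)\phi_m(\zeta)\bar\phi_n(\bar\zeta)=\delta_{m,n}$ with $\bar\zeta=1/\zeta$ ($\bar\phi_n$ is a separate polynomial, not in general the complex conjugate of $\phi_n$); the reciprocal polynomial $\phi^*_n(z)=z^n\bar\phi_n(1/z)$; and the associated functions, for $n>0$, $\xi_n(z)=\int_{\mathbb T}\frac{d\zeta}{2\pi i\zeta}\frac{\zeta+z}{\zeta-z}w(\zeta)\phi_n(\zeta)$, $\ \xi^*_n(z)=-z^n\int_{\mathbb T}\frac{d\zeta}{2\pi i\zeta}\frac{\zeta+z}{\zeta-z}w(\zeta)\bar\phi_n(\bar\zeta)=\frac1{\kappa_n}-\int_{\mathbb T}\frac{d\zeta}{2\pi i\zeta}\frac{\zeta+z}{\zeta-z}w(\zeta)\phi^*_n(\zeta)$, and $\xi_0(z)=\kappa_0[w_0+F(z)]$, $\xi^*_0(z)=\kappa_0[w_0-F(z)]$ with $F(z)=\int_{\mathbb T}\frac{d\zeta}{2\pi i\zeta}\frac{\zeta+z}{\zeta-z}w(\zeta)$.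 Set $r_n=\phi_n(0)/\kappa_n$, $\bar r_n=\bar\phi_n(0)/\kappa_n$. The same definitions and normalisation applied to the modified weight $\widehat w$ give $\Phi_n,\bar\Phi_n,\Phi^*_n,\Xi_n,\Xi^*_n$, leading coefficient $\widehat\kappa_n$, and $\widehat r_n,\widehat{\bar r}_n$. Negative indices: when an index in the determinant is negative, the functions are those produced by running the recurrences $\phi_m=\frac{\kappa_{m+1}\phi_{m+1}-\phi_{m+1}(0)\phi^*_{m+1}}{\kappa_m z}$, $\phi^*_m=\frac{-\bar\phi_{m+1}(0)\phi_{m+1}+\kappa_{m+1}\phi^*_{m+1}}{\kappa_m}$, $\xi_m=\frac{\kappa_{m+1}\xi_{m+1}+\phi_{m+1}(0)\xi^*_{m+1}}{\kappa_m z}$, $\xi^*_m=\frac{\bar\phi_{m+1}(0)\xi_{m+1}+\kappa_{m+1}\xi^*_{m+1}}{\kappa_m}$ backwards from $m+1=0$, where for negative index the symbols $\kappa_m\neq0$, $\phi_m(0)$, $\bar\phi_m(0)$ denote constants defined in some way; thus $\phi_m=\phi^*_m=0$ for $m<0$, while $\xi_m,\xi^*_m$ with $m<0$ are polynomials in $1/z$ (for instance $\tfrac12\kappa_{-1}\xi_{-1}=1/z$, $\tfrac12\kappa_{-1}\xi^*_{-1}=1$), no longer given by the integrals above. Standing generic assumptions: within each of the four families the parameters are pairwise distinct ($\alpha_j\ne\alpha_k$, $\beta_j\ne\beta_k$, $\alpha^*_j\neq\alpha^*_k$, $\beta^*_j\ne\beta^*_k$ for $j\ne k$; confluent cases are obtained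 as limits); both the original and the modified bi-orthogonal systems exist, with $r_n\bar r_n\ne0,1$ and $\widehat r_n\widehat{\bar r}_n\ne0,1$ for all $n\in\mathbb N$. The formulas are read where the matrix entries are defined.
   Formalization: Also assumed: α_j≠α*_k, β_j≠β*_k (else two rows of D coincide); all β, β* nonzero and off the unit circle; α, α* nonzero if K*>0; φ_m(0), φ̄_m(0)≠0 for m<0 (else D can vanish); w integrable. Ξ-formulas are for |z|≠1, and z=0 only where defined. *)

theory Defs
  imports
    "HOL-Complex_Analysis.Complex_Analysis"
    "Jordan_Normal_Form.Determinant"
begin

text \<open>Integral over the unit circle against \<open>d\<zeta> / (2 \<pi> i \<zeta>)\<close>.\<close>

definition circle_int :: "(complex \<Rightarrow> complex) \<Rightarrow> complex" where
  "circle_int f =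
     contour_integral (circlepath 0 1) (\<lambda>\<zeta>. f \<zeta> / (2 * of_real pi * \<i> * \<zeta>))"

definition circle_weight :: "(complex \<Rightarrow> complex) \<Rightarrow> bool" where
  "circle_weight w \<longleftrightarrow> (\<lambda>t. w (circlepath 0 1 t)) absolutely_integrable_on {0..1}"

definition moment :: "(complex \<Rightarrow> complex) \<Rightarrow> int \<Rightarrow> complex" where
  "moment w k = circle_int (\<lambda>\<zeta>. w \<zeta> * \<zeta> powi (- k))"

definition toeplitz_det :: "(complex \<Rightarrow> complex) \<Rightarrow> nat \<Rightarrow> complex" where
  "toeplitz_det w n = Determinant.det (mat n n (\<lambda>(j, k). moment w (int j - int k)))"

text \<open>
  \<open>\<psi> n\<close> is the second polynomial (usually written with a bar) of the pair.
  On the circle the conjugate of \<open>\<zeta>\<close> is \<open>1 / \<zeta>\<close>.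
\<close>

definition biorthogonal_system ::
  "(complex \<Rightarrow> complex) \<Rightarrow> (nat \<Rightarrow> complex poly) \<Rightarrow> (nat \<Rightarrow> complex poly) \<Rightarrow> bool" where
  "biorthogonal_system w \<phi> \<psi> \<longleftrightarrow>
     (\<forall>n. degree (\<phi> n) = n \<and> degree (\<psi> n) = n \<and> lead_coeff (\<phi> n) = lead_coeff (\<psi> n)) \<and>
     (\<forall>m n. circle_int (\<lambda>\<zeta>. w \<zeta> * poly (\<phi> m) \<zeta> * poly (\<psi> n) (1 / \<zeta>))
            = (if m = n then 1 else 0))"

text \<open>
  \<open>z ^ n * poly (\<psi> n) (1 / z)\<close> as a polynomial; \<open>reflect_poly\<close> reverses with respect
  to the actual degree of its argument, which is \<open>n\<close> in a bi-orthogonal system.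
\<close>

definition reciprocal :: "(nat \<Rightarrow> complex poly) \<Rightarrow> nat \<Rightarrow> complex poly" where
  "reciprocal \<psi> n = reflect_poly (\<psi> n)"

definition caratheodory :: "(complex \<Rightarrow> complex) \<Rightarrow> complex \<Rightarrow> complex" where
  "caratheodory w z = circle_int (\<lambda>\<zeta>. (\<zeta> + z) / (\<zeta> - z) * w \<zeta>)"

definition assoc ::
  "(complex \<Rightarrow> complex) \<Rightarrow> (nat \<Rightarrow> complex poly) \<Rightarrow> nat \<Rightarrow> complex \<Rightarrow> complex" where
  "assoc w \<phi> n z =
     (if n = 0 then lead_coeff (\<phi> 0) * (moment w 0 + caratheodory w z)
      else circle_int (\<lambda>\<zeta>. (\<zeta> + z) / (\<zeta> - z) * w \<zeta> * poly (\<phi> n) \<zeta>))"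

definition assoc_star ::
  "(complex \<Rightarrow> complex) \<Rightarrow> (nat \<Rightarrow> complex poly) \<Rightarrow> nat \<Rightarrow> complex \<Rightarrow> complex" where
  "assoc_star w \<psi> n z =
     (if n = 0 then lead_coeff (\<psi> 0) * (moment w 0 - caratheodory w z)
      else - (z ^ n) * circle_int (\<lambda>\<zeta>. (\<zeta> + z) / (\<zeta> - z) * w \<zeta> * poly (\<psi> n) (1 / \<zeta>)))"

text \<open>
  The index \<open>0\<close> is left out: there \<open>r\<close> is always \<open>1\<close> for both polynomials.
\<close>

definition generic_r :: "(nat \<Rightarrow> complex poly) \<Rightarrow> (nat \<Rightarrow> complex poly) \<Rightarrow> bool" where
  "generic_r \<phi> \<psi> \<longleftrightarrow>
     (\<forall>n\<ge>1. poly (\<phi> n) 0 / lead_coeff (\<phi> n) * (poly (\<psi> n) 0 / lead_coeff (\<psi> n)) \<notin> {0, 1})"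

text \<open>
  Extension to negative indices. Only the values of \<open>k\<close>, \<open>p\<close>, \<open>q\<close> at negative integers are
  used; they stand for the leading coefficients and the values at \<open>0\<close> of \<open>\<phi>\<close> and \<open>\<psi>\<close>.
\<close>

definition lead_ext :: "(nat \<Rightarrow> complex poly) \<Rightarrow> (int \<Rightarrow> complex) \<Rightarrow> int \<Rightarrow> complex" where
  "lead_ext \<phi> k m = (if m < 0 then k m else lead_coeff (\<phi> (nat m)))"

definition zero_ext :: "(nat \<Rightarrow> complex poly) \<Rightarrow> (int \<Rightarrow> complex) \<Rightarrow> int \<Rightarrow> complex" where
  "zero_ext \<phi> p m = (if m < 0 then p m else poly (\<phi> (nat m)) 0)"

text \<open>
  One backward step from index \<open>m + 1\<close> to \<open>m\<close>, acting on the values at \<open>z\<close> of the function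
  and of its starred companion. The sign \<open>s\<close> is \<open>-1\<close> for the polynomials and \<open>1\<close> for the
  associated functions.
\<close>

definition back_step ::
  "complex \<Rightarrow> (int \<Rightarrow> complex) \<Rightarrow> (int \<Rightarrow> complex) \<Rightarrow> (int \<Rightarrow> complex) \<Rightarrow> complex \<Rightarrow> int \<Rightarrow>
   complex \<times> complex \<Rightarrow> complex \<times> complex" where
  "back_step s \<kappa> f0 g0 z m = (\<lambda>(x, y).
     ((\<kappa> (m + 1) * x + s * f0 (m + 1) * y) / (\<kappa> m * z),
      (s * g0 (m + 1) * x + \<kappa> (m + 1) * y) / \<kappa> m))"

primrec back_run ::
  "complex \<Rightarrow> (int \<Rightarrow> complex) \<Rightarrow> (int \<Rightarrow> complex) \<Rightarrow> (int \<Rightarrow> complex) \<Rightarrow> complex \<Rightarrow>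
   complex \<times> complex \<Rightarrow> nat \<Rightarrow> complex \<times> complex" where
  "back_run s \<kappa> f0 g0 z start 0 = start"
| "back_run s \<kappa> f0 g0 z start (Suc j) =
     back_step s \<kappa> f0 g0 z (- int (Suc j)) (back_run s \<kappa> f0 g0 z start j)"

definition neg_phi ::
  "(nat \<Rightarrow> complex poly) \<Rightarrow> (nat \<Rightarrow> complex poly) \<Rightarrow>
   (int \<Rightarrow> complex) \<Rightarrow> (int \<Rightarrow> complex) \<Rightarrow> (int \<Rightarrow> complex) \<Rightarrow> int \<Rightarrow> complex \<Rightarrow> complex \<times> complex" where
  "neg_phi \<phi> \<psi> k p q m z =
     back_run (-1) (lead_ext \<phi> k) (zero_ext \<phi> p) (zero_ext \<psi> q) z
       (poly (\<phi> 0) z, poly (reciprocal \<psi> 0) z) (nat (- m))"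

definition neg_xi ::
  "(complex \<Rightarrow> complex) \<Rightarrow> (nat \<Rightarrow> complex poly) \<Rightarrow> (nat \<Rightarrow> complex poly) \<Rightarrow>
   (int \<Rightarrow> complex) \<Rightarrow> (int \<Rightarrow> complex) \<Rightarrow> (int \<Rightarrow> complex) \<Rightarrow> int \<Rightarrow> complex \<Rightarrow> complex \<times> complex" where
  "neg_xi w \<phi> \<psi> k p q m z =
     back_run 1 (lead_ext \<phi> k) (zero_ext \<phi> p) (zero_ext \<psi> q) z
       (assoc w \<phi> 0 z, assoc_star w \<psi> 0 z) (nat (- m))"

definition phi_seq where
  "phi_seq \<phi> \<psi> k p q m z =
     (if m < 0 then fst (neg_phi \<phi> \<psi> k p q m z) else poly (\<phi> (nat m)) z)"

definition phi_star_seq where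
  "phi_star_seq \<phi> \<psi> k p q m z =
     (if m < 0 then snd (neg_phi \<phi> \<psi> k p q m z) else poly (reciprocal \<psi> (nat m)) z)"

definition xi_seq where
  "xi_seq w \<phi> \<psi> k p q m z =
     (if m < 0 then fst (neg_xi w \<phi> \<psi> k p q m z) else assoc w \<phi> (nat m) z)"

definition xi_star_seq where
  "xi_star_seq w \<phi> \<psi> k p q m z =
     (if m < 0 then snd (neg_xi w \<phi> \<psi> k p q m z) else assoc_star w \<psi> (nat m) z)"

definition numer :: "complex list \<Rightarrow> complex list \<Rightarrow> complex \<Rightarrow> complex" where
  "numer as bs z = (\<Prod>a\<leftarrow>as. z - a) * (\<Prod>b\<leftarrow>bs. 1 - b / z)"

definition modified_weight ::
  "complex list \<Rightarrow> complex list \<Rightarrow> complex list \<Rightarrow> complex list \<Rightarrow>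
   (complex \<Rightarrow> complex) \<Rightarrow> complex \<Rightarrow> complex" where
  "modified_weight \<alpha> \<alpha>s \<beta> \<beta>s w z = numer \<alpha> \<alpha>s z / numer \<beta> \<beta>s z * w z"

definition det_row ::
  "nat \<Rightarrow> nat \<Rightarrow> nat \<Rightarrow> nat \<Rightarrow> nat \<Rightarrow> (int \<Rightarrow> complex \<Rightarrow> complex) \<Rightarrow> complex \<Rightarrow> complex list" where
  "det_row K Ks L Ls n a z =
     map (\<lambda>c. z ^ (L - c) * a (int n - int Ls - int L + int c) z) [0..<L] @
     map (\<lambda>c. a (int n - int Ls + int c) z) [0..<Ls] @
     map (\<lambda>c. z powi (- int c) * a (int n + int c) z) [0..<Ks + 1] @
     map (\<lambda>c. z powi (- int Ks) * a (int n + int Ks + int c) z) [1..<K + 1]"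

definition bordered_det ::
  "complex list \<Rightarrow> complex list \<Rightarrow> complex list \<Rightarrow> complex list \<Rightarrow> nat \<Rightarrow>
   (int \<Rightarrow> complex \<Rightarrow> complex) \<Rightarrow> (int \<Rightarrow> complex \<Rightarrow> complex) \<Rightarrow> (int \<Rightarrow> complex \<Rightarrow> complex) \<Rightarrow>
   complex \<Rightarrow> complex" where
  "bordered_det \<alpha> \<alpha>s \<beta> \<beta>s n a p x z =
     (let v = det_row (length \<alpha>) (length \<alpha>s) (length \<beta>) (length \<beta>s) n in
      Determinant.det
        (mat_of_rows_list (length \<alpha> + length \<alpha>s + length \<beta> + length \<beta>s + 1)
          (v a z # map (v p) \<alpha> @ map (v p) \<alpha>s @ map (v x) \<beta> @ map (v x) \<beta>s)))"

end

theory Submission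
  imports Defs
begin

text \<open>
  Every column of the determinant is a pair \<open>(z\<^sup>s \<phi>\<^sub>m, z\<^sup>s \<xi>\<^sub>m)\<close>, and a linear combination of the
  columns is annihilated by the lower rows iff its first component \<open>G\<close> vanishes at the \<open>\<alpha>\<close>'s and
  its second component \<open>Y\<close> at the \<open>\<beta>\<close>'s. Then \<open>G = A h\<close> with \<open>A\<close> the numerator of the modification
  and \<open>h\<close> a polynomial of degree at most \<open>n\<close>. With \<open>B\<close> the denominator and \<open>S\<close> the associated
  function of \<open>h\<close> for the modified weight, \<open>B S - Y\<close> is a Laurent polynomial vanishing at the
  \<open>\<beta>\<close>'s, hence \<open>B Q\<close> with a Laurent polynomial \<open>Q\<close>; the growth of \<open>Y\<close> at \<open>0\<close> and at infinity
  forces \<open>Q = 0\<close>. So \<open>S = Y / B\<close> is \<open>O(z\<^sup>n)\<close> at \<open>0\<close>, which is the orthogonality that makes \<open>h\<close>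
  a multiple of \<open>\<Phi>\<^sub>n\<close>. The supports of consecutive columns differ by one exponent, so the columns are
  independent; hence the kernel is one-dimensional and spanned by the cofactors of the first row.
\<close>

section \<open>Integration against the weight\<close>

text \<open>The shape of the columns carries the argument. Column \<open>j\<close> is
  \<open>z powi s j\<close> times the function of index \<open>m j\<close>; \<open>m j\<close> rises
  by one per column, while \<open>s j\<close> stays or falls by one. With \<open>K\<close>,
  \<open>Ks\<close>, \<open>L\<close>, \<open>Ls\<close> the lengths of the four parameter lists,
  this arranges four bounds. \<open>s j \<ge> - Ks\<close> and \<open>s j + m j \<le> n + K\<close>
  control the pole and the degree of \<open>G\<close>, so that division by \<open>A\<close> leaves
  degree at most \<open>n\<close>. \<open>s j + m j \<ge> n - Ls\<close> is the order of
  \<open>Y\<close> at 0 and \<open>s j \<le> L\<close> governs its growth at infinity; they are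
  matched to \<open>1 / B\<close>, so that \<open>Y / B\<close> becomes O(z^n) and O(1/z). The
  Laurent discrepancy between \<open>Y\<close> and a Cauchy transform has two sources: moving
  \<open>z powi s\<close> through the integral, and the columns of negative index, whose first
  component is zero and whose second is itself a Laurent polynomial. This is how small
  \<open>n\<close> is covered. All estimates are made off the unit circle, where Cauchy transforms
  of a merely integrable weight exist; the identity for the associated functions at the origin is
  reached by continuity.\<close>

definition wint :: "(complex \<Rightarrow> complex) \<Rightarrow> (complex \<Rightarrow> complex) \<Rightarrow> complex" where
  "wint w g = circle_int (\<lambda>\<zeta>. w \<zeta> * g \<zeta>)"

lemma circlepath_in_sphere: "circlepath 0 1 t \<in> sphere 0 1"
  by (simp add: circlepath norm_mult)

text \<open>The parametrisation has derivative \<open>2 * pi * \<i> * \<zeta>\<close>, which cancels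
  the normalising denominator: \<open>circle_int\<close> is a plain mean over the parameter
  interval.\<close>

lemma circle_int_eq_integral:
  "circle_int f = integral {0..1} (\<lambda>t. f (circlepath 0 1 t))"
  unfolding circle_int_def contour_integral_integral
  by (rule integral_cong) (simp only: vector_derivative_circlepath, simp add: circlepath)

lemma wint_eq_integral:
  "wint w g = integral {0..1} (\<lambda>t. w (circlepath 0 1 t) * g (circlepath 0 1 t))"
  by (simp add: wint_def circle_int_eq_integral)

lemma circle_int_cong:
  assumes "\<And>\<zeta>. norm \<zeta> = 1 \<Longrightarrow> f \<zeta> = g \<zeta>"
  shows "circle_int f = circle_int g"
  unfolding circle_int_eq_integral
  by (rule integral_cong) (use circlepath_in_sphere assms in auto)

lemma wint_cong:
  assumes "\<And>\<zeta>. norm \<zeta> = 1 \<Longrightarrow> f \<zeta> = g \<zeta>"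
  shows "wint w f = wint w g"
  unfolding wint_def by (rule circle_int_cong) (simp add: assms)

text \<open>The weight is only integrable, so integrands are kept as weight times a factor
  continuous on the circle; such a factor is bounded and measurable.\<close>

lemma wint_product_absolutely_integrable:
  assumes w: "circle_weight w" and g: "continuous_on (sphere 0 1) g"
  shows "(\<lambda>t. w (circlepath 0 1 t) * g (circlepath 0 1 t)) absolutely_integrable_on {0..1}"
proof -
  have c: "continuous_on {0..1} (\<lambda>t. g (circlepath 0 1 t))"
    by (rule continuous_on_compose2[OF g])
       (use circlepath_in_sphere in \<open>auto intro!: continuous_intros simp: circlepath_def part_circlepath_def\<close>)
  have "(\<lambda>t. (\<lambda>a b. b * a) (g (circlepath 0 1 t)) (w (circlepath 0 1 t)))
          absolutely_integrable_on {0..1}"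
  proof (rule absolutely_integrable_bounded_measurable_product[where h = "\<lambda>a b. b * a :: complex"])
    show "bilinear (\<lambda>a b. b * a :: complex)"
      by (simp add: bilinear_def linear_iff algebra_simps)
    show "(\<lambda>t. g (circlepath 0 1 t)) \<in> borel_measurable (lebesgue_on {0..1})"
      using c by (rule continuous_imp_measurable_on_sets_lebesgue) simp
    show "bounded ((\<lambda>t. g (circlepath 0 1 t)) ` {0..1})"
      using c compact_continuous_image compact_imp_bounded by blast
  qed (use w in \<open>auto simp: circle_weight_def\<close>)
  then show ?thesis by simp
qed

lemma wint_product_integrable:
  assumes "circle_weight w" "continuous_on (sphere 0 1) g"
  shows "(\<lambda>t. w (circlepath 0 1 t) * g (circlepath 0 1 t)) integrable_on {0..1}"
  using wint_product_absolutely_integrable[OF assms] absolutely_integrable_on_def by blast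

lemma wint_cmult: "wint w (\<lambda>\<zeta>. c * g \<zeta>) = c * wint w g"
  unfolding wint_eq_integral by (simp add: mult.left_commute)

lemma wint_add:
  assumes "circle_weight w" "continuous_on (sphere 0 1) f" "continuous_on (sphere 0 1) g"
  shows "wint w (\<lambda>\<zeta>. f \<zeta> + g \<zeta>) = wint w f + wint w g"
  unfolding wint_eq_integral ring_distribs
  by (rule integral_add; rule wint_product_integrable[OF assms(1)]) (use assms in auto)

lemma wint_diff:
  assumes "circle_weight w" "continuous_on (sphere 0 1) f" "continuous_on (sphere 0 1) g"
  shows "wint w (\<lambda>\<zeta>. f \<zeta> - g \<zeta>) = wint w f - wint w g"
  unfolding wint_eq_integral ring_distribs
  by (rule integral_diff; rule wint_product_integrable[OF assms(1)]) (use assms in auto)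

lemma wint_sum:
  assumes "circle_weight w" "finite A" "\<And>i. i \<in> A \<Longrightarrow> continuous_on (sphere 0 1) (f i)"
  shows "wint w (\<lambda>\<zeta>. \<Sum>i\<in>A. f i \<zeta>) = (\<Sum>i\<in>A. wint w (f i))"
  unfolding wint_eq_integral sum_distrib_left
  by (rule integral_sum) (use assms in \<open>auto intro!: wint_product_integrable\<close>)

text \<open>\<open>B\<close> is the L1 norm of the weight. It is fixed before \<open>g\<close>,
  which makes the bound uniform over the remainders \<open>g \<zeta> / \<zeta> ^ n\<close> met
  below.\<close>

lemma wint_bound:
  assumes "circle_weight w"
  obtains B where "B \<ge> 0"
    "\<And>g M. continuous_on (sphere 0 1) g \<Longrightarrow> (\<And>\<zeta>. norm \<zeta> = 1 \<Longrightarrow> norm (g \<zeta>) \<le> M) \<Longrightarrow>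
       norm (wint w g) \<le> B * M"
proof (rule that)
  let ?B = "integral {0..1} (\<lambda>t. norm (w (circlepath 0 1 t)))"
  have int: "(\<lambda>t. norm (w (circlepath 0 1 t))) integrable_on {0..1}"
    using assms unfolding circle_weight_def absolutely_integrable_on_def by blast
  show "?B \<ge> 0" by (rule integral_nonneg[OF int]) auto
  fix g :: "complex \<Rightarrow> complex" and M assume g: "continuous_on (sphere 0 1) g" and M: "\<And>\<zeta>. norm \<zeta> = 1 \<Longrightarrow> norm (g \<zeta>) \<le> M"
  have "norm (wint w g) \<le> integral {0..1} (\<lambda>t. norm (w (circlepath 0 1 t)) * M)"
    unfolding wint_eq_integral
  proof (rule integral_norm_bound_integral)
    show "(\<lambda>t. norm (w (circlepath 0 1 t)) * M) integrable_on {0..1}"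
      by (rule integrable_on_mult_left[OF int])
    show "norm (w (circlepath 0 1 t) * g (circlepath 0 1 t)) \<le> norm (w (circlepath 0 1 t)) * M" for t
      using M[of "circlepath 0 1 t"] circlepath_in_sphere[of t]
      by (auto simp: norm_mult intro!: mult_left_mono)
  qed (rule wint_product_integrable[OF assms g])
  then show "norm (wint w g) \<le> ?B * M" by simp
qed

section \<open>Cauchy transforms: expansion at the origin and growth\<close>

definition cauchy_transform ::
  "(complex \<Rightarrow> complex) \<Rightarrow> (complex \<Rightarrow> complex) \<Rightarrow> complex \<Rightarrow> complex" where
  "cauchy_transform w g z = wint w (\<lambda>\<zeta>. g \<zeta> / (\<zeta> - z))"

text \<open>Iterates \<open>1 / (\<zeta> - z) = 1 / \<zeta> + z / (\<zeta> * (\<zeta> - z))\<close>.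
  The remainder is exact, is again a Cauchy transform, and the identity holds on both sides of the
  circle; so it yields Taylor coefficients and orders of vanishing, and also lets a power of
  \<open>z\<close> be pulled out globally.\<close>

lemma cauchy_transform_expansion:
  assumes w: "circle_weight w" and g: "continuous_on (sphere 0 1) g" and z: "norm z \<noteq> 1"
  shows "cauchy_transform w g z =
    (\<Sum>i<n. wint w (\<lambda>\<zeta>. g \<zeta> / \<zeta> ^ Suc i) * z ^ i) + z ^ n * cauchy_transform w (\<lambda>\<zeta>. g \<zeta> / \<zeta> ^ n) z"
proof (induction n)
  case (Suc n)
  have c: "continuous_on (sphere 0 1) (\<lambda>\<zeta>. g \<zeta> / \<zeta> ^ k)" for k
    using g by (intro continuous_intros) auto
  have "cauchy_transform w (\<lambda>\<zeta>. g \<zeta> / \<zeta> ^ n) z =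
      wint w (\<lambda>\<zeta>. g \<zeta> / \<zeta> ^ Suc n + z * (g \<zeta> / \<zeta> ^ Suc n / (\<zeta> - z)))"
    unfolding cauchy_transform_def
  proof (rule wint_cong)
    fix \<zeta> :: complex assume "norm \<zeta> = 1"
    then have "\<zeta> \<noteq> 0" "\<zeta> - z \<noteq> 0" using z by auto
    then show "g \<zeta> / \<zeta> ^ n / (\<zeta> - z) = g \<zeta> / \<zeta> ^ Suc n + z * (g \<zeta> / \<zeta> ^ Suc n / (\<zeta> - z))"
      by (simp add: field_simps)
  qed
  also have "\<dots> = wint w (\<lambda>\<zeta>. g \<zeta> / \<zeta> ^ Suc n) + z * cauchy_transform w (\<lambda>\<zeta>. g \<zeta> / \<zeta> ^ Suc n) z"
    unfolding cauchy_transform_def wint_cmult[symmetric]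
    by (rule wint_add[OF w c]) (use z g in \<open>auto intro!: continuous_intros\<close>)
  finally show ?case using Suc.IH by (simp add: algebra_simps)
qed simp

text \<open>The distance of \<open>z\<close> from the circle is
  \<open>\<bar>1 - norm z\<bar>\<close>; one bound thus serves near 0 and at infinity.\<close>

lemma norm_cauchy_transform_le:
  assumes w: "circle_weight w" and g: "continuous_on (sphere 0 1) g"
  obtains M where "M \<ge> 0" "\<And>z. norm z \<noteq> 1 \<Longrightarrow> norm (cauchy_transform w g z) \<le> M / \<bar>1 - norm z\<bar>"
proof -
  obtain B where B: "B \<ge> 0" "\<And>g M. continuous_on (sphere 0 1) g \<Longrightarrow>
      (\<And>\<zeta>. norm \<zeta> = 1 \<Longrightarrow> norm (g \<zeta>) \<le> M) \<Longrightarrow> norm (wint w g) \<le> B * M"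
    using wint_bound[OF w] by blast
  have "bounded (g ` sphere 0 1)"
    using g compact_continuous_image[OF g] compact_imp_bounded by auto
  then obtain G where G: "G > 0" "\<And>\<zeta>. norm \<zeta> = 1 \<Longrightarrow> norm (g \<zeta>) \<le> G"
    unfolding bounded_pos by auto
  have "norm (cauchy_transform w g z) \<le> B * (G / \<bar>1 - norm z\<bar>)" if z: "norm z \<noteq> 1" for z
    unfolding cauchy_transform_def
  proof (rule B(2))
    show "continuous_on (sphere 0 1) (\<lambda>\<zeta>. g \<zeta> / (\<zeta> - z))"
      using z g by (intro continuous_intros) auto
    fix \<zeta> :: complex assume "norm \<zeta> = 1"
    then have "\<bar>1 - norm z\<bar> \<le> norm (\<zeta> - z)" using norm_triangle_ineq3[of \<zeta> z] by simp
    then show "norm (g \<zeta> / (\<zeta> - z)) \<le> G / \<bar>1 - norm z\<bar>"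
      unfolding norm_divide using G z \<open>norm \<zeta> = 1\<close> by (intro frac_le) auto
  qed
  then show ?thesis using that[of "B * G"] B G by simp
qed

lemma cauchy_transform_sums:
  assumes w: "circle_weight w" and g: "continuous_on (sphere 0 1) g" and z: "norm z < 1/2"
  shows "(\<lambda>i. wint w (\<lambda>\<zeta>. g \<zeta> / \<zeta> ^ Suc i) * z ^ i) sums cauchy_transform w g z"
proof -
  obtain B where B: "B \<ge> 0" "\<And>g M. continuous_on (sphere 0 1) g \<Longrightarrow>
      (\<And>\<zeta>. norm \<zeta> = 1 \<Longrightarrow> norm (g \<zeta>) \<le> M) \<Longrightarrow> norm (wint w g) \<le> B * M"
    using wint_bound[OF w] by blast
  have "bounded (g ` sphere 0 1)"
    using g compact_continuous_image[OF g] compact_imp_bounded by auto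
  then obtain G where G: "G > 0" "\<And>\<zeta>. norm \<zeta> = 1 \<Longrightarrow> norm (g \<zeta>) \<le> G"
    unfolding bounded_pos by auto
  \<comment> \<open>The bound is the same for all \<open>n\<close>: \<open>\<zeta> ^ n\<close> has
    modulus one on the circle, and \<open>z\<close> keeps distance at least 1/2 from it.\<close>
  have "norm (cauchy_transform w (\<lambda>\<zeta>. g \<zeta> / \<zeta> ^ n) z) \<le> B * (G / (1/2))" for n
    unfolding cauchy_transform_def
  proof (rule B(2))
    show "continuous_on (sphere 0 1) (\<lambda>\<zeta>. g \<zeta> / \<zeta> ^ n / (\<zeta> - z))"
      using z g by (intro continuous_intros) auto
    fix \<zeta> :: complex assume "norm \<zeta> = 1"
    then have "1/2 \<le> norm (\<zeta> - z)" using norm_triangle_ineq2[of \<zeta> z] z by simp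
    then show "norm (g \<zeta> / \<zeta> ^ n / (\<zeta> - z)) \<le> G / (1/2)"
      unfolding norm_divide norm_power \<open>norm \<zeta> = 1\<close> using G z \<open>norm \<zeta> = 1\<close>
      by (intro frac_le) auto
  qed
  then have "(\<lambda>n. z ^ n * cauchy_transform w (\<lambda>\<zeta>. g \<zeta> / \<zeta> ^ n) z) \<longlonglongrightarrow> 0"
    by (intro lim_null_mult_right_bounded[where B = "B * (G / (1/2))"] LIMSEQ_power_zero)
       (use z in auto)
  then have "(\<lambda>n. cauchy_transform w g z - z ^ n * cauchy_transform w (\<lambda>\<zeta>. g \<zeta> / \<zeta> ^ n) z)
       \<longlonglongrightarrow> cauchy_transform w g z - 0"
    by (intro tendsto_intros)
  moreover have "(\<Sum>i<n. wint w (\<lambda>\<zeta>. g \<zeta> / \<zeta> ^ Suc i) * z ^ i) =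
     cauchy_transform w g z - z ^ n * cauchy_transform w (\<lambda>\<zeta>. g \<zeta> / \<zeta> ^ n) z" for n
    using cauchy_transform_expansion[OF w g, of z n] z by simp
  ultimately show ?thesis by (simp add: sums_def)
qed

lemma cauchy_transform_has_fps_expansion:
  assumes w: "circle_weight w" and g: "continuous_on (sphere 0 1) g"
  shows "cauchy_transform w g has_fps_expansion Abs_fps (\<lambda>i. wint w (\<lambda>\<zeta>. g \<zeta> / \<zeta> ^ Suc i))"
proof (rule has_fps_expansionI)
  have "\<forall>\<^sub>F z in nhds 0. norm (z::complex) < 1/2"
    unfolding eventually_nhds_metric by (intro exI[of _ "1/2"]) auto
  then show "\<forall>\<^sub>F z in nhds 0. (\<lambda>i. Abs_fps (\<lambda>i. wint w (\<lambda>\<zeta>. g \<zeta> / \<zeta> ^ Suc i)) $ i * z ^ i)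
      sums cauchy_transform w g z"
    by eventually_elim (use cauchy_transform_sums[OF w g] in simp)
qed

lemma eventually_at_0_norm_less:
  "\<forall>\<^sub>F z in at (0::complex). norm z < 1/2 \<and> z \<noteq> 0"
  unfolding eventually_at by (intro exI[of _ "1/2"]) auto

lemma eventually_at_infinity_norm_ge: "\<forall>\<^sub>F z in at_infinity. norm (z::complex) \<ge> r"
  unfolding eventually_at_infinity by auto

lemma cauchy_transform_bigo_infinity:
  assumes w: "circle_weight w" and g: "continuous_on (sphere 0 1) g"
  shows "cauchy_transform w g \<in> O[at_infinity](\<lambda>z. 1 / z)"
proof -
  obtain M where M: "M \<ge> 0"
    "\<And>z. norm z \<noteq> 1 \<Longrightarrow> norm (cauchy_transform w g z) \<le> M / \<bar>1 - norm z\<bar>"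
    using norm_cauchy_transform_le[OF w g] by blast
  show ?thesis
  proof (rule bigoI[of _ "2 * M"])
    show "\<forall>\<^sub>F z in at_infinity. norm (cauchy_transform w g z) \<le> 2 * M * norm (1 / z)"
      using eventually_at_infinity_norm_ge[of 2]
    proof eventually_elim
      case (elim z)
      then have "M / \<bar>1 - norm z\<bar> \<le> M / (norm z / 2)"
        using M elim by (intro frac_le) auto
      then show ?case using M(2)[of z] elim by (simp add: norm_divide mult.commute)
    qed
  qed
qed

lemma cauchy_transform_remainder_bigo:
  assumes w: "circle_weight w" and g: "continuous_on (sphere 0 1) g"
  shows "(\<lambda>z. cauchy_transform w g z - (\<Sum>i<n. wint w (\<lambda>\<zeta>. g \<zeta> / \<zeta> ^ Suc i) * z ^ i))
    \<in> O[at 0](\<lambda>z. z ^ n)"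
proof -
  have c: "continuous_on (sphere 0 1) (\<lambda>\<zeta>. g \<zeta> / \<zeta> ^ n)"
    using g by (intro continuous_intros) auto
  obtain M where M: "M \<ge> 0"
    "\<And>z. norm z \<noteq> 1 \<Longrightarrow> norm (cauchy_transform w (\<lambda>\<zeta>. g \<zeta> / \<zeta> ^ n) z) \<le> M / \<bar>1 - norm z\<bar>"
    using norm_cauchy_transform_le[OF w c] by blast
  show ?thesis
  proof (rule bigoI[of _ "2 * M"])
    show "\<forall>\<^sub>F z in at 0. norm (cauchy_transform w g z -
        (\<Sum>i<n. wint w (\<lambda>\<zeta>. g \<zeta> / \<zeta> ^ Suc i) * z ^ i)) \<le> 2 * M * norm (z ^ n)"
      using eventually_at_0_norm_less
    proof eventually_elim
      case (elim z)
      have "M / \<bar>1 - norm z\<bar> \<le> M / (1 / 2)"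
        using M elim by (intro divide_left_mono) auto
      then have "norm (cauchy_transform w (\<lambda>\<zeta>. g \<zeta> / \<zeta> ^ n) z) \<le> 2 * M"
        using M(2)[of z] elim by simp
      then show ?case
        using cauchy_transform_expansion[OF w g, of z n] elim
        by (simp add: norm_mult mult.commute mult_left_mono)
    qed
  qed
qed

lemma cauchy_transform_bigo_zero:
  assumes "circle_weight w" "continuous_on (sphere 0 1) g"
    and "\<And>i. i < n \<Longrightarrow> wint w (\<lambda>\<zeta>. g \<zeta> / \<zeta> ^ Suc i) = 0"
  shows "cauchy_transform w g \<in> O[at 0](\<lambda>z. z ^ n)"
  using cauchy_transform_remainder_bigo[OF assms(1,2), of n] assms(3) by simp

section \<open>Laurent polynomials\<close>

text \<open>Equality is demanded off the origin only, so the value that division by zero assigns at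
  0 is irrelevant. \<open>M\<close> may exceed the order of the pole.\<close>

definition laurent :: "(complex \<Rightarrow> complex) \<Rightarrow> bool" where
  "laurent f \<longleftrightarrow> (\<exists>p M. \<forall>z. z \<noteq> 0 \<longrightarrow> f z = poly p z / z ^ M)"

lemma laurentI: "(\<And>z. z \<noteq> 0 \<Longrightarrow> f z = poly p z / z ^ M) \<Longrightarrow> laurent f"
  by (auto simp: laurent_def)

lemma laurent_add:
  assumes "laurent f" "laurent g"
  shows "laurent (\<lambda>z. f z + g z)"
proof -
  obtain p M q N where "\<And>z. z \<noteq> 0 \<Longrightarrow> f z = poly p z / z ^ M" "\<And>z. z \<noteq> 0 \<Longrightarrow> g z = poly q z / z ^ N"
    using assms unfolding laurent_def by metis
  then show ?thesis
    by (intro laurentI[of _ "p * monom 1 N + q * monom 1 M" "M + N"])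
       (simp add: poly_monom field_simps power_add)
qed

lemma laurent_mult:
  assumes "laurent f" "laurent g"
  shows "laurent (\<lambda>z. f z * g z)"
proof -
  obtain p M q N where "\<And>z. z \<noteq> 0 \<Longrightarrow> f z = poly p z / z ^ M" "\<And>z. z \<noteq> 0 \<Longrightarrow> g z = poly q z / z ^ N"
    using assms unfolding laurent_def by metis
  then show ?thesis
    by (intro laurentI[of _ "p * q" "M + N"]) (simp add: power_add)
qed

lemma laurent_poly: "laurent (poly p)"
  by (rule laurentI[of _ p 0]) simp

lemma laurent_const: "laurent (\<lambda>z. c)"
  by (rule laurentI[of _ "[:c:]" 0]) simp

lemma laurent_cmult: "laurent f \<Longrightarrow> laurent (\<lambda>z. c * f z)"
  by (intro laurent_mult laurent_const)

lemma laurent_sum: "(\<And>i. i \<in> A \<Longrightarrow> laurent (f i)) \<Longrightarrow> laurent (\<lambda>z. \<Sum>i\<in>A. f i z)"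
  by (induction A rule: infinite_finite_induct) (auto intro: laurent_add laurent_const)

lemma laurent_powi: "laurent (\<lambda>z. z powi i)"
proof (cases "i \<ge> 0")
  case True
  then show ?thesis
    by (intro laurentI[of _ "monom 1 (nat i)" 0]) (simp add: poly_monom power_int_def)
next
  case False
  then show ?thesis
    by (intro laurentI[of _ "1" "nat (-i)"]) (simp add: power_int_def field_simps)
qed

lemma laurent_powi_sum:
  assumes "laurent g"
  obtains A c where "finite (A :: int set)" "\<And>z. z \<noteq> 0 \<Longrightarrow> g z = (\<Sum>i\<in>A. c i * z powi i)"
proof -
  obtain p M where p: "\<And>z. z \<noteq> 0 \<Longrightarrow> g z = poly p z / z ^ M"
    using assms unfolding laurent_def by metis
  have "g z = (\<Sum>i\<in>(\<lambda>k. int k - int M) ` {..degree p}. coeff p (nat (i + int M)) * z powi i)"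
    if z: "z \<noteq> 0" for z
  proof -
    have "(\<Sum>i\<in>(\<lambda>k. int k - int M) ` {..degree p}. coeff p (nat (i + int M)) * z powi i) =
        (\<Sum>k\<le>degree p. coeff p k * z powi (int k - int M))"
      by (subst sum.reindex) (auto simp: inj_on_def)
    also have "\<dots> = (\<Sum>k\<le>degree p. coeff p k * z ^ k / z ^ M)"
      by (rule sum.cong) (use z in \<open>simp_all add: power_int_diff\<close>)
    also have "\<dots> = g z"
      by (simp only: p[OF z] poly_altdef sum_divide_distrib)
    finally show ?thesis by simp
  qed
  then show ?thesis
    by (intro that[of "(\<lambda>k. int k - int M) ` {..degree p}" "\<lambda>i. coeff p (nat (i + int M))"]) auto
qed

text \<open>A geometric sum for either sign of \<open>i\<close>; the quotient is minus the sum for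
  \<open>i \<ge> 0\<close> and plus the sum otherwise, whence \<open>\<sigma>\<close>. Every term
  separates \<open>z\<close> from \<open>\<zeta>\<close>, so integration over \<open>\<zeta>\<close>
  leaves a Laurent polynomial in \<open>z\<close>.\<close>

lemma powi_difference_quotient:
  obtains A :: "nat set" and r s :: "nat \<Rightarrow> int" and \<sigma> :: complex where "finite A"
    "\<And>z \<zeta>. z \<noteq> 0 \<Longrightarrow> \<zeta> \<noteq> 0 \<Longrightarrow> \<zeta> \<noteq> z \<Longrightarrow>
       (z powi i - \<zeta> powi i) / (\<zeta> - z) = (\<Sum>l\<in>A. \<sigma> * z powi r l * \<zeta> powi s l)"
proof (cases "i \<ge> 0")
  case True
  define n where "n = nat i"
  have i: "i = int n" using True by (simp add: n_def)
  show ?thesis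
  proof (rule that[of "{..<n}" "-1" "\<lambda>l. int (n - Suc l)" "\<lambda>l. int l"])
    fix z \<zeta> :: complex assume *: "z \<noteq> 0" "\<zeta> \<noteq> 0" "\<zeta> \<noteq> z"
    have "\<zeta> ^ n - z ^ n = (\<zeta> - z) * (\<Sum>l<n. z ^ (n - Suc l) * \<zeta> ^ l)"
      by (rule power_diff_sumr2)
    then have "z ^ n - \<zeta> ^ n = - (\<Sum>l<n. z ^ (n - Suc l) * \<zeta> ^ l) * (\<zeta> - z)"
      by (simp add: algebra_simps)
    then have "(z ^ n - \<zeta> ^ n) / (\<zeta> - z) = - (\<Sum>l<n. z ^ (n - Suc l) * \<zeta> ^ l)"
      using * by (simp add: nonzero_divide_eq_eq)
    then show "(z powi i - \<zeta> powi i) / (\<zeta> - z) =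
        (\<Sum>l<n. - 1 * z powi int (n - Suc l) * \<zeta> powi int l)"
      by (simp only: i power_int_of_nat mult_minus1 mult_1 mult_minus_left sum_negf)
  qed simp
next
  case False
  define n where "n = nat (-i)"
  have i: "i = - int n" using False by (simp add: n_def)
  show ?thesis
  proof (rule that[of "{..<n}" "1" "\<lambda>l. int (n - Suc l) - int n" "\<lambda>l. int l - int n"])
    fix z \<zeta> :: complex assume *: "z \<noteq> 0" "\<zeta> \<noteq> 0" "\<zeta> \<noteq> z"
    have "\<zeta> ^ n - z ^ n = (\<zeta> - z) * (\<Sum>l<n. z ^ (n - Suc l) * \<zeta> ^ l)"
      by (rule power_diff_sumr2)
    moreover have "z powi i - \<zeta> powi i = (\<zeta> ^ n - z ^ n) / (z ^ n * \<zeta> ^ n)"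
      using * by (simp add: i power_int_minus field_simps)
    ultimately have "(z powi i - \<zeta> powi i) / (\<zeta> - z) =
        (\<Sum>l<n. z ^ (n - Suc l) * \<zeta> ^ l) / (z ^ n * \<zeta> ^ n)"
      using * by simp
    also have "\<dots> = (\<Sum>l<n. 1 * z powi (int (n - Suc l) - int n) * \<zeta> powi (int l - int n))"
      unfolding sum_divide_distrib
    proof (intro sum.cong refl)
      fix l
      have "z powi (int (n - Suc l) - int n) = z ^ (n - Suc l) / z ^ n"
        using * by (simp only: power_int_diff power_int_of_nat simp_thms)
      moreover have "\<zeta> powi (int l - int n) = \<zeta> ^ l / \<zeta> ^ n"
        using * by (simp only: power_int_diff power_int_of_nat simp_thms)
      ultimately show "z ^ (n - Suc l) * \<zeta> ^ l / (z ^ n * \<zeta> ^ n) =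
          1 * z powi (int (n - Suc l) - int n) * \<zeta> powi (int l - int n)" by simp
    qed
    finally show "(z powi i - \<zeta> powi i) / (\<zeta> - z) =
        (\<Sum>l<n. 1 * z powi (int (n - Suc l) - int n) * \<zeta> powi (int l - int n))" .
  qed simp
qed

text \<open>The price of moving a Laurent factor from outside a Cauchy transform to its inside:
  \<open>g z / (\<zeta> - z)\<close> and \<open>g \<zeta> / (\<zeta> - z)\<close> differ by a kernel
  without a pole at \<open>\<zeta> = z\<close>. It is applied to the denominator of the modification
  and to the powers in the columns.\<close>

lemma laurent_wint_difference_quotient:
  assumes w: "circle_weight w" and v: "continuous_on (sphere 0 1) v" and g: "laurent g"
  obtains P where "laurent P" "\<And>z. z \<noteq> 0 \<Longrightarrow> norm z \<noteq> 1 \<Longrightarrow>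
     wint w (\<lambda>\<zeta>. (g z - g \<zeta>) / (\<zeta> - z) * v \<zeta>) = P z"
proof -
  have mono: "\<exists>P. laurent P \<and> (\<forall>z. z \<noteq> 0 \<longrightarrow> norm z \<noteq> 1 \<longrightarrow>
     wint w (\<lambda>\<zeta>. (z powi i - \<zeta> powi i) / (\<zeta> - z) * v \<zeta>) = P z)" for i
  proof -
    obtain A :: "nat set" and r s :: "nat \<Rightarrow> int" and \<sigma> :: complex where A: "finite A"
      "\<And>z \<zeta>. z \<noteq> 0 \<Longrightarrow> \<zeta> \<noteq> 0 \<Longrightarrow> \<zeta> \<noteq> z \<Longrightarrow>
         (z powi i - \<zeta> powi i) / (\<zeta> - z) = (\<Sum>l\<in>A. \<sigma> * z powi r l * \<zeta> powi s l)"
      by (rule powi_difference_quotient[of i]) (rule that)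
    let ?P = "\<lambda>z. \<Sum>l\<in>A. (\<sigma> * wint w (\<lambda>\<zeta>. \<zeta> powi s l * v \<zeta>)) * z powi r l"
    have "wint w (\<lambda>\<zeta>. (z powi i - \<zeta> powi i) / (\<zeta> - z) * v \<zeta>) = ?P z"
      if z: "z \<noteq> 0" "norm z \<noteq> 1" for z
    proof -
      have "wint w (\<lambda>\<zeta>. (z powi i - \<zeta> powi i) / (\<zeta> - z) * v \<zeta>) =
          wint w (\<lambda>\<zeta>. \<Sum>l\<in>A. \<sigma> * z powi r l * (\<zeta> powi s l * v \<zeta>))"
      proof (rule wint_cong)
        fix \<zeta> :: complex assume "norm \<zeta> = 1"
        then have "\<zeta> \<noteq> 0" "\<zeta> \<noteq> z" using z by auto
        from A(2)[OF z(1) this]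
        show "(z powi i - \<zeta> powi i) / (\<zeta> - z) * v \<zeta> = (\<Sum>l\<in>A. \<sigma> * z powi r l * (\<zeta> powi s l * v \<zeta>))"
          by (simp add: sum_distrib_right mult.assoc)
      qed
      also have "\<dots> = ?P z"
      proof (subst wint_sum[OF w A(1)])
        show "continuous_on (sphere 0 1) (\<lambda>\<zeta>. \<sigma> * z powi r l * (\<zeta> powi s l * v \<zeta>))" for l
          using v by (auto intro!: continuous_intros)
        show "(\<Sum>l\<in>A. wint w (\<lambda>\<zeta>. \<sigma> * z powi r l * (\<zeta> powi s l * v \<zeta>))) = ?P z"
          unfolding wint_cmult by (simp only: mult_ac)
      qed
      finally show ?thesis .
    qed
    moreover have "laurent ?P" by (intro laurent_sum laurent_cmult laurent_powi)
    ultimately show ?thesis by blast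
  qed
  obtain P where P: "\<And>i. laurent (P i)" "\<And>i z. z \<noteq> 0 \<Longrightarrow> norm z \<noteq> 1 \<Longrightarrow>
     wint w (\<lambda>\<zeta>. (z powi i - \<zeta> powi i) / (\<zeta> - z) * v \<zeta>) = P i z"
    using mono by metis
  obtain A c where A: "finite (A :: int set)" "\<And>z. z \<noteq> 0 \<Longrightarrow> g z = (\<Sum>i\<in>A. c i * z powi i)"
    by (rule laurent_powi_sum[OF g]) (rule that)
  show ?thesis
  proof
    show "laurent (\<lambda>z. \<Sum>i\<in>A. c i * P i z)" by (intro laurent_sum laurent_cmult P)
    fix z :: complex assume z: "z \<noteq> 0" "norm z \<noteq> 1"
    have "wint w (\<lambda>\<zeta>. (g z - g \<zeta>) / (\<zeta> - z) * v \<zeta>) =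
       wint w (\<lambda>\<zeta>. \<Sum>i\<in>A. c i * ((z powi i - \<zeta> powi i) / (\<zeta> - z) * v \<zeta>))"
    proof (rule wint_cong)
      fix \<zeta> :: complex assume "norm \<zeta> = 1"
      then have "\<zeta> \<noteq> 0" by auto
      then have "g z - g \<zeta> = (\<Sum>i\<in>A. c i * (z powi i - \<zeta> powi i))"
        by (simp add: A(2) z sum_subtractf right_diff_distrib)
      then show "(g z - g \<zeta>) / (\<zeta> - z) * v \<zeta> = (\<Sum>i\<in>A. c i * ((z powi i - \<zeta> powi i) / (\<zeta> - z) * v \<zeta>))"
        by (simp add: sum_divide_distrib sum_distrib_right mult.assoc)
    qed
    also have "\<dots> = (\<Sum>i\<in>A. c i * P i z)"
    proof (subst wint_sum[OF w A(1)])
      show "continuous_on (sphere 0 1) (\<lambda>\<zeta>. c i * ((z powi i - \<zeta> powi i) / (\<zeta> - z) * v \<zeta>))" for i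
        using v z by (auto intro!: continuous_intros)
      show "(\<Sum>i\<in>A. wint w (\<lambda>\<zeta>. c i * ((z powi i - \<zeta> powi i) / (\<zeta> - z) * v \<zeta>))) =
          (\<Sum>i\<in>A. c i * P i z)"
        unfolding wint_cmult by (simp only: P(2)[OF z])
    qed
    finally show "wint w (\<lambda>\<zeta>. (g z - g \<zeta>) / (\<zeta> - z) * v \<zeta>) = (\<Sum>i\<in>A. c i * P i z)" .
  qed
qed

section \<open>Vanishing of polynomials and Laurent polynomials from growth bounds\<close>

lemma coeff_eq_0_of_poly_bigo:
  fixes p :: "complex poly"
  assumes "poly p \<in> O[at 0](\<lambda>z. z ^ n)" "i < n"
  shows "coeff p i = 0"
  using assms
proof (induction n arbitrary: p i)
  case (Suc n)
  obtain a q where p: "p = pCons a q" by (cases p)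
  have lim: "(poly p \<longlongrightarrow> 0) (at 0)"
  proof -
    obtain c where c: "\<forall>\<^sub>F z in at 0. norm (poly p z) \<le> c * norm (z ^ Suc n)"
      using Suc.prems(1) by (auto simp: bigo_def)
    show ?thesis
    proof (rule tendsto_0_le)
      from c show "\<forall>\<^sub>F z in at 0. norm (poly p z) \<le> norm (z ^ Suc n) * c"
        by (simp add: mult.commute)
      show "((\<lambda>z. z ^ Suc n) \<longlongrightarrow> (0::complex)) (at 0)"
        using tendsto_power[OF tendsto_ident_at[of "0::complex" UNIV], of "Suc n"] by simp
    qed
  qed
  moreover have "(poly p \<longlongrightarrow> poly p 0) (at 0)"
    using isCont_def poly_isCont by blast
  ultimately have "poly p 0 = 0" by (rule tendsto_unique[OF at_neq_bot, symmetric])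
  then have a: "a = 0" by (simp add: p)
  obtain c where c: "\<forall>\<^sub>F z in at 0. norm (poly p z) \<le> c * norm (z ^ Suc n)"
    using Suc.prems(1) by (auto simp: bigo_def)
  have "poly q \<in> O[at 0](\<lambda>z. z ^ n)"
  proof (rule bigoI)
    show "\<forall>\<^sub>F z in at 0. norm (poly q z) \<le> c * norm (z ^ n)"
      using c eventually_at_0_norm_less
    proof eventually_elim
      case (elim z)
      have "norm z * norm (poly q z) = norm (poly p z)" by (simp add: p a norm_mult)
      also have "\<dots> \<le> norm z * (c * norm (z ^ n))"
        using elim by (simp add: norm_mult norm_power ac_simps)
      finally show ?case using elim by simp
    qed
  qed
  then have "coeff q j = 0" if "j < n" for j using Suc.IH that by blast
  then show ?case using Suc.prems(2) by (cases i) (simp_all add: p a)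
next
  case 0
  from 0(2) show ?case by simp
qed

lemma poly_tendsto_0_at_infinity:
  fixes p :: "complex poly"
  assumes "(poly p \<longlongrightarrow> 0) at_infinity"
  shows "p = 0"
proof (cases "degree p = 0")
  case True
  then obtain a where p: "p = [:a:]" by (meson degree_eq_zeroE)
  then have "poly p = (\<lambda>_. a)" by (simp add: fun_eq_iff)
  then have "((\<lambda>z::complex. a) \<longlongrightarrow> 0) at_infinity" using assms by simp
  then have "a = 0" by (simp add: tendsto_const_iff[OF trivial_limit_at_infinity])
  then show ?thesis by (simp add: p)
next
  case False
  then have "filterlim (poly p) at_infinity at_infinity"
    by (intro filterlim_poly_at_infinity) auto
  then show ?thesis
    using assms not_tendsto_and_filterlim_at_infinity[OF trivial_limit_at_infinity] by blast
qed

text \<open>A Liouville argument: boundedness at 0 removes the negative powers, decay at infinity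
  removes the rest.\<close>

lemma laurent_eq_0:
  assumes f: "laurent f" "f \<in> O[at 0](\<lambda>_. 1)" "f \<in> O[at_infinity](\<lambda>z. 1 / z)" and z: "z \<noteq> 0"
  shows "f z = 0"
proof -
  obtain p M where p: "\<And>z. z \<noteq> 0 \<Longrightarrow> f z = poly p z / z ^ M"
    using f unfolding laurent_def by metis
  have ev0: "\<forall>\<^sub>F z in at 0. z \<noteq> (0::complex)" by (simp add: eventually_at_filter)
  have evi: "\<forall>\<^sub>F z in at_infinity. z \<noteq> (0::complex)"
    using eventually_at_infinity_norm_ge[of 1] by eventually_elim auto
  have "(\<lambda>z. f z * z ^ M) \<in> O[at 0](\<lambda>z. 1 * z ^ M)"
    by (intro landau_o.big.mult f) auto
  also have "(\<lambda>z. f z * z ^ M) \<in> O[at 0](\<lambda>z. 1 * z ^ M) \<longleftrightarrow> poly p \<in> O[at 0](\<lambda>z. z ^ M)"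
    by (rule landau_o.big.in_cong[THEN trans]) 
       (use ev0 in \<open>eventually_elim, simp add: p\<close>, simp)
  finally have "\<And>i. i < M \<Longrightarrow> coeff p i = 0" using coeff_eq_0_of_poly_bigo by blast
  then have "monom 1 M dvd p" by (simp add: monom_1_dvd_iff')
  then obtain q where q: "p = monom 1 M * q" by (elim dvdE)
  have fq: "f z = poly q z" if "z \<noteq> 0" for z using p[OF that] that by (simp add: q poly_monom)
  have "(f \<longlongrightarrow> 0) at_infinity"
  proof -
    obtain c where c: "\<forall>\<^sub>F z in at_infinity. norm (f z) \<le> c * norm (1 / z)"
      using f(3) by (auto simp: bigo_def)
    show ?thesis
    proof (rule tendsto_0_le)
      from c show "\<forall>\<^sub>F z in at_infinity. norm (f z) \<le> norm (1 / z) * c"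
        by (simp add: mult.commute)
      show "((\<lambda>z. 1 / z) \<longlongrightarrow> (0::complex)) at_infinity"
        by (simp add: tendsto_inverse_0 divide_inverse)
    qed
  qed
  also have "(f \<longlongrightarrow> 0) at_infinity \<longleftrightarrow> (poly q \<longlongrightarrow> 0) at_infinity"
    by (rule filterlim_cong) (use evi in \<open>auto simp: fq elim!: eventually_mono\<close>)
  finally have "q = 0" by (rule poly_tendsto_0_at_infinity)
  then show ?thesis using fq z by simp
qed

section \<open>Polynomials with prescribed roots and the factors of the modification\<close>

definition roots_poly :: "complex list \<Rightarrow> complex poly" where
  "roots_poly xs = (\<Prod>a\<leftarrow>xs. [:- a, 1:])"

lemma roots_poly_Nil [simp]: "roots_poly [] = 1"
  by (simp add: roots_poly_def)

lemma roots_poly_Cons: "roots_poly (a # xs) = [:- a, 1:] * roots_poly xs"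
  by (simp add: roots_poly_def)

lemma poly_roots_poly: "poly (roots_poly xs) z = (\<Prod>a\<leftarrow>xs. z - a)"
  by (induction xs) (simp_all add: roots_poly_Cons algebra_simps)

lemma poly_roots_poly_eq_0_iff: "poly (roots_poly xs) z = 0 \<longleftrightarrow> z \<in> set xs"
  by (induction xs) (auto simp: poly_roots_poly)

lemma roots_poly_neq_0 [simp]: "roots_poly xs \<noteq> 0"
proof (induction xs)
  case (Cons a xs)
  then show ?case unfolding roots_poly_Cons mult_eq_0_iff by simp
qed simp

lemma degree_roots_poly [simp]: "degree (roots_poly xs) = length xs"
proof (induction xs)
  case (Cons a xs)
  then show ?case
    unfolding roots_poly_Cons by (subst degree_mult_eq) simp_all
qed simp

lemma roots_poly_dvd:
  assumes "distinct xs" "\<And>a. a \<in> set xs \<Longrightarrow> poly p a = 0"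
  shows "roots_poly xs dvd p"
  using assms
proof (induction xs arbitrary: p)
  case (Cons a xs)
  then have "[:- a, 1:] dvd p" by (simp add: poly_eq_0_iff_dvd)
  then obtain q where q: "p = [:- a, 1:] * q" by (elim dvdE)
  have "roots_poly xs dvd q"
  proof (rule Cons.IH)
    fix b assume "b \<in> set xs"
    then have "poly p b = 0" "b \<noteq> a" using Cons.prems by auto
    then show "poly q b = 0" by (simp add: q)
  qed (use Cons.prems in auto)
  then show ?case unfolding q roots_poly_Cons by (rule mult_dvd_mono[OF dvd_refl])
qed simp

lemma numer_eq_roots_poly:
  assumes "z \<noteq> 0 \<or> bs = []"
  shows "numer as bs z = poly (roots_poly (as @ bs)) z / z ^ length bs"
proof -
  have "(\<Prod>b\<leftarrow>bs. 1 - b / z) = (\<Prod>b\<leftarrow>bs. z - b) / z ^ length bs"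
    using assms by (induction bs) (auto simp: field_simps)
  then show ?thesis by (simp add: numer_def poly_roots_poly)
qed

lemma laurent_numer: "laurent (numer as bs)"
  by (rule laurentI) (simp add: numer_eq_roots_poly)

lemma numer_eq_0_iff: "z \<noteq> 0 \<Longrightarrow> numer as bs z = 0 \<longleftrightarrow> z \<in> set (as @ bs)"
  by (simp add: numer_eq_roots_poly poly_roots_poly_eq_0_iff)

section \<open>Kernel vectors and the modified weight\<close>

lemma circle_weight_mult:
  assumes "circle_weight w" "continuous_on (sphere 0 1) v"
  shows "circle_weight (\<lambda>\<zeta>. v \<zeta> * w \<zeta>)"
  using wint_product_absolutely_integrable[OF assms] by (simp add: circle_weight_def mult.commute)

lemma continuous_on_numer: "continuous_on (sphere 0 1) (numer as bs)"
proof -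
  have "continuous_on (sphere 0 1) (\<lambda>z. poly (roots_poly (as @ bs)) z / z ^ length bs)"
    by (intro continuous_intros) auto
  then show ?thesis
    by (rule continuous_on_eq) (subst numer_eq_roots_poly, auto)
qed

lemma numer_neq_0_circle:
  "\<forall>b \<in> set (as @ bs). norm b \<noteq> 1 \<Longrightarrow> norm \<zeta> = 1 \<Longrightarrow> numer as bs \<zeta> \<noteq> 0"
  by (subst numer_eq_0_iff) auto

lemma circle_weight_modified_weight:
  assumes "circle_weight w" "\<forall>b \<in> set (\<beta> @ \<beta>s). norm b \<noteq> 1"
  shows "circle_weight (modified_weight \<alpha> \<alpha>s \<beta> \<beta>s w)"
proof -
  have "continuous_on (sphere 0 1) (\<lambda>\<zeta>. numer \<alpha> \<alpha>s \<zeta> / numer \<beta> \<beta>s \<zeta>)"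
    using numer_neq_0_circle[OF assms(2)] by (intro continuous_intros continuous_on_numer) auto
  from circle_weight_mult[OF assms(1) this] show ?thesis
    by (simp add: modified_weight_def[abs_def])
qed

lemma wint_modified_weight:
  "wint (modified_weight \<alpha> \<alpha>s \<beta> \<beta>s w) g = wint w (\<lambda>\<zeta>. numer \<alpha> \<alpha>s \<zeta> / numer \<beta> \<beta>s \<zeta> * g \<zeta>)"
  by (simp add: wint_def modified_weight_def mult_ac)

section \<open>Growth of the reciprocals of the modification factors\<close>

lemma bigo_inverse_factor_infinity:
  "(\<lambda>z::complex. 1 / (z - b)) \<in> O[at_infinity](\<lambda>z. 1 / z)"
proof (rule bigoI[of _ 2])
  show "\<forall>\<^sub>F z in at_infinity. norm (1 / (z - b)) \<le> 2 * norm (1 / z)"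
    using eventually_at_infinity_norm_ge[of "2 * norm b + 1"]
  proof eventually_elim
    case (elim z)
    have "norm z - norm b \<le> norm (z - b)" by (rule norm_triangle_ineq2)
    moreover have "norm z > 0" using elim norm_ge_zero[of b] by linarith
    ultimately have "norm z \<le> 2 * norm (z - b)" "norm z > 0" using elim by linarith+
    then show ?case by (simp add: norm_divide divide_simps)
  qed
qed

lemma bigo_inverse_factor_zero:
  assumes "b \<noteq> 0"
  shows "(\<lambda>z::complex. 1 / (z - b)) \<in> O[at 0](\<lambda>_. 1)"
proof (rule bigoI_tendsto)
  show "((\<lambda>z. 1 / (z - b) / 1) \<longlongrightarrow> 1 / (0 - b) / 1) (at 0)"
    using assms by (intro tendsto_intros) auto
qed simp

lemma eventually_neq_0:
  "\<forall>\<^sub>F z in at_infinity. z \<noteq> (0::complex)" "\<forall>\<^sub>F z in at 0. z \<noteq> (0::complex)"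
  using eventually_at_infinity_norm_ge[of 1] by (auto simp: eventually_at_filter elim!: eventually_mono)

text \<open>Each \<open>z - a\<close> contributes \<open>1 / z\<close>, while
  \<open>1 / (1 - b / z) = z / (z - b)\<close> stays bounded.\<close>

lemma bigo_inverse_numer_infinity:
  "(\<lambda>z. 1 / numer as bs z) \<in> O[at_infinity](\<lambda>z. 1 / z ^ length as)"
proof -
  have 1: "(\<lambda>z. 1 / (\<Prod>a\<leftarrow>as. z - a)) \<in> O[at_infinity](\<lambda>z. 1 / z ^ length as)"
  proof (induction as)
    case (Cons a as)
    from landau_o.big.mult[OF bigo_inverse_factor_infinity[of a] Cons] show ?case by simp
  qed simp
  have 2: "(\<lambda>z. 1 / (\<Prod>b\<leftarrow>bs. 1 - b / z)) \<in> O[at_infinity](\<lambda>z. 1)"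
  proof (induction bs)
    case (Cons b bs)
    have "(\<lambda>z. z * (1 / (z - b))) \<in> O[at_infinity](\<lambda>z. z * (1 / z))"
      by (intro landau_o.big.mult bigo_inverse_factor_infinity) simp
    also have "\<dots> = O[at_infinity](\<lambda>_. 1)"
      by (rule landau_o.big.cong) (use eventually_neq_0 in \<open>auto elim!: eventually_mono\<close>)
    also have "(\<lambda>z. z * (1 / (z - b))) \<in> O[at_infinity](\<lambda>_. 1) \<longleftrightarrow>
        (\<lambda>z. 1 / (1 - b / z)) \<in> O[at_infinity](\<lambda>_. 1)"
      by (rule landau_o.big.in_cong)
         (use eventually_neq_0(1) in \<open>auto elim!: eventually_mono simp: field_simps\<close>)
    finally have "(\<lambda>z. 1 / (1 - b / z)) \<in> O[at_infinity](\<lambda>_. 1)" .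
    from landau_o.big.mult[OF this Cons] show ?case by simp
  qed simp
  from landau_o.big.mult[OF 1 2] show ?thesis by (simp add: numer_def)
qed

text \<open>The roles are exchanged at 0: \<open>1 / (z - a)\<close> is bounded and each
  \<open>z / (z - b)\<close> contributes one factor \<open>z\<close>; both estimates rest on nonzero
  roots.\<close>

lemma bigo_inverse_numer_zero:
  assumes "0 \<notin> set (as @ bs)"
  shows "(\<lambda>z. 1 / numer as bs z) \<in> O[at 0](\<lambda>z. z ^ length bs)"
proof -
  have 1: "(\<lambda>z. 1 / (\<Prod>a\<leftarrow>as. z - a)) \<in> O[at 0](\<lambda>z. 1)" if "0 \<notin> set as"
    using that
  proof (induction as)
    case (Cons a as)
    have "(\<lambda>z. 1 / (z - a)) \<in> O[at 0](\<lambda>z. 1)"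
      using Cons.prems by (intro bigo_inverse_factor_zero) auto
    from landau_o.big.mult[OF this Cons.IH] show ?case using Cons.prems by simp
  qed simp
  have 2: "(\<lambda>z. 1 / (\<Prod>b\<leftarrow>bs. 1 - b / z)) \<in> O[at 0](\<lambda>z. z ^ length bs)" if "0 \<notin> set bs"
    using that
  proof (induction bs)
    case (Cons b bs)
    have "(\<lambda>z. z * (1 / (z - b))) \<in> O[at 0](\<lambda>z. z * 1)"
      using Cons.prems by (intro landau_o.big.mult bigo_inverse_factor_zero) auto
    also have "(\<lambda>z. z * (1 / (z - b))) \<in> O[at 0](\<lambda>z. z * 1) \<longleftrightarrow>
        (\<lambda>z. 1 / (1 - b / z)) \<in> O[at 0](\<lambda>z. z * 1)"
      by (rule landau_o.big.in_cong)
         (use eventually_neq_0(2) in \<open>auto elim!: eventually_mono simp: field_simps\<close>)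
    finally have "(\<lambda>z. 1 / (1 - b / z)) \<in> O[at 0](\<lambda>z. z * 1)" .
    from landau_o.big.mult[OF this Cons.IH] Cons.prems show ?case by simp
  qed simp
  from landau_o.big.mult[OF 1 2] assms show ?thesis by (simp add: numer_def)
qed

text \<open>Converse of \<open>cauchy_transform_bigo_zero\<close>. The Taylor polynomial differs
  from the transform by O(z^n), so it is itself O(z^n) although it has only powers below
  \<open>n\<close>. An order of vanishing is thereby turned back into orthogonality.\<close>

lemma wint_eq_0_of_cauchy_transform_bigo:
  assumes w: "circle_weight w" and g: "continuous_on (sphere 0 1) g"
    and O: "cauchy_transform w g \<in> O[at 0](\<lambda>z. z ^ n)" and i: "i < n"
  shows "wint w (\<lambda>\<zeta>. g \<zeta> / \<zeta> ^ Suc i) = 0"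
proof -
  define c where "c i = wint w (\<lambda>\<zeta>. g \<zeta> / \<zeta> ^ Suc i)" for i
  define p where "p = (\<Sum>i<n. monom (c i) i)"
  have "(\<lambda>z. cauchy_transform w g z - (cauchy_transform w g z - (\<Sum>i<n. c i * z ^ i)))
      \<in> O[at 0](\<lambda>z. z ^ n)"
    unfolding c_def by (intro sum_in_bigo O cauchy_transform_remainder_bigo w g)
  moreover have "poly p = (\<lambda>z. \<Sum>i<n. c i * z ^ i)"
    by (simp add: p_def poly_sum poly_monom fun_eq_iff)
  ultimately have "poly p \<in> O[at 0](\<lambda>z. z ^ n)" by simp
  then have "coeff p i = 0" using coeff_eq_0_of_poly_bigo i by blast
  moreover have "coeff p i = c i" using i by (simp add: p_def coeff_sum)
  ultimately show ?thesis by (simp add: c_def)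
qed

text \<open>\<open>poly g z / z ^ length \<alpha>s\<close> and \<open>Y\<close> are the two
  components of a combination of columns, the second one divided by \<open>z\<close> in the starred
  case. The exponents in \<open>Y0\<close> and \<open>Yinf\<close> are tuned to
  \<open>1 / numer \<beta> \<beta>s\<close>, which is \<open>O(z ^ length \<beta>s)\<close> at 0 and
  \<open>O(1 / z ^ length \<beta>)\<close> at infinity.\<close>

theorem transform_of_kernel_vector:
  fixes g :: "complex poly" and w :: "complex \<Rightarrow> complex" and \<alpha> \<alpha>s \<beta> \<beta>s :: "complex list"
  defines "w' \<equiv> modified_weight \<alpha> \<alpha>s \<beta> \<beta>s w"
  assumes w: "circle_weight w" and \<epsilon>: "continuous_on (sphere 0 1) \<epsilon>"
    and \<alpha>: "distinct (\<alpha> @ \<alpha>s)" "\<And>a. a \<in> set (\<alpha> @ \<alpha>s) \<Longrightarrow> poly g a = 0"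
    and deg: "degree g \<le> n + length (\<alpha> @ \<alpha>s)"
    and \<beta>: "distinct (\<beta> @ \<beta>s)" "0 \<notin> set (\<beta> @ \<beta>s)" "\<forall>b \<in> set (\<beta> @ \<beta>s). norm b \<noteq> 1"
      "\<And>b. b \<in> set (\<beta> @ \<beta>s) \<Longrightarrow> Y b = 0"
    and P: "laurent P" "\<And>z. z \<noteq> 0 \<Longrightarrow> norm z \<noteq> 1 \<Longrightarrow>
       Y z = cauchy_transform w (\<lambda>\<zeta>. \<epsilon> \<zeta> * (poly g \<zeta> / \<zeta> ^ length \<alpha>s)) z + P z"
    and Y0: "Y \<in> O[at 0](\<lambda>z. z powi (int n - int (length \<beta>s)))"
    and Yinf: "Y \<in> O[at_infinity](\<lambda>z. z powi (int (length \<beta>) - 1))"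
  obtains h where "degree h \<le> n" "g = roots_poly (\<alpha> @ \<alpha>s) * h"
    "\<And>i. i < n \<Longrightarrow> wint w' (\<lambda>\<zeta>. \<epsilon> \<zeta> * poly h \<zeta> / \<zeta> ^ Suc i) = 0"
    "\<And>z. z \<noteq> 0 \<Longrightarrow> norm z \<noteq> 1 \<Longrightarrow>
       Y z = numer \<beta> \<beta>s z * cauchy_transform w' (\<lambda>\<zeta>. \<epsilon> \<zeta> * poly h \<zeta>) z"
proof -
  let ?A = "numer \<alpha> \<alpha>s" and ?B = "numer \<beta> \<beta>s"
  have "roots_poly (\<alpha> @ \<alpha>s) dvd g" by (rule roots_poly_dvd[OF \<alpha>(1)]) (rule \<alpha>(2))
  then obtain h where h: "g = roots_poly (\<alpha> @ \<alpha>s) * h" by (elim dvdE)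
  let ?S = "cauchy_transform w' (\<lambda>\<zeta>. \<epsilon> \<zeta> * poly h \<zeta>)"
  have deg_h: "degree h \<le> n"
  proof (cases "h = 0")
    case False
    then show ?thesis using deg by (simp add: h degree_mult_eq)
  qed simp
  have w': "circle_weight w'" unfolding w'_def by (rule circle_weight_modified_weight[OF w \<beta>(3)])
  have ch: "continuous_on (sphere 0 1) (\<lambda>\<zeta>. \<epsilon> \<zeta> * poly h \<zeta>)" by (intro continuous_intros \<epsilon>)
  note B0 = numer_neq_0_circle[OF \<beta>(3)]
  \<comment> \<open>Up to the kernel, \<open>?v\<close> is the integrand of \<open>?S\<close>
    against \<open>w\<close>; times \<open>?B\<close> it is the integrand behind \<open>Y\<close>.
    Hence \<open>?B * ?S\<close> and \<open>Y\<close> differ only by Laurent polynomials: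
    \<open>P1\<close> from moving \<open>?B\<close> inside, \<open>P\<close> from the
    hypothesis.\<close>
  let ?v = "\<lambda>\<zeta>. ?A \<zeta> / ?B \<zeta> * (\<epsilon> \<zeta> * poly h \<zeta>)"
  have v: "continuous_on (sphere 0 1) ?v"
    using B0 by (intro continuous_intros continuous_on_numer \<epsilon>) auto
  obtain P1 where P1: "laurent P1" "\<And>z. z \<noteq> 0 \<Longrightarrow> norm z \<noteq> 1 \<Longrightarrow>
     wint w (\<lambda>\<zeta>. (?B z - ?B \<zeta>) / (\<zeta> - z) * ?v \<zeta>) = P1 z"
    by (rule laurent_wint_difference_quotient[OF w v laurent_numer]) (rule that)
  define P2 where "P2 z = P1 z - P z" for z
  have P2: "laurent P2" unfolding P2_def
    using laurent_add[OF P1(1) laurent_cmult[OF P(1), of "-1"]] by simp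
  have diff: "?B z * ?S z - Y z = P2 z" if z: "z \<noteq> 0" "norm z \<noteq> 1" for z
  proof -
    have "P1 z = wint w (\<lambda>\<zeta>. ?B z * (?A \<zeta> / ?B \<zeta> * (\<epsilon> \<zeta> * poly h \<zeta> / (\<zeta> - z))) -
        \<epsilon> \<zeta> * (poly g \<zeta> / \<zeta> ^ length \<alpha>s) / (\<zeta> - z))"
      unfolding P1(2)[OF z, symmetric]
    proof (rule wint_cong)
      fix \<zeta> :: complex assume *: "norm \<zeta> = 1"
      then have "\<zeta> \<noteq> 0" "\<zeta> - z \<noteq> 0" "?B \<zeta> \<noteq> 0" using z B0 by auto
      moreover have "poly g \<zeta> / \<zeta> ^ length \<alpha>s = ?A \<zeta> * poly h \<zeta>"
        using \<open>\<zeta> \<noteq> 0\<close> by (simp add: h numer_eq_roots_poly)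
      ultimately show "(?B z - ?B \<zeta>) / (\<zeta> - z) * ?v \<zeta> =
          ?B z * (?A \<zeta> / ?B \<zeta> * (\<epsilon> \<zeta> * poly h \<zeta> / (\<zeta> - z))) -
          \<epsilon> \<zeta> * (poly g \<zeta> / \<zeta> ^ length \<alpha>s) / (\<zeta> - z)"
        by (simp add: divide_simps) (simp add: algebra_simps)
    qed
    also have "\<dots> = ?B z * ?S z - cauchy_transform w (\<lambda>\<zeta>. \<epsilon> \<zeta> * (poly g \<zeta> / \<zeta> ^ length \<alpha>s)) z"
      unfolding cauchy_transform_def w'_def wint_modified_weight wint_cmult[symmetric]
      by (rule wint_diff[OF w])
         (use B0 z in \<open>auto intro!: continuous_intros continuous_on_numer \<epsilon>\<close>)
    finally show ?thesis using P(2)[OF z] by (simp add: P2_def)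
  qed
  obtain p M where p: "\<And>z. z \<noteq> 0 \<Longrightarrow> P2 z = poly p z / z ^ M"
    using P2 unfolding laurent_def by metis
  \<comment> \<open>Since \<open>norm b \<noteq> 1\<close>, the identity \<open>diff\<close> is
    available at \<open>b\<close> itself, where both \<open>?B\<close> and \<open>Y\<close>
    vanish.\<close>
  have pb: "poly p b = 0" if b: "b \<in> set (\<beta> @ \<beta>s)" for b
  proof -
    have "b \<noteq> 0" "norm b \<noteq> 1" using b \<beta> by auto
    moreover from this have "?B b = 0" using b numer_eq_0_iff[of b \<beta> \<beta>s] by blast
    ultimately have "poly p b / b ^ M = 0" using diff[of b] \<beta>(4)[OF b] p by simp
    then show ?thesis using \<open>b \<noteq> 0\<close> by simp
  qed
  have "roots_poly (\<beta> @ \<beta>s) dvd p" by (rule roots_poly_dvd[OF \<beta>(1)]) (rule pb)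
  then obtain q where q: "p = roots_poly (\<beta> @ \<beta>s) * q"
    by (elim dvdE)
  define Q where "Q z = poly q z * z ^ length \<beta>s / z ^ M" for z
  have P2Q: "P2 z = ?B z * Q z" if "z \<noteq> 0" for z
    using that by (simp add: p q numer_eq_roots_poly Q_def)
  have Q: "laurent Q"
    by (rule laurentI[of _ "q * monom 1 (length \<beta>s)" M]) (simp add: Q_def poly_monom)
  have Q_eq: "Q z = ?S z - Y z * (1 / ?B z)"
    if "z \<noteq> 0" "norm z \<noteq> 1" "z \<notin> set (\<beta> @ \<beta>s)" for z
  proof -
    have "?B z \<noteq> 0" using that by (simp add: numer_eq_0_iff)
    then show ?thesis using diff[OF that(1,2)] P2Q[OF that(1)] by (simp add: field_simps)
  qed
  have Y0': "(\<lambda>z. Y z * (1 / ?B z)) \<in> O[at 0](\<lambda>z. z ^ n)"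
  proof -
    have "(\<lambda>z. Y z * (1 / ?B z)) \<in>
        O[at 0](\<lambda>z. z powi (int n - int (length \<beta>s)) * z ^ length \<beta>s)"
      by (intro landau_o.big.mult Y0 bigo_inverse_numer_zero \<beta>(2))
    also have "\<dots> = O[at 0](\<lambda>z. z ^ n)"
      by (rule landau_o.big.cong)
         (use eventually_neq_0(2) in \<open>auto elim!: eventually_mono simp: power_int_diff\<close>)
    finally show ?thesis .
  qed
  have Yinf': "(\<lambda>z. Y z * (1 / ?B z)) \<in> O[at_infinity](\<lambda>z. 1 / z)"
  proof -
    have "(\<lambda>z. Y z * (1 / ?B z)) \<in>
        O[at_infinity](\<lambda>z. z powi (int (length \<beta>) - 1) * (1 / z ^ length \<beta>))"
      by (intro landau_o.big.mult Yinf bigo_inverse_numer_infinity)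
    also have "\<dots> = O[at_infinity](\<lambda>z. 1 / z)"
      by (rule landau_o.big.cong)
         (use eventually_neq_0(1) in \<open>auto elim!: eventually_mono simp: power_int_diff\<close>)
    finally show ?thesis .
  qed
  have ev0: "\<forall>\<^sub>F z in at 0. z \<noteq> 0 \<and> norm z \<noteq> 1 \<and> z \<notin> set (\<beta> @ \<beta>s)"
  proof -
    have "\<forall>\<^sub>F z in at 0. z \<notin> set (\<beta> @ \<beta>s)"
    proof -
      have "\<forall>\<^sub>F z in nhds 0. z \<in> - set (\<beta> @ \<beta>s)"
        using \<beta>(2) by (intro eventually_nhds_in_open open_Compl finite_imp_closed) auto
      then show ?thesis by (auto simp: eventually_at_filter elim!: eventually_mono)
    qed
    with eventually_at_0_norm_less show ?thesis by eventually_elim auto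
  qed
  have evinf: "\<forall>\<^sub>F z in at_infinity. z \<noteq> 0 \<and> norm z \<noteq> 1 \<and> z \<notin> set (\<beta> @ \<beta>s)"
  proof -
    obtain R where R: "\<forall>z\<in>set (\<beta> @ \<beta>s). norm z \<le> R"
      using finite_imp_bounded[of "set (\<beta> @ \<beta>s)"] unfolding bounded_iff by auto
    show ?thesis using eventually_at_infinity_norm_ge[of "max 2 (R + 1)"]
    proof eventually_elim
      case (elim z)
      then have "\<not> norm z \<le> R" "z \<noteq> 0" "norm z \<noteq> 1" by auto
      moreover from this R have "z \<notin> set (\<beta> @ \<beta>s)" by blast
      ultimately show ?case by blast
    qed
  qed
  have Q0: "Q z = 0" if "z \<noteq> 0" for z
  proof (rule laurent_eq_0[OF Q _ _ that])
    have "(\<lambda>z. ?S z - Y z * (1 / ?B z)) \<in> O[at 0](\<lambda>_. 1)"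
    proof (rule sum_in_bigo)
      show "?S \<in> O[at 0](\<lambda>_. 1)"
        using cauchy_transform_bigo_zero[OF w' ch, of 0] by simp
      have "(\<lambda>z::complex. z ^ n) \<in> O[at 0](\<lambda>_. 1)"
        by (rule bigoI_tendsto[where c = "0 ^ n"]) (auto intro!: tendsto_eq_intros)
      with Y0' show "(\<lambda>z. Y z * (1 / ?B z)) \<in> O[at 0](\<lambda>_. 1)" by (rule landau_o.big_trans)
    qed
    then show "Q \<in> O[at 0](\<lambda>_. 1)"
      by (rule landau_o.big.in_cong[THEN iffD1, rotated])
         (use ev0 in \<open>auto elim!: eventually_mono simp: Q_eq\<close>)
    have "(\<lambda>z. ?S z - Y z * (1 / ?B z)) \<in> O[at_infinity](\<lambda>z. 1 / z)"
      by (rule sum_in_bigo(2)[OF cauchy_transform_bigo_infinity[OF w' ch] Yinf'])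
    then show "Q \<in> O[at_infinity](\<lambda>z. 1 / z)"
      by (rule landau_o.big.in_cong[THEN iffD1, rotated])
         (use evinf in \<open>auto elim!: eventually_mono simp: Q_eq\<close>)
  qed
  show ?thesis
  proof (rule that[OF deg_h h])
    fix i assume "i < n"
    moreover have "?S \<in> O[at 0](\<lambda>z. z ^ n)"
      using Y0'
      by (rule landau_o.big.in_cong[THEN iffD1, rotated])
         (use ev0 in \<open>eventually_elim, use Q_eq Q0 in force\<close>)
    ultimately show "wint w' (\<lambda>\<zeta>. \<epsilon> \<zeta> * poly h \<zeta> / \<zeta> ^ Suc i) = 0"
      by (intro wint_eq_0_of_cauchy_transform_bigo[OF w' ch])
  next
    fix z :: complex assume "z \<noteq> 0" "norm z \<noteq> 1"
    then show "Y z = ?B z * ?S z" using diff[of z] P2Q[of z] Q0[of z] by simp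
  qed
qed

section \<open>Linear algebra\<close>

lemma bordered_mat_null_vector:
  fixes u :: "nat \<Rightarrow> complex" and b :: "nat \<Rightarrow> nat \<Rightarrow> complex"
  assumes "Determinant.det (mat (Suc N) (Suc N) (\<lambda>(r, j). if r = 0 then u j else b (r - 1) j)) = 0"
  obtains c where "\<exists>j\<le>N. c j \<noteq> 0" "(\<Sum>j\<le>N. u j * c j) = 0" "\<forall>r<N. (\<Sum>j\<le>N. b r j * c j) = 0"
proof -
  let ?A = "mat (Suc N) (Suc N) (\<lambda>(r, j). if r = 0 then u j else b (r - 1) j)"
  have "?A \<in> carrier_mat (Suc N) (Suc N)" by simp
  from det_0_iff_vec_prod_zero[OF this] assms obtain v where
    v: "v \<in> carrier_vec (Suc N)" "v \<noteq> 0\<^sub>v (Suc N)" "?A *\<^sub>v v = 0\<^sub>v (Suc N)" by auto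
  have row: "(\<Sum>j\<le>N. (if r = 0 then u j else b (r - 1) j) * v $ j) = 0" if "r < Suc N" for r
  proof -
    have "0 = (?A *\<^sub>v v) $ r" using v(3) that by simp
    also have "\<dots> = (\<Sum>j<Suc N. (if r = 0 then u j else b (r - 1) j) * v $ j)"
      using that v(1) by (simp add: scalar_prod_def atLeast0LessThan)
    finally show ?thesis by (simp only: lessThan_Suc_atMost)
  qed
  show ?thesis
  proof (rule that[of "\<lambda>j. v $ j"])
    show "\<exists>j\<le>N. v $ j \<noteq> 0"
    proof (rule ccontr)
      assume "\<not> (\<exists>j\<le>N. v $ j \<noteq> 0)"
      then have "v = 0\<^sub>v (Suc N)" using v(1) by (intro eq_vecI) auto
      with v(2) show False by simp
    qed
    show "(\<Sum>j\<le>N. u j * v $ j) = 0" using row[of 0] by simp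
    show "\<forall>r<N. (\<Sum>j\<le>N. b r j * v $ j) = 0" using row[of "Suc _"] by simp
  qed
qed

text \<open>The lower rows are \<open>N\<close> equations in \<open>N + 1\<close> unknowns. By
  \<open>ker\<close> every solution is sent to a multiple of \<open>g\<close>, and by
  \<open>ind\<close> it is determined by its image, so the solutions form a line. The cofactors of
  the first row solve the system and their image is the determinant; the point left is that they do
  not all vanish.\<close>

lemma proportional_to_bordered_det:
  fixes e :: "'i \<Rightarrow> nat \<Rightarrow> complex" and b :: "nat \<Rightarrow> nat \<Rightarrow> complex" and g :: "'i \<Rightarrow> complex"
  assumes ker: "\<And>c. (\<forall>r<N. (\<Sum>j\<le>N. b r j * c j) = 0) \<Longrightarrow>
      \<exists>a. \<forall>i\<in>S. (\<Sum>j\<le>N. e i j * c j) = a * g i"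
    and ind: "\<And>c. (\<forall>i\<in>S. (\<Sum>j\<le>N. e i j * c j) = 0) \<Longrightarrow> \<forall>j\<le>N. c j = 0"
  shows "\<exists>C. \<forall>i\<in>S. g i =
    C * Determinant.det (mat (Suc N) (Suc N) (\<lambda>(r, j). if r = 0 then e i j else b (r - 1) j))"
proof -
  define A where "A u = mat (Suc N) (Suc N) (\<lambda>(r, j). if r = 0 then u j else b (r - 1) j)" for u
  \<comment> \<open>Cofactors along the first row do not see that row; the zero row is merely a
    representative.\<close>
  define cof where "cof j = cofactor (A (\<lambda>_. 0)) 0 j" for j
  have A: "A u \<in> carrier_mat (Suc N) (Suc N)" for u by (simp add: A_def)
  have det_A: "Determinant.det (A u) = (\<Sum>j\<le>N. u j * cof j)" for u
  proof -
    have "mat_delete (A u) 0 j = mat_delete (A (\<lambda>_. 0)) 0 j" for j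
      by (rule eq_matI) (auto simp: mat_delete_def A_def)
    then have "cofactor (A u) 0 j = cof j" for j by (simp add: cof_def cofactor_def)
    with laplace_expansion_row[OF A, of 0 u] show ?thesis
      by (simp add: A_def lessThan_Suc_atMost)
  qed
  have "\<forall>r<N. (\<Sum>j\<le>N. b r j * cof j) = 0"
  proof (intro allI impI)
    fix r assume r: "r < N"
    have "Determinant.det (A (b r)) = 0"
    proof (rule det_identical_rows[OF A])
      show "row (A (b r)) 0 = row (A (b r)) (Suc r)"
        using r by (intro eq_vecI) (auto simp: A_def)
    qed (use r in auto)
    then show "(\<Sum>j\<le>N. b r j * cof j) = 0" by (simp add: det_A)
  qed
  from ker[OF this] obtain a where a: "\<forall>i\<in>S. (\<Sum>j\<le>N. e i j * cof j) = a * g i" ..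
  have "a \<noteq> 0"
  proof
    assume "a = 0"
    with a have "\<forall>i\<in>S. (\<Sum>j\<le>N. e i j * cof j) = 0" by simp
    \<comment> \<open>With all cofactors zero, every first row gives a singular matrix. The zero row
      yields a null vector \<open>c\<close> with some \<open>c l \<noteq> 0\<close>; the unit row at
      \<open>l\<close> then yields \<open>d\<close> with \<open>d l = 0\<close>, independent of
      \<open>c\<close>. The combination \<open>\<mu> * d - \<nu> * c\<close> is sent to 0; its entry
      at \<open>l\<close> gives \<open>\<nu> = 0\<close>, so \<open>d\<close> itself is sent to 0,
      against \<open>ind\<close>.\<close>
    from ind[OF this] have "Determinant.det (A u) = 0" for u by (simp add: det_A)
    note null = bordered_mat_null_vector[OF this[unfolded A_def]]
    obtain c where c: "\<exists>j\<le>N. c j \<noteq> 0" "(\<Sum>j\<le>N. 0 * c j) = 0" "\<forall>r<N. (\<Sum>j\<le>N. b r j * c j) = 0"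
      by (rule null[of "\<lambda>_. 0"]) (rule that)
    from c(1) obtain l where l: "l \<le> N" "c l \<noteq> 0" by blast
    obtain d where d: "\<exists>j\<le>N. d j \<noteq> 0" "(\<Sum>j\<le>N. (if j = l then 1 else 0) * d j) = 0"
      "\<forall>r<N. (\<Sum>j\<le>N. b r j * d j) = 0"
      by (rule null[of "\<lambda>j. if j = l then 1 else 0"]) (rule that)
    have dl: "d l = 0" using d(2) l(1) by (simp add: if_distrib[of "\<lambda>x. x * _"] cong: if_cong)
    from ker[OF c(3)] obtain \<mu> where \<mu>: "\<forall>i\<in>S. (\<Sum>j\<le>N. e i j * c j) = \<mu> * g i" ..
    from ker[OF d(3)] obtain \<nu> where \<nu>: "\<forall>i\<in>S. (\<Sum>j\<le>N. e i j * d j) = \<nu> * g i" ..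
    have "\<forall>i\<in>S. (\<Sum>j\<le>N. e i j * (\<mu> * d j - \<nu> * c j)) = 0"
    proof
      fix i assume "i \<in> S"
      have "(\<Sum>j\<le>N. e i j * (\<mu> * d j - \<nu> * c j)) =
          \<mu> * (\<Sum>j\<le>N. e i j * d j) - \<nu> * (\<Sum>j\<le>N. e i j * c j)"
        by (simp add: sum_distrib_left sum_subtractf algebra_simps)
      then show "(\<Sum>j\<le>N. e i j * (\<mu> * d j - \<nu> * c j)) = 0"
        using \<open>i \<in> S\<close> \<mu> \<nu> by simp
    qed
    from ind[OF this] l dl have "\<nu> = 0" by auto
    with \<nu> have "\<forall>i\<in>S. (\<Sum>j\<le>N. e i j * d j) = 0" by simp
    from ind[OF this] d(1) show False by blast
  qed
  then have "\<forall>i\<in>S. g i = 1 / a * Determinant.det (A (e i))"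
    using a by (simp add: det_A)
  then show ?thesis unfolding A_def by blast
qed

text \<open>Among the members with nonzero coefficient take the one of highest rank: the others have
  entry zero at its mark \<open>t j\<close>. Integer ranks allow the columns to be run through in
  either direction.\<close>

lemma triangular_independent:
  fixes f :: "nat \<Rightarrow> nat \<Rightarrow> complex" and rank :: "nat \<Rightarrow> int"
  assumes "finite A" and sum: "\<And>i. (\<Sum>j\<in>A. c j * f j i) = 0" and inj: "inj_on rank A"
    and t: "\<And>j. j \<in> A \<Longrightarrow> f j (t j) \<noteq> 0"
      "\<And>i j. i \<in> A \<Longrightarrow> j \<in> A \<Longrightarrow> rank i < rank j \<Longrightarrow> f i (t j) = 0"
    and "l \<in> A"
  shows "c l = 0"
proof (rule ccontr)
  assume "c l \<noteq> 0"
  define B where "B = {j \<in> A. c j \<noteq> 0}"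
  have B: "finite B" "B \<noteq> {}" using assms(1) \<open>l \<in> A\<close> \<open>c l \<noteq> 0\<close> by (auto simp: B_def)
  then have "Max (rank ` B) \<in> rank ` B" by (intro Max_in) auto
  then obtain j where j: "j \<in> B" "rank j = Max (rank ` B)" by auto
  have "c i * f i (t j) = 0" if "i \<in> A - {j}" for i
  proof (cases "c i = 0")
    case False
    then have "i \<in> B" using that by (simp add: B_def)
    then have "rank i \<le> rank j" using B j by simp
    moreover have "rank i \<noteq> rank j" using inj that j by (auto simp: inj_on_def B_def)
    ultimately show ?thesis using t(2)[of i j] that j by (simp add: B_def)
  qed simp
  then have "(\<Sum>i\<in>A - {j}. c i * f i (t j)) = 0" by (intro sum.neutral ballI)
  moreover have "(\<Sum>i\<in>A. c i * f i (t j)) = c j * f j (t j) + (\<Sum>i\<in>A - {j}. c i * f i (t j))"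
    using assms(1) j by (intro sum.remove) (auto simp: B_def)
  ultimately show False using sum[of "t j"] t(1)[of j] j by (simp add: B_def)
qed

section \<open>The columns of the bordered determinant\<close>

text \<open>The exponents in the four blocks of \<open>det_row\<close>, by running column number.
  Each step keeps the exponent or lowers it by one, while \<open>col_index\<close> rises by one; so
  from one column to the next the range from shift to shift plus index gains one power, at its upper
  or at its lower end.\<close>

definition col_shift :: "nat \<Rightarrow> nat \<Rightarrow> nat \<Rightarrow> nat \<Rightarrow> int" where
  "col_shift Ks L Ls j =
     (if j \<le> L then int L - int j else if j \<le> L + Ls then 0
      else if j \<le> L + Ls + Ks then int (L + Ls) - int j else - int Ks)"

lemma col_shift_antimono: "i \<le> j \<Longrightarrow> col_shift Ks L Ls j \<le> col_shift Ks L Ls i"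
  by (auto simp: col_shift_def)

lemma col_shift_add_mono: "i \<le> j \<Longrightarrow> col_shift Ks L Ls i + int i \<le> col_shift Ks L Ls j + int j"
  by (auto simp: col_shift_def)

text \<open>The first and last bounds limit the pole and the degree of the combined first component.
  The second limits the growth of the second component at infinity, and the third its order at 0,
  because shift plus index is \<open>n - Ls - L\<close> plus the quantity bounded there.\<close>

lemma col_shift_bounds:
  "- int Ks \<le> col_shift Ks L Ls j" "col_shift Ks L Ls j \<le> int L"
  "int L \<le> col_shift Ks L Ls j + int j"
  "j \<le> K + Ks + L + Ls \<Longrightarrow> col_shift Ks L Ls j + int j \<le> int (L + Ls + K)"
  by (auto simp: col_shift_def)

definition col_index :: "nat \<Rightarrow> nat \<Rightarrow> nat \<Rightarrow> nat \<Rightarrow> int" where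
  "col_index n L Ls j = int n - int Ls - int L + int j"

lemma det_row_nth:
  assumes "j \<le> K + Ks + L + Ls"
  shows "det_row K Ks L Ls n a z ! j = z powi col_shift Ks L Ls j * a (col_index n L Ls j) z"
proof -
  consider "j < L" | "L \<le> j" "j < L + Ls" | "L + Ls \<le> j" "j < L + Ls + Ks + 1"
    | "L + Ls + Ks + 1 \<le> j" by linarith
  then show ?thesis
  proof cases
    case 1
    then have "z powi (int L - int j) = z ^ (L - j)" by (simp add: power_int_def nat_diff_distrib)
    with 1 show ?thesis
      by (simp add: det_row_def nth_append col_shift_def col_index_def)
  next
    case 2
    then have "\<not> j < L" "j - L < Ls" by linarith+
    with 2 have "det_row K Ks L Ls n a z ! j = a (int n - int Ls + int (j - L)) z"
      by (simp add: det_row_def nth_append)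
    also have "int n - int Ls + int (j - L) = col_index n L Ls j"
      using 2 by (simp add: col_index_def)
    finally show ?thesis using 2 by (simp add: col_shift_def)
  next
    case 3
    then have "\<not> j < L" "\<not> j - L < Ls" "j - (L + Ls) < Suc Ks" by linarith+
    then have "det_row K Ks L Ls n a z ! j =
        z powi (- int (j - L - Ls)) * a (int n + int (j - L - Ls)) z"
      by (simp add: det_row_def nth_append del: upt_Suc)
    also have "- int (j - L - Ls) = col_shift Ks L Ls j"
      using 3 by (auto simp: col_shift_def)
    also have "int n + int (j - L - Ls) = col_index n L Ls j"
      using 3 by (auto simp: col_index_def)
    finally show ?thesis .
  next
    case 4
    then have "\<not> j < L" "\<not> j - L < Ls" "\<not> j - (L + Ls) < Suc Ks" "j - Suc (L + Ls + Ks) < K"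
      using assms by linarith+
    moreover from this(4) have "[Suc 0..<Suc K] ! (j - Suc (L + Ls + Ks)) = Suc 0 + (j - Suc (L + Ls + Ks))"
      by (intro nth_upt) simp
    ultimately have "det_row K Ks L Ls n a z ! j =
        z powi (- int Ks) * a (int n + int Ks + int (1 + (j - Suc (L + Ls + Ks)))) z"
      by (simp add: det_row_def nth_append del: upt_Suc)
    also have "- int Ks = col_shift Ks L Ls j"
      using 4 by (auto simp: col_shift_def)
    also have "int n + int Ks + int (1 + (j - Suc (L + Ls + Ks))) = col_index n L Ls j"
      using 4 by (auto simp: col_index_def)
    finally show ?thesis .
  qed
qed

lemma bordered_det_eq:
  fixes \<alpha> \<alpha>s \<beta> \<beta>s :: "complex list" and n :: nat and a p x :: "int \<Rightarrow> complex \<Rightarrow> complex"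
  defines "s \<equiv> col_shift (length \<alpha>s) (length \<beta>) (length \<beta>s)"
    and "m \<equiv> col_index n (length \<beta>) (length \<beta>s)"
    and "N \<equiv> length \<alpha> + length \<alpha>s + length \<beta> + length \<beta>s"
  defines "b \<equiv> \<lambda>r j. if r < length (\<alpha> @ \<alpha>s)
       then ((\<alpha> @ \<alpha>s) ! r) powi s j * p (m j) ((\<alpha> @ \<alpha>s) ! r)
       else ((\<beta> @ \<beta>s) ! (r - length (\<alpha> @ \<alpha>s))) powi s j * x (m j) ((\<beta> @ \<beta>s) ! (r - length (\<alpha> @ \<alpha>s)))"
  shows "bordered_det \<alpha> \<alpha>s \<beta> \<beta>s n a p x z =
    Determinant.det (mat (Suc N) (Suc N) (\<lambda>(r, j). if r = 0 then z powi s j * a (m j) z else b (r - 1) j))"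
proof -
  let ?v = "det_row (length \<alpha>) (length \<alpha>s) (length \<beta>) (length \<beta>s) n"
  let ?rows = "?v a z # map (?v p) (\<alpha> @ \<alpha>s) @ map (?v x) (\<beta> @ \<beta>s)"
  have "mat_of_rows_list (Suc N) ?rows =
     mat (Suc N) (Suc N) (\<lambda>(r, j). if r = 0 then z powi s j * a (m j) z else b (r - 1) j)"
  proof (rule eq_matI)
    fix r j
    assume "r < dim_row (mat (Suc N) (Suc N) (\<lambda>(r, j). if r = 0 then z powi s j * a (m j) z else b (r - 1) j))"
      "j < dim_col (mat (Suc N) (Suc N) (\<lambda>(r, j). if r = 0 then z powi s j * a (m j) z else b (r - 1) j))"
    then have rj: "r \<le> N" "j \<le> N" by auto
    have v: "?v a' z' ! j = z' powi s j * a' (m j) z'" for a' :: "int \<Rightarrow> complex \<Rightarrow> complex" and z'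
      unfolding s_def m_def using rj(2) by (intro det_row_nth) (simp add: N_def)
    have "?rows ! r ! j = (if r = 0 then z powi s j * a (m j) z else b (r - 1) j)"
    proof (cases r)
      case (Suc r')
      show ?thesis
      proof (cases "r' < length (\<alpha> @ \<alpha>s)")
        case True
        then have "?rows ! r = ?v p ((\<alpha> @ \<alpha>s) ! r')"
          unfolding Suc by (simp only: nth_Cons_Suc nth_append length_map if_True nth_map)
        with True show ?thesis by (simp add: v Suc b_def)
      next
        case False
        then have "?rows ! r = ?v x ((\<beta> @ \<beta>s) ! (r' - length (\<alpha> @ \<alpha>s)))"
          unfolding Suc using rj(1) Suc
          by (simp only: nth_Cons_Suc nth_append[of "map _ _"] length_map if_False)
             (rule nth_map, simp add: N_def)
        with False show ?thesis by (simp add: v Suc b_def)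
      qed
    qed (simp add: v)
    then show "mat_of_rows_list (Suc N) ?rows $$ (r, j) =
       mat (Suc N) (Suc N) (\<lambda>(r, j). if r = 0 then z powi s j * a (m j) z else b (r - 1) j) $$ (r, j)"
      using rj by (simp add: mat_of_rows_list_def N_def)
  qed (auto simp: mat_of_rows_list_def N_def)
  then show ?thesis by (simp add: bordered_det_def Let_def N_def)
qed

lemma poly_eq_0_off_circle:
  fixes P :: "complex poly"
  assumes "\<And>z. z \<noteq> 0 \<Longrightarrow> norm z \<noteq> 1 \<Longrightarrow> poly P z = 0"
  shows "P = 0"
proof (rule ccontr)
  assume "P \<noteq> 0"
  then have "finite {z. poly P z = 0}" by (rule poly_roots_finite)
  moreover have "range (\<lambda>i::nat. of_nat (i + 2)) \<subseteq> {z. poly P z = 0}"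
  proof (intro image_subsetI CollectI)
    fix i :: nat
    have "norm (of_nat (i + 2) :: complex) = of_nat (i + 2)" by (rule norm_of_nat)
    moreover have "(of_nat (i + 2) :: complex) \<noteq> 0" by (simp only: of_nat_eq_0_iff)
    ultimately show "poly P (of_nat (i + 2)) = 0" by (intro assms) auto
  qed
  ultimately have "finite (range (\<lambda>i::nat. of_nat (i + 2) :: complex))" by (rule finite_subset[rotated])
  then have "finite (UNIV :: nat set)" by (rule finite_imageD) (simp add: inj_on_def)
  then show False by simp
qed

text \<open>
  The pairs \<open>(\<phi>, \<xi>)\<close> and \<open>(\<phi>*, \<xi>*)\<close> are both instances, with \<open>\<epsilon> \<zeta> = 2 \<zeta>\<close>, \<open>\<delta> = 0\<close> and
  \<open>\<epsilon> \<zeta> = -2\<close>, \<open>\<delta> = 1\<close> respectively: since \<open>1 + (\<zeta> + z) / (\<zeta> - z) = 2 \<zeta> / (\<zeta> - z)\<close> and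
  \<open>1 - (\<zeta> + z) / (\<zeta> - z) = - 2 z / (\<zeta> - z)\<close>, the associated functions are Cauchy transforms.
  The polynomials \<open>u i\<close> describe the associated functions of index \<open>- i - 1\<close>.
\<close>

locale biorthogonal_family =
  fixes w :: "complex \<Rightarrow> complex" and \<epsilon> :: "complex \<Rightarrow> complex" and \<delta> :: nat
    and f u :: "nat \<Rightarrow> complex poly" and a x :: "int \<Rightarrow> complex \<Rightarrow> complex"
  assumes weight: "circle_weight w"
    and cont_\<epsilon>: "continuous_on (sphere 0 1) \<epsilon>"
    and degree_f: "degree (f m) \<le> m" and coeff_f: "coeff (f m) 0 \<noteq> 0" "coeff (f m) m \<noteq> 0"
    and orth: "i < m \<Longrightarrow> wint w (\<lambda>\<zeta>. \<epsilon> \<zeta> * poly (f m) \<zeta> / \<zeta> ^ Suc i) = 0"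
    and a_of_nat: "a (int m) z = poly (f m) z" and a_neg: "l < 0 \<Longrightarrow> a l z = 0"
    and x_of_nat: "norm z \<noteq> 1 \<Longrightarrow> x (int m) z = z ^ \<delta> * cauchy_transform w (\<lambda>\<zeta>. \<epsilon> \<zeta> * poly (f m) \<zeta>) z"
    and x_neg: "z \<noteq> 0 \<Longrightarrow> x (- int (Suc i)) z = z ^ \<delta> * (poly (u i) z / z ^ Suc i)"
    and degree_u: "degree (u i) \<le> i" and coeff_u: "coeff (u i) 0 \<noteq> 0" "coeff (u i) i \<noteq> 0"
begin

section \<open>Growth and independence of the columns of a family\<close>

lemma cont_\<epsilon>_poly: "continuous_on (sphere 0 1) (\<lambda>\<zeta>. \<epsilon> \<zeta> * poly p \<zeta>)"
  by (intro continuous_intros cont_\<epsilon>)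

lemma index_cases [case_names nonneg neg]:
  obtains m where "l = int m" | i where "l = - int (Suc i)"
  by (cases l rule: int_cases) auto

text \<open>Orthogonality to \<open>m\<close> consecutive powers removes the first \<open>m\<close>
  Taylor coefficients; for negative index the pole is explicit. Division by
  \<open>z ^ \<delta>\<close> puts the starred functions, which carry an extra factor
  \<open>z\<close>, on the same footing.\<close>

lemma x_bigo_zero: "(\<lambda>z. x l z / z ^ \<delta>) \<in> O[at 0](\<lambda>z. z powi l)"
proof (cases l rule: index_cases)
  case (nonneg m)
  have "cauchy_transform w (\<lambda>\<zeta>. \<epsilon> \<zeta> * poly (f m) \<zeta>) \<in> O[at 0](\<lambda>z. z ^ m)"
    using orth[of _ m] by (intro cauchy_transform_bigo_zero weight cont_\<epsilon>_poly)
  also have "?this \<longleftrightarrow> (\<lambda>z. x l z / z ^ \<delta>) \<in> O[at 0](\<lambda>z. z ^ m)"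
    by (rule landau_o.big.in_cong)
       (use eventually_at_0_norm_less in \<open>auto elim!: eventually_mono simp: nonneg x_of_nat\<close>)
  finally show ?thesis by (simp add: nonneg)
next
  case (neg i)
  have "(\<lambda>z. poly (u i) z * (1 / z ^ Suc i)) \<in> O[at 0](\<lambda>z. 1 * (1 / z ^ Suc i))"
  proof (intro landau_o.big.mult)
    show "poly (u i) \<in> O[at 0](\<lambda>_. 1)"
      by (rule bigoI_tendsto[where c = "poly (u i) 0"]) (auto intro!: tendsto_intros)
  qed simp
  also have "?this \<longleftrightarrow> (\<lambda>z. x l z / z ^ \<delta>) \<in> O[at 0](\<lambda>z. 1 * (1 / z ^ Suc i))"
    by (rule landau_o.big.in_cong)
       (use eventually_neq_0(2) in \<open>eventually_elim, simp add: neg x_neg del: of_nat_Suc\<close>)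
  finally show ?thesis
    by (simp add: neg power_int_minus divide_inverse del: of_nat_Suc power_Suc)
qed

lemma x_bigo_infinity: "(\<lambda>z. x l z / z ^ \<delta>) \<in> O[at_infinity](\<lambda>z. 1 / z)"
proof (cases l rule: index_cases)
  case (nonneg m)
  have "cauchy_transform w (\<lambda>\<zeta>. \<epsilon> \<zeta> * poly (f m) \<zeta>) \<in> O[at_infinity](\<lambda>z. 1 / z)"
    by (intro cauchy_transform_bigo_infinity weight cont_\<epsilon>_poly)
  also have "?this \<longleftrightarrow> (\<lambda>z. x l z / z ^ \<delta>) \<in> O[at_infinity](\<lambda>z. 1 / z)"
    by (rule landau_o.big.in_cong)
       (use eventually_at_infinity_norm_ge[of 2] in
         \<open>auto elim!: eventually_mono simp: nonneg x_of_nat\<close>)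
  finally show ?thesis .
next
  case (neg i)
  have "(\<lambda>z. \<Sum>k\<le>i. coeff (u i) k * z ^ k * (1 / z ^ Suc i)) \<in> O[at_infinity](\<lambda>z. 1 / z)"
  proof (intro big_sum_in_bigo)
    fix k assume k: "k \<in> {..i}"
    show "(\<lambda>z. coeff (u i) k * z ^ k * (1 / z ^ Suc i)) \<in> O[at_infinity](\<lambda>z. 1 / z)"
    proof (rule bigoI[of _ "norm (coeff (u i) k)"])
      show "\<forall>\<^sub>F z in at_infinity. norm (coeff (u i) k * z ^ k * (1 / z ^ Suc i))
          \<le> norm (coeff (u i) k) * norm (1 / z)"
        using eventually_at_infinity_norm_ge[of 1]
      proof eventually_elim
        case (elim z)
        then have "norm z ^ k \<le> norm z ^ i" "norm z > 0" using k by (auto intro: power_increasing)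
        then have "norm z ^ k / norm z ^ Suc i \<le> 1 / norm z"
          by (simp add: divide_simps)
        from mult_left_mono[OF this, of "norm (coeff (u i) k)"] show ?case
          by (simp add: norm_mult norm_divide norm_power)
      qed
    qed
  qed
  moreover have "poly (u i) z = (\<Sum>k\<le>i. coeff (u i) k * z ^ k)" for z
    unfolding poly_altdef using degree_u[of i]
    by (intro sum.mono_neutral_left) (auto simp: coeff_eq_0)
  ultimately have "(\<lambda>z. poly (u i) z / z ^ Suc i) \<in> O[at_infinity](\<lambda>z. 1 / z)"
    by (simp add: sum_distrib_right sum_divide_distrib)
  also have "?this \<longleftrightarrow> (\<lambda>z. x l z / z ^ \<delta>) \<in> O[at_infinity](\<lambda>z. 1 / z)"
    by (rule landau_o.big.in_cong)
       (use eventually_neq_0(1) in \<open>eventually_elim, simp add: neg x_neg del: of_nat_Suc\<close>)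
  finally show ?thesis .
qed

text \<open>Ties the two components of a column together. For nonnegative index the discrepancy
  comes from moving \<open>z powi s\<close> inside the integral; for negative index the integral is
  zero and the whole second component is the discrepancy.\<close>

lemma x_minus_cauchy_transform_laurent:
  obtains P where "laurent P" "\<And>z. z \<noteq> 0 \<Longrightarrow> norm z \<noteq> 1 \<Longrightarrow>
     z powi s * (x l z / z ^ \<delta>) = cauchy_transform w (\<lambda>\<zeta>. \<epsilon> \<zeta> * (\<zeta> powi s * a l \<zeta>)) z + P z"
proof (cases l rule: index_cases)
  case (nonneg m)
  obtain P where P: "laurent P" "\<And>z. z \<noteq> 0 \<Longrightarrow> norm z \<noteq> 1 \<Longrightarrow>
     wint w (\<lambda>\<zeta>. (z powi s - \<zeta> powi s) / (\<zeta> - z) * (\<epsilon> \<zeta> * poly (f m) \<zeta>)) = P z"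
    by (rule laurent_wint_difference_quotient[OF weight cont_\<epsilon>_poly laurent_powi]) (rule that)
  show ?thesis
  proof (rule that[OF P(1)])
    fix z :: complex assume z: "z \<noteq> 0" "norm z \<noteq> 1"
    have "P z = wint w (\<lambda>\<zeta>. z powi s * (\<epsilon> \<zeta> * poly (f m) \<zeta> / (\<zeta> - z)) -
        \<epsilon> \<zeta> * (\<zeta> powi s * a l \<zeta>) / (\<zeta> - z))"
      unfolding P(2)[OF z, symmetric]
    proof (rule wint_cong)
      fix \<zeta> :: complex assume "norm \<zeta> = 1"
      then have "\<zeta> - z \<noteq> 0" using z by auto
      then show "(z powi s - \<zeta> powi s) / (\<zeta> - z) * (\<epsilon> \<zeta> * poly (f m) \<zeta>) =
          z powi s * (\<epsilon> \<zeta> * poly (f m) \<zeta> / (\<zeta> - z)) - \<epsilon> \<zeta> * (\<zeta> powi s * a l \<zeta>) / (\<zeta> - z)"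
        by (simp add: nonneg a_of_nat divide_simps) (simp add: algebra_simps)
    qed
    also have "\<dots> = z powi s * cauchy_transform w (\<lambda>\<zeta>. \<epsilon> \<zeta> * poly (f m) \<zeta>) z -
        cauchy_transform w (\<lambda>\<zeta>. \<epsilon> \<zeta> * (\<zeta> powi s * a l \<zeta>)) z"
      unfolding cauchy_transform_def wint_cmult[symmetric] nonneg a_of_nat
      by (rule wint_diff[OF weight]) (use z in \<open>auto intro!: continuous_intros cont_\<epsilon>\<close>)
    finally show "z powi s * (x l z / z ^ \<delta>) =
        cauchy_transform w (\<lambda>\<zeta>. \<epsilon> \<zeta> * (\<zeta> powi s * a l \<zeta>)) z + P z"
      using z by (simp add: nonneg x_of_nat)
  qed
next
  case (neg i)
  show ?thesis
  proof (rule that[of "\<lambda>z. z powi s * (poly (u i) z * z powi (- int (Suc i)))"])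
    show "laurent (\<lambda>z. z powi s * (poly (u i) z * z powi (- int (Suc i))))"
      by (intro laurent_mult laurent_powi laurent_poly)
    fix z :: complex assume z: "z \<noteq> 0" "norm z \<noteq> 1"
    have "cauchy_transform w (\<lambda>\<zeta>. \<epsilon> \<zeta> * (\<zeta> powi s * a l \<zeta>)) z = 0"
      using wint_cmult[of w 0] by (simp add: cauchy_transform_def a_neg neg del: of_nat_Suc)
    then show "z powi s * (x l z / z ^ \<delta>) =
        cauchy_transform w (\<lambda>\<zeta>. \<epsilon> \<zeta> * (\<zeta> powi s * a l \<zeta>)) z +
        z powi s * (poly (u i) z * z powi (- int (Suc i)))"
      using z by (simp add: neg x_neg power_int_minus divide_inverse del: of_nat_Suc power_Suc)
  qed
qed

text \<open>Two stages. Columns of nonnegative index are separated by their first components.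
  Columns of negative index are invisible there, but once the other coefficients are known to be
  zero they can be separated by their second components. Both stages use that the end coefficients
  of \<open>f m\<close> and \<open>u i\<close> are nonzero.\<close>

lemma columns_independent:
  fixes L Ls Ks n N :: nat
  defines "s \<equiv> col_shift Ks L Ls" and "m \<equiv> col_index n L Ls"
  assumes a0: "\<And>z. z \<noteq> 0 \<Longrightarrow> norm z \<noteq> 1 \<Longrightarrow> (\<Sum>j\<le>N. z powi s j * a (m j) z * c j) = 0"
    and x0: "\<And>z. z \<noteq> 0 \<Longrightarrow> norm z \<noteq> 1 \<Longrightarrow> (\<Sum>j\<le>N. z powi s j * x (m j) z * c j) = 0"
    and "j \<le> N"
  shows "c j = 0"
proof -
  have s: "\<And>i j. i \<le> j \<Longrightarrow> s j \<le> s i" "\<And>i j. i \<le> j \<Longrightarrow> s i + int i \<le> s j + int j"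
    "\<And>j. - int Ks \<le> s j" "\<And>j. int L \<le> s j + int j"
    unfolding s_def using col_shift_antimono col_shift_add_mono col_shift_bounds by auto
  have m: "m j = int n - int Ls - int L + int j" for j by (simp add: m_def col_index_def)
  have nonneg: "c j = 0" if j: "j \<le> N" "m j \<ge> 0" for j
  proof -
    define A where "A = {j. j \<le> N \<and> m j \<ge> 0}"
    define p where "p j = monom 1 (nat (s j + int Ks)) * f (nat (m j))" for j
    \<comment> \<open>The mark is the power that column \<open>j\<close> has and all earlier ones
      lack: the bottom one if the shift has just dropped, the top one otherwise. For
      \<open>j = 0\<close> truncated subtraction selects the top, and no column precedes.\<close>
    define t where "t j = (if s j < s (j - 1) then nat (s j + int Ks) else nat (s j + int Ks + m j))" for j
    have p: "poly (p j) z = z ^ Ks * (z powi s j * a (m j) z)" if "z \<noteq> 0" "m j \<ge> 0" for z j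
    proof -
      have "z ^ nat (s j + int Ks) = z powi (int Ks + s j)"
        using s(3)[of j] by (simp add: power_int_def add.commute)
      then show ?thesis
        using that a_of_nat[of "nat (m j)" z] by (simp add: p_def poly_monom power_int_add)
    qed
    have coeff_p: "coeff (p j) i = (if nat (s j + int Ks) \<le> i
        then coeff (f (nat (m j))) (i - nat (s j + int Ks)) else 0)" for i j
      by (simp add: p_def coeff_monom_mult)
    show ?thesis
    proof (rule triangular_independent[of A c "\<lambda>j i. coeff (p j) i" int t])
      show "(\<Sum>j\<in>A. c j * coeff (p j) i) = 0" for i
      proof -
        have "(\<Sum>j\<in>A. Polynomial.smult (c j) (p j)) = 0"
        proof (rule poly_eq_0_off_circle)
          fix z :: complex assume z: "z \<noteq> 0" "norm z \<noteq> 1"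
          have "poly (\<Sum>j\<in>A. Polynomial.smult (c j) (p j)) z =
              (\<Sum>j\<in>A. z ^ Ks * (z powi s j * a (m j) z * c j))"
            unfolding poly_sum by (rule sum.cong) (simp_all add: p z A_def)
          also have "\<dots> = (\<Sum>j\<le>N. z ^ Ks * (z powi s j * a (m j) z * c j))"
            by (rule sum.mono_neutral_left) (auto simp: A_def a_neg)
          also have "\<dots> = 0" using a0[OF z] by (simp add: sum_distrib_left[symmetric])
          finally show "poly (\<Sum>j\<in>A. Polynomial.smult (c j) (p j)) z = 0" .
        qed
        then have "coeff (\<Sum>j\<in>A. Polynomial.smult (c j) (p j)) i = 0" by simp
        then show ?thesis by (simp add: coeff_sum)
      qed
      show "coeff (p j) (t j) \<noteq> 0" if "j \<in> A" for j
      proof -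
        have "nat (s j + int Ks + m j) - nat (s j + int Ks) = nat (m j)"
          "nat (s j + int Ks) \<le> nat (s j + int Ks + m j)"
          using s(3)[of j] that by (auto simp: A_def)
        then show ?thesis by (simp add: coeff_p t_def coeff_f)
      qed
      show "coeff (p i) (t j) = 0" if ij: "i \<in> A" "j \<in> A" "int i < int j" for i j
      proof (cases "s j < s (j - 1)")
        case True
        moreover have "s (j - 1) \<le> s i" using ij by (intro s) auto
        ultimately show ?thesis using s(3)[of j] by (simp add: coeff_p t_def)
      next
        case False
        then have "s j = s (j - 1)" using s(1)[of "j - 1" j] by simp
        moreover have "s i + int i \<le> s (j - 1) + int (j - 1)" using ij by (intro s) auto
        ultimately have lt: "s i + m i < s j + m j" using ij by (simp add: m)
        have "degree (f (nat (m i))) \<le> nat (m i)" by (rule degree_f)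
        also have "\<dots> < t j - nat (s i + int Ks)"
          using lt False s(3)[of i] s(3)[of j] ij by (simp add: t_def A_def)
        finally show ?thesis by (simp add: coeff_p coeff_eq_0)
      qed
    qed (use j in \<open>auto simp: A_def\<close>)
  qed
  show ?thesis
  proof (cases "m j \<ge> 0")
    case True
    then show ?thesis using nonneg \<open>j \<le> N\<close> by blast
  next
    case False
    define A where "A = {j. j \<le> N \<and> m j < 0}"
    define v where "v j = nat (- m j - 1)" for j
    \<comment> \<open>The lowest power in column \<open>j\<close> is \<open>s j + m j\<close>, apart
      from \<open>z ^ \<delta>\<close>; the common factor \<open>z powi (int Ls - int n)\<close>
      raises it to \<open>s j + j - L\<close>, which is nonnegative.\<close>
    define p where "p j = monom 1 (nat (s j + int j - int L)) * u (v j)" for j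
    \<comment> \<open>Now the degrees of \<open>u\<close> grow as \<open>j\<close> decreases, so
      columns are run through backwards and compared with later ones: if the shift stays, the bottom
      power is new, otherwise the top power, which follows \<open>s j\<close>.\<close>
    define t where "t j = (if s (Suc j) = s j then nat (s j + int j - int L)
      else nat (s j + int j - int L) + v j)" for j
    have v: "m j = - int (Suc (v j))" if "m j < 0" for j using that by (simp add: v_def)
    have p: "poly (p j) z = z powi (int Ls - int n) * (z powi s j * x (m j) z) / z ^ \<delta>"
      if z: "z \<noteq> 0" "m j < 0" for z j
    proof -
      have "int Ls - int n + s j - int (Suc (v j)) = s j + int j - int L"
        using v[OF z(2)] by (simp add: m)
      then have "z ^ nat (s j + int j - int L) = z powi (int Ls - int n + s j - int (Suc (v j)))"
        using s(4)[of j] by (simp only: power_int_def) simp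
      also have "\<dots> = z powi (int Ls - int n) * z powi s j / z ^ Suc (v j)"
        using z(1) by (simp only: power_int_diff power_int_add power_int_of_nat simp_thms)
      finally show ?thesis
        using z x_neg[OF z(1), of "v j"] v[OF z(2)] by (simp add: p_def poly_monom del: power_Suc of_nat_Suc)
    qed
    have coeff_p: "coeff (p j) i = (if nat (s j + int j - int L) \<le> i
        then coeff (u (v j)) (i - nat (s j + int j - int L)) else 0)" for i j
      by (simp add: p_def coeff_monom_mult)
    show ?thesis
    proof (rule triangular_independent[of A c "\<lambda>j i. coeff (p j) i" "\<lambda>j. - int j" t])
      show "(\<Sum>j\<in>A. c j * coeff (p j) i) = 0" for i
      proof -
        have "(\<Sum>j\<in>A. Polynomial.smult (c j) (p j)) = 0"
        proof (rule poly_eq_0_off_circle)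
          fix z :: complex assume z: "z \<noteq> 0" "norm z \<noteq> 1"
          have "poly (\<Sum>j\<in>A. Polynomial.smult (c j) (p j)) z =
              (\<Sum>j\<in>A. z powi (int Ls - int n) / z ^ \<delta> * (z powi s j * x (m j) z * c j))"
            unfolding poly_sum by (rule sum.cong) (simp_all add: p z A_def)
          also have "\<dots> = (\<Sum>j\<le>N. z powi (int Ls - int n) / z ^ \<delta> * (z powi s j * x (m j) z * c j))"
            by (rule sum.mono_neutral_left) (auto simp: A_def nonneg)
          also have "\<dots> = 0" unfolding sum_distrib_left[symmetric] x0[OF z] by simp
          finally show "poly (\<Sum>j\<in>A. Polynomial.smult (c j) (p j)) z = 0" .
        qed
        then have "coeff (\<Sum>j\<in>A. Polynomial.smult (c j) (p j)) i = 0" by simp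
        then show ?thesis by (simp add: coeff_sum)
      qed
      show "coeff (p j) (t j) \<noteq> 0" if "j \<in> A" for j
        by (simp add: coeff_p t_def coeff_u)
      show "coeff (p i) (t j) = 0" if ij: "i \<in> A" "j \<in> A" "- int i < - int j" for i j
      proof (cases "s (Suc j) = s j")
        case True
        have "s (Suc j) + int (Suc j) \<le> s i + int i" using ij by (intro s) auto
        then show ?thesis using True s(4)[of j] by (simp add: coeff_p t_def)
      next
        case False
        then have "s (Suc j) < s j" using s(1)[of j "Suc j"] by simp
        moreover have "s i \<le> s (Suc j)" using ij by (intro s) auto
        ultimately have lt: "s i < s j" by simp
        have "degree (u (v i)) \<le> v i" by (rule degree_u)
        also have "v i < t j - nat (s i + int i - int L)"
          using lt False s(4)[of i] s(4)[of j] ij by (simp add: t_def A_def v_def m) arith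
        finally show ?thesis by (simp add: coeff_p coeff_eq_0)
      qed
    qed (use False \<open>j \<le> N\<close> in \<open>auto simp: A_def inj_on_def\<close>)
  qed
qed

text \<open>\<open>t\<close> is the target polynomial of the modified system and \<open>y\<close>
  its associated function; the hypothesis on \<open>t\<close> says that orthogonality determines it
  up to a scalar. Treating both in one statement yields the same \<open>C\<close> in the polynomial
  formula and in the associated one.\<close>

theorem bordered_determinant_formula:
  fixes \<alpha> \<alpha>s \<beta> \<beta>s :: "complex list" and n :: nat and t :: "complex poly" and y :: "complex \<Rightarrow> complex"
  defines "w' \<equiv> modified_weight \<alpha> \<alpha>s \<beta> \<beta>s w"
  assumes \<alpha>: "distinct (\<alpha> @ \<alpha>s)" "\<alpha>s \<noteq> [] \<Longrightarrow> 0 \<notin> set (\<alpha> @ \<alpha>s)"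
    and \<beta>: "distinct (\<beta> @ \<beta>s)" "0 \<notin> set (\<beta> @ \<beta>s)" "\<forall>b \<in> set (\<beta> @ \<beta>s). norm b \<noteq> 1"
    and t: "\<And>h. degree h \<le> n \<Longrightarrow>
        (\<And>i. i < n \<Longrightarrow> wint w' (\<lambda>\<zeta>. \<epsilon> \<zeta> * poly h \<zeta> / \<zeta> ^ Suc i) = 0) \<Longrightarrow>
        \<exists>l. h = Polynomial.smult l t"
    and y: "\<And>z. norm z \<noteq> 1 \<Longrightarrow> y z = z ^ \<delta> * cauchy_transform w' (\<lambda>\<zeta>. \<epsilon> \<zeta> * poly t \<zeta>) z"
  shows "\<exists>C. (\<forall>z. z \<noteq> 0 \<or> \<alpha>s = [] \<longrightarrow>
         numer \<alpha> \<alpha>s z * poly t z = C * bordered_det \<alpha> \<alpha>s \<beta> \<beta>s n a a x z) \<and>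
      (\<forall>z. norm z \<noteq> 1 \<and> (z \<noteq> 0 \<or> \<alpha>s = [] \<and> \<beta>s = [] \<and> length \<beta> \<le> n) \<longrightarrow>
         numer \<beta> \<beta>s z * y z = C * bordered_det \<alpha> \<alpha>s \<beta> \<beta>s n x a x z)"
proof -
  define K Ks L Ls where "K = length \<alpha>" and "Ks = length \<alpha>s" and "L = length \<beta>" and "Ls = length \<beta>s"
  note lens = K_def Ks_def L_def Ls_def
  define s where "s = col_shift Ks L Ls"
  define m where "m = col_index n L Ls"
  define N where "N = K + Ks + L + Ls"
  have s: "- int Ks \<le> s j" "s j \<le> int L" "int L \<le> s j + int j"
    "j \<le> N \<Longrightarrow> s j + int j \<le> int (L + Ls + K)" for j
    unfolding s_def N_def using col_shift_bounds by blast+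
  have m: "m j = int n - int Ls - int L + int j" for j by (simp add: m_def col_index_def)
  define b where "b = (\<lambda>r j. if r < length (\<alpha> @ \<alpha>s)
       then ((\<alpha> @ \<alpha>s) ! r) powi s j * a (m j) ((\<alpha> @ \<alpha>s) ! r)
       else ((\<beta> @ \<beta>s) ! (r - length (\<alpha> @ \<alpha>s))) powi s j * x (m j) ((\<beta> @ \<beta>s) ! (r - length (\<alpha> @ \<alpha>s))))"
  \<comment> \<open>\<open>Inl z\<close> stands for the first row \<open>v(a, z)\<close> and
    \<open>Inr z\<close> for \<open>v(x, z)\<close>. The disjoint sum makes one proportionality
    argument, hence one constant, cover both.\<close>
  define S :: "(complex + complex) set" where
    "S = Inl ` {z. z \<noteq> 0 \<or> \<alpha>s = []} \<union>
       Inr ` {z. norm z \<noteq> 1 \<and> (z \<noteq> 0 \<or> \<alpha>s = [] \<and> \<beta>s = [] \<and> length \<beta> \<le> n)}"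
  define e where "e = (\<lambda>i j. case i of Inl z \<Rightarrow> z powi s j * a (m j) z | Inr z \<Rightarrow> z powi s j * x (m j) z)"
  define g where "g = (\<lambda>i. case i of Inl z \<Rightarrow> numer \<alpha> \<alpha>s z * poly t z | Inr z \<Rightarrow> numer \<beta> \<beta>s z * y z)"
  have w': "circle_weight w'" unfolding w'_def by (rule circle_weight_modified_weight[OF weight \<beta>(3)])
  have "\<exists>C. \<forall>i\<in>S. g i =
    C * Determinant.det (mat (Suc N) (Suc N) (\<lambda>(r, j). if r = 0 then e i j else b (r - 1) j))"
  proof (rule proportional_to_bordered_det)
    fix c assume c: "\<forall>i\<in>S. (\<Sum>j\<le>N. e i j * c j) = 0"
    show "\<forall>j\<le>N. c j = 0"
    proof (intro allI impI)
      fix j assume "j \<le> N"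
      then show "c j = 0"
      proof (rule columns_independent[where N = N and Ks = Ks and L = L and Ls = Ls and n = n and c = c, rotated 2])
        fix z :: complex assume "z \<noteq> 0" "norm z \<noteq> 1"
        then have "Inl z \<in> S" "Inr z \<in> S" by (auto simp: S_def)
        then show "(\<Sum>j\<le>N. z powi col_shift Ks L Ls j * a (col_index n L Ls j) z * c j) = 0"
          "(\<Sum>j\<le>N. z powi col_shift Ks L Ls j * x (col_index n L Ls j) z * c j) = 0"
          using c by (auto simp: e_def s_def m_def)
      qed
    qed
  next
    fix c assume c: "\<forall>r<N. (\<Sum>j\<le>N. b r j * c j) = 0"
    \<comment> \<open>The first component of column \<open>j\<close> times \<open>z ^ Ks\<close>,
      which makes it a polynomial.\<close>
    define p where "p j = (if m j < 0 then 0 else monom 1 (nat (s j + int Ks)) * f (nat (m j)))" for j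
    have p: "poly (p j) z / z ^ Ks = z powi s j * a (m j) z" if z: "z \<noteq> 0 \<or> Ks = 0" for z j
    proof (cases "m j < 0")
      case False
      have "z ^ nat (s j + int Ks) / z ^ Ks = z powi s j"
      proof (cases "z = 0")
        case True
        then show ?thesis using z s(1)[of j] by (simp add: power_int_def)
      next
        case False
        have "z ^ nat (s j + int Ks) = z powi (s j + int Ks)"
          using s(1)[of j] by (simp add: power_int_def)
        then show ?thesis using False by (simp add: power_int_add)
      qed
      moreover have "poly (p j) z / z ^ Ks = z ^ nat (s j + int Ks) / z ^ Ks * poly (f (nat (m j))) z"
        using False by (simp add: p_def poly_monom)
      ultimately show ?thesis using False a_of_nat[of "nat (m j)" z] by simp
    qed (simp add: p_def a_neg)
    define G where "G = (\<Sum>j\<le>N. Polynomial.smult (c j) (p j))"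
    define Y where "Y z = (\<Sum>j\<le>N. c j * (z powi s j * (x (m j) z / z ^ \<delta>)))" for z
    have G: "poly G z / z ^ Ks = (\<Sum>j\<le>N. z powi s j * a (m j) z * c j)" if "z \<noteq> 0 \<or> Ks = 0" for z
    proof -
      have "poly G z / z ^ Ks = (\<Sum>j\<le>N. c j * (poly (p j) z / z ^ Ks))"
        by (simp add: G_def poly_sum sum_divide_distrib)
      also have "\<dots> = (\<Sum>j\<le>N. z powi s j * a (m j) z * c j)"
        using p[OF that] by (simp add: mult.commute)
      finally show ?thesis .
    qed
    have "\<exists>P. laurent P \<and> (\<forall>z. z \<noteq> 0 \<longrightarrow> norm z \<noteq> 1 \<longrightarrow>
       z powi s j * (x (m j) z / z ^ \<delta>) =
       cauchy_transform w (\<lambda>\<zeta>. \<epsilon> \<zeta> * (\<zeta> powi s j * a (m j) \<zeta>)) z + P z)" for j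
    proof -
      obtain P where "laurent P" "\<And>z. z \<noteq> 0 \<Longrightarrow> norm z \<noteq> 1 \<Longrightarrow>
         z powi s j * (x (m j) z / z ^ \<delta>) =
         cauchy_transform w (\<lambda>\<zeta>. \<epsilon> \<zeta> * (\<zeta> powi s j * a (m j) \<zeta>)) z + P z"
        by (rule x_minus_cauchy_transform_laurent[of "s j" "m j"]) (rule that)
      then show ?thesis by (intro exI[of _ P] conjI allI impI)
    qed
    then obtain P where P: "\<And>j. laurent (P j)" "\<And>j z. z \<noteq> 0 \<Longrightarrow> norm z \<noteq> 1 \<Longrightarrow>
       z powi s j * (x (m j) z / z ^ \<delta>) =
       cauchy_transform w (\<lambda>\<zeta>. \<epsilon> \<zeta> * (\<zeta> powi s j * a (m j) \<zeta>)) z + P j z"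
      by metis
    obtain h where h: "degree h \<le> n" "G = roots_poly (\<alpha> @ \<alpha>s) * h"
      "\<And>i. i < n \<Longrightarrow> wint w' (\<lambda>\<zeta>. \<epsilon> \<zeta> * poly h \<zeta> / \<zeta> ^ Suc i) = 0"
      "\<And>z. z \<noteq> 0 \<Longrightarrow> norm z \<noteq> 1 \<Longrightarrow>
         Y z = numer \<beta> \<beta>s z * cauchy_transform w' (\<lambda>\<zeta>. \<epsilon> \<zeta> * poly h \<zeta>) z"
    proof (rule transform_of_kernel_vector[OF weight cont_\<epsilon> \<alpha>(1) _ _ \<beta>])
      show "poly G r = 0" if r: "r \<in> set (\<alpha> @ \<alpha>s)" for r
      proof -
        obtain i where i: "i < length (\<alpha> @ \<alpha>s)" "(\<alpha> @ \<alpha>s) ! i = r" using r by (meson in_set_conv_nth)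
        then have "i < N" by (simp add: N_def lens)
        with c i have "(\<Sum>j\<le>N. r powi s j * a (m j) r * c j) = 0" by (auto simp: b_def)
        moreover have "r \<noteq> 0 \<or> Ks = 0" using \<alpha>(2) r by (auto simp: Ks_def)
        ultimately show ?thesis using G[of r] by auto
      qed
      show "degree G \<le> n + length (\<alpha> @ \<alpha>s)"
        unfolding G_def
      proof (rule degree_sum_le)
        fix j assume j: "j \<in> {..N}"
        have "degree (p j) \<le> n + length (\<alpha> @ \<alpha>s)"
        proof (cases "m j < 0")
          case False
          have "degree (p j) \<le> nat (s j + int Ks) + degree (f (nat (m j)))"
            using False degree_mult_le[of "monom (1::complex) (nat (s j + int Ks))" "f (nat (m j))"]
            by (simp add: p_def degree_monom_eq)
          also have "\<dots> \<le> nat (s j + int Ks) + nat (m j)" using degree_f by simp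
          also have "\<dots> \<le> n + length (\<alpha> @ \<alpha>s)"
            using False s(1)[of j] s(4)[of j] j by (simp add: m lens)
          finally show ?thesis .
        qed (simp add: p_def)
        then show "degree (Polynomial.smult (c j) (p j)) \<le> n + length (\<alpha> @ \<alpha>s)"
          using degree_smult_le order_trans by blast
      qed simp
      show "Y r = 0" if r: "r \<in> set (\<beta> @ \<beta>s)" for r
      proof -
        obtain i where i: "i < length (\<beta> @ \<beta>s)" "(\<beta> @ \<beta>s) ! i = r" using r by (meson in_set_conv_nth)
        then have "length (\<alpha> @ \<alpha>s) + i < N" by (simp add: N_def lens)
        with c have "(\<Sum>j\<le>N. b (length (\<alpha> @ \<alpha>s) + i) j * c j) = 0" by blast
        then have "(\<Sum>j\<le>N. r powi s j * x (m j) r * c j) / r ^ \<delta> = 0"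
          using i(2) by (simp add: b_def)
        then show ?thesis by (simp add: Y_def sum_divide_distrib mult_ac)
      qed
      show "laurent (\<lambda>z. \<Sum>j\<le>N. c j * P j z)" by (intro laurent_sum laurent_cmult P)
      show "Y z = cauchy_transform w (\<lambda>\<zeta>. \<epsilon> \<zeta> * (poly G \<zeta> / \<zeta> ^ length \<alpha>s)) z + (\<Sum>j\<le>N. c j * P j z)"
        if z: "z \<noteq> 0" "norm z \<noteq> 1" for z
      proof -
        have "cauchy_transform w (\<lambda>\<zeta>. \<epsilon> \<zeta> * (poly G \<zeta> / \<zeta> ^ length \<alpha>s)) z =
            wint w (\<lambda>\<zeta>. \<Sum>j\<le>N. c j * (\<epsilon> \<zeta> * (poly (p j) \<zeta> / \<zeta> ^ Ks) / (\<zeta> - z)))"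
          unfolding cauchy_transform_def
          by (rule wint_cong)
             (simp add: G_def poly_sum sum_divide_distrib sum_distrib_left sum_distrib_right Ks_def mult_ac)
        also have "\<dots> = (\<Sum>j\<le>N. c j * wint w (\<lambda>\<zeta>. \<epsilon> \<zeta> * (poly (p j) \<zeta> / \<zeta> ^ Ks) / (\<zeta> - z)))"
          unfolding wint_cmult[symmetric]
          by (rule wint_sum[OF weight])
             (use z in \<open>auto intro!: continuous_intros cont_\<epsilon>\<close>)
        also have "\<dots> = (\<Sum>j\<le>N. c j * cauchy_transform w (\<lambda>\<zeta>. \<epsilon> \<zeta> * (\<zeta> powi s j * a (m j) \<zeta>)) z)"
        proof (intro sum.cong refl arg_cong2[of _ _ _ _ "(*)"])
          fix j
          show "wint w (\<lambda>\<zeta>. \<epsilon> \<zeta> * (poly (p j) \<zeta> / \<zeta> ^ Ks) / (\<zeta> - z)) =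
            cauchy_transform w (\<lambda>\<zeta>. \<epsilon> \<zeta> * (\<zeta> powi s j * a (m j) \<zeta>)) z"
            unfolding cauchy_transform_def
          proof (rule wint_cong)
            fix \<zeta> :: complex assume "norm \<zeta> = 1"
            then have "\<zeta> \<noteq> 0 \<or> Ks = 0" by auto
            from p[OF this] show "\<epsilon> \<zeta> * (poly (p j) \<zeta> / \<zeta> ^ Ks) / (\<zeta> - z) =
               \<epsilon> \<zeta> * (\<zeta> powi s j * a (m j) \<zeta>) / (\<zeta> - z)" by simp
          qed
        qed
        finally show ?thesis
          unfolding Y_def P(2)[OF z] by (simp add: distrib_left sum.distrib)
      qed
      show "Y \<in> O[at 0](\<lambda>z. z powi (int n - int (length \<beta>s)))"
        unfolding Y_def
      proof (intro big_sum_in_bigo)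
        fix j
        have "(\<lambda>z. z powi s j * (x (m j) z / z ^ \<delta>)) \<in> O[at 0](\<lambda>z. z powi s j * z powi m j)"
          by (intro landau_o.big.mult x_bigo_zero) simp
        also have "(\<lambda>z::complex. z powi s j * z powi m j) \<in> O[at 0](\<lambda>z. z powi (int n - int Ls))"
        proof (rule bigoI[of _ 1])
          show "\<forall>\<^sub>F z::complex in at 0. norm (z powi s j * z powi m j) \<le> 1 * norm (z powi (int n - int Ls))"
            using eventually_at_0_norm_less
          proof eventually_elim
            case (elim z)
            have "norm (z powi s j * z powi m j) = norm z powi (s j + m j)"
              using elim by (simp add: norm_mult norm_power_int power_int_add)
            also have "\<dots> \<le> norm z powi (int n - int Ls)"
              using elim s(3)[of j] by (intro power_int_decreasing) (auto simp: m)
            finally show ?case by (simp add: norm_power_int)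
          qed
        qed
        finally have *: "(\<lambda>z. z powi s j * (x (m j) z / z ^ \<delta>)) \<in> O[at 0](\<lambda>z. z powi (int n - int (length \<beta>s)))"
          unfolding Ls_def .
        show "(\<lambda>z. c j * (z powi s j * (x (m j) z / z ^ \<delta>))) \<in> O[at 0](\<lambda>z. z powi (int n - int (length \<beta>s)))"
        proof (cases "c j = 0")
          case False
          show ?thesis unfolding landau_o.big.cmult_in_iff[OF False] by (rule *)
        qed simp
      qed
      show "Y \<in> O[at_infinity](\<lambda>z. z powi (int (length \<beta>) - 1))"
        unfolding Y_def
      proof (intro big_sum_in_bigo)
        fix j
        have "(\<lambda>z. z powi s j * (x (m j) z / z ^ \<delta>)) \<in> O[at_infinity](\<lambda>z. z powi s j * (1 / z))"
          by (intro landau_o.big.mult x_bigo_infinity) simp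
        also have "(\<lambda>z::complex. z powi s j * (1 / z)) \<in> O[at_infinity](\<lambda>z. z powi (int L - 1))"
        proof (rule bigoI[of _ 1])
          show "\<forall>\<^sub>F z::complex in at_infinity. norm (z powi s j * (1 / z)) \<le> 1 * norm (z powi (int L - 1))"
            using eventually_at_infinity_norm_ge[of 1]
          proof eventually_elim
            case (elim z)
            then have "z \<noteq> 0" by auto
            then have "norm (z powi s j * (1 / z)) = norm z powi (s j - 1)"
              by (simp add: norm_mult norm_divide norm_power_int power_int_diff)
            also have "\<dots> \<le> norm z powi (int L - 1)"
              using elim s(2)[of j] by (intro power_int_increasing) auto
            finally show ?case by (simp add: norm_power_int)
          qed
        qed
        finally have *: "(\<lambda>z. z powi s j * (x (m j) z / z ^ \<delta>)) \<in> O[at_infinity](\<lambda>z. z powi (int (length \<beta>) - 1))"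
          unfolding L_def .
        show "(\<lambda>z. c j * (z powi s j * (x (m j) z / z ^ \<delta>))) \<in> O[at_infinity](\<lambda>z. z powi (int (length \<beta>) - 1))"
        proof (cases "c j = 0")
          case False
          show ?thesis unfolding landau_o.big.cmult_in_iff[OF False] by (rule *)
        qed simp
      qed
    qed (simp_all add: w'_def that)
    from t[OF h(1) h(3)] obtain l where l: "h = Polynomial.smult l t" by blast
    have trans_h: "cauchy_transform w' (\<lambda>\<zeta>. \<epsilon> \<zeta> * poly h \<zeta>) z =
        l * cauchy_transform w' (\<lambda>\<zeta>. \<epsilon> \<zeta> * poly t \<zeta>) z" for z
      unfolding cauchy_transform_def wint_cmult[symmetric]
      by (rule wint_cong) (simp add: l mult_ac)
    have off_0: "(\<Sum>j\<le>N. z powi s j * x (m j) z * c j) = l * (numer \<beta> \<beta>s z * y z)"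
      if z: "z \<noteq> 0" "norm z \<noteq> 1" for z
    proof -
      have "(\<Sum>j\<le>N. z powi s j * x (m j) z * c j) = z ^ \<delta> * Y z"
        using z by (simp add: Y_def sum_distrib_left mult_ac)
      also have "\<dots> = l * (numer \<beta> \<beta>s z * y z)"
        using h(4)[OF z] y[OF z(2)] trans_h[of z] by (simp add: mult_ac)
      finally show ?thesis .
    qed
    show "\<exists>l. \<forall>i\<in>S. (\<Sum>j\<le>N. e i j * c j) = l * g i"
    proof (intro exI ballI)
      fix i assume "i \<in> S"
      then consider z where "i = Inl z" "z \<noteq> 0 \<or> \<alpha>s = []"
        | z where "i = Inr z" "norm z \<noteq> 1" "z \<noteq> 0"
        | "i = Inr 0" "\<alpha>s = []" "\<beta>s = []" "length \<beta> \<le> n"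
        unfolding S_def by auto
      then show "(\<Sum>j\<le>N. e i j * c j) = l * g i"
      proof cases
        case (1 z)
        then have "z \<noteq> 0 \<or> Ks = 0" by (auto simp: Ks_def)
        from G[OF this] show ?thesis
          using 1 by (simp add: e_def g_def h(2) l numer_eq_roots_poly Ks_def mult_ac)
      next
        case (2 z)
        then show ?thesis using off_0[of z] by (simp add: e_def g_def)
      next
        \<comment> \<open>The kernel argument reaches only \<open>z \<noteq> 0\<close>. Under these
          provisos every shift and every index is nonnegative, and Cauchy transforms are continuous
          at 0, so both sides extend and agree there.\<close>
        case 3
        let ?lhs = "\<lambda>z. \<Sum>j\<le>N. z powi s j * x (m j) z * c j"
        let ?rhs = "\<lambda>z. l * (numer \<beta> \<beta>s z * y z)"
        have cauchy_cont: "isCont (cauchy_transform v (\<lambda>\<zeta>. \<epsilon> \<zeta> * poly r \<zeta>)) 0"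
          if "circle_weight v" for v r
          using cauchy_transform_has_fps_expansion[OF that cont_\<epsilon>_poly]
          by (rule has_fps_expansion_imp_continuous)
        have ev: "\<forall>\<^sub>F z in nhds 0. norm (z::complex) \<noteq> 1"
          unfolding eventually_nhds_metric by (intro exI[of _ "1/2"]) auto
        have x_eq: "z powi s j * x (m j) z * c j =
            z ^ nat (s j) * (z ^ \<delta> * cauchy_transform w (\<lambda>\<zeta>. \<epsilon> \<zeta> * poly (f (nat (m j))) \<zeta>) z) * c j"
          if "norm z \<noteq> 1" for z j
        proof -
          have "s j \<ge> 0" "m j \<ge> 0" using 3 s(1)[of j] by (auto simp: m lens)
          then show ?thesis using x_of_nat[OF that, of "nat (m j)"] by (simp add: power_int_def)
        qed
        have "isCont (\<lambda>z. z powi s j * x (m j) z * c j) 0" for j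
        proof (subst isCont_cong[OF eventually_mono[OF ev]])
          show "isCont (\<lambda>z. z ^ nat (s j) *
              (z ^ \<delta> * cauchy_transform w (\<lambda>\<zeta>. \<epsilon> \<zeta> * poly (f (nat (m j))) \<zeta>) z) * c j) 0"
            by (intro continuous_intros cauchy_cont weight)
        qed (rule x_eq)
        then have "isCont ?lhs 0" by (intro continuous_sum)
        moreover have "isCont ?rhs 0"
        proof (subst isCont_cong[OF eventually_mono[OF ev]])
          show "isCont (\<lambda>z. l * (poly (roots_poly \<beta>) z *
             (z ^ \<delta> * cauchy_transform w' (\<lambda>\<zeta>. \<epsilon> \<zeta> * poly t \<zeta>) z))) 0"
            by (intro continuous_intros cauchy_cont w')
          show "?rhs z = l * (poly (roots_poly \<beta>) z *
             (z ^ \<delta> * cauchy_transform w' (\<lambda>\<zeta>. \<epsilon> \<zeta> * poly t \<zeta>) z))" if "norm z \<noteq> 1" for z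
            using that 3 by (simp add: y numer_eq_roots_poly)
        qed
        moreover have "\<forall>\<^sub>F z in at 0. ?lhs z = ?rhs z"
          using eventually_at_0_norm_less by eventually_elim (use off_0 in auto)
        ultimately have "?lhs 0 = ?rhs 0"
          unfolding isCont_def by (intro tendsto_unique[OF at_neq_bot _ tendsto_cong[THEN iffD2]])
        then show ?thesis using 3 by (simp add: e_def g_def)
      qed
    qed
  qed
  then obtain C where C: "\<And>i. i \<in> S \<Longrightarrow> g i =
    C * Determinant.det (mat (Suc N) (Suc N) (\<lambda>(r, j). if r = 0 then e i j else b (r - 1) j))" by blast
  have det: "bordered_det \<alpha> \<alpha>s \<beta> \<beta>s n a' a x z =
     Determinant.det (mat (Suc N) (Suc N) (\<lambda>(r, j). if r = 0 then z powi s j * a' (m j) z else b (r - 1) j))"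
    for a' z
    unfolding bordered_det_eq b_def s_def m_def N_def lens by (rule refl)
  show ?thesis
  proof (intro exI conjI allI impI)
    fix z :: complex assume "z \<noteq> 0 \<or> \<alpha>s = []"
    then have "Inl z \<in> S" by (auto simp: S_def)
    from C[OF this] show "numer \<alpha> \<alpha>s z * poly t z = C * bordered_det \<alpha> \<alpha>s \<beta> \<beta>s n a a x z"
      unfolding det by (simp only: g_def e_def sum.case)
  next
    fix z :: complex assume "norm z \<noteq> 1 \<and> (z \<noteq> 0 \<or> \<alpha>s = [] \<and> \<beta>s = [] \<and> length \<beta> \<le> n)"
    then have "Inr z \<in> S" by (auto simp: S_def)
    from C[OF this] show "numer \<beta> \<beta>s z * y z = C * bordered_det \<alpha> \<alpha>s \<beta> \<beta>s n x a x z"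
      unfolding det by (simp only: g_def e_def sum.case)
  qed
qed

end

section \<open>Bi-orthogonal systems\<close>

text \<open>An abstract bilinear form, not assumed symmetric, so that exchanging its arguments turns
  each fact about \<open>\<phi>\<close> into one about \<open>\<psi>\<close>.\<close>

locale biorthogonal_pair =
  fixes B :: "complex poly \<Rightarrow> complex poly \<Rightarrow> complex" and \<phi> \<psi> :: "nat \<Rightarrow> complex poly"
  assumes add_left: "B (p + p') q = B p q + B p' q" and add_right: "B p (q + q') = B p q + B p q'"
    and smult_left: "B (Polynomial.smult c p) q = c * B p q"
    and smult_right: "B p (Polynomial.smult c q) = c * B p q"
    and degree: "degree (\<phi> n) = n" "degree (\<psi> n) = n"
    and lead_coeff_eq: "lead_coeff (\<phi> n) = lead_coeff (\<psi> n)"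
    and biorth: "B (\<phi> m) (\<psi> n) = (if m = n then 1 else 0)"
begin

lemma zero_left: "B 0 q = 0" and zero_right: "B p 0 = 0"
  using smult_left[of 0 0 q] smult_right[of p 0 0] by simp_all

lemma diff_left: "B (p - p') q = B p q - B p' q" and diff_right: "B p (q - q') = B p q - B p q'"
  by (simp_all add: eq_diff_eq flip: add_left add_right)

lemma lead_coeff_neq_0: "lead_coeff (\<phi> n) \<noteq> 0" "coeff (\<phi> n) n \<noteq> 0" "coeff (\<psi> n) n \<noteq> 0"
proof -
  have "\<phi> n \<noteq> 0" using biorth[of n n] zero_left by auto
  then show "lead_coeff (\<phi> n) \<noteq> 0" by simp
  then show "coeff (\<phi> n) n \<noteq> 0" "coeff (\<psi> n) n \<noteq> 0"
    using lead_coeff_eq[of n] degree[of n] by simp_all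
qed

lemma coeff_eq: "coeff (\<psi> n) n = coeff (\<phi> n) n"
  using lead_coeff_eq[of n] degree[of n] by simp

text \<open>Strips the top coefficient of \<open>q\<close> with a multiple of
  \<open>\<psi> k\<close>, which pairs to zero with \<open>\<phi> m\<close> as \<open>k < m\<close>.
  Bounding the support by coefficients instead of the degree lets \<open>k = 0\<close> mean
  \<open>q = 0\<close>.\<close>

lemma orthogonal_lower:
  assumes "k \<le> m" "\<And>i. i \<ge> k \<Longrightarrow> coeff q i = 0"
  shows "B (\<phi> m) q = 0"
  using assms
proof (induction k arbitrary: q)
  case 0
  then have "q = 0" by (simp add: poly_eq_iff)
  then show ?case by (simp add: zero_right)
next
  case (Suc k)
  define c where "c = coeff q k / coeff (\<psi> k) k"
  have "B (\<phi> m) (q - Polynomial.smult c (\<psi> k)) = 0"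
  proof (rule Suc.IH)
    fix i assume "i \<ge> k"
    then show "coeff (q - Polynomial.smult c (\<psi> k)) i = 0"
      using Suc.prems(2)[of i] lead_coeff_neq_0(3)[of k]
      by (cases "i = k") (simp_all add: c_def coeff_eq_0 degree)
  qed (use Suc.prems in simp)
  then show ?case using Suc.prems(1) by (simp add: diff_right smult_right biorth)
qed

text \<open>Only the part of \<open>q\<close> along \<open>\<psi> m\<close> survives, and
  \<open>\<psi> m\<close> has the same leading coefficient as \<open>\<phi> m\<close>.\<close>

lemma pairing_degree_le:
  assumes "degree q \<le> m"
  shows "B (\<phi> m) q = coeff q m / coeff (\<phi> m) m"
proof -
  define c where "c = coeff q m / coeff (\<psi> m) m"
  have "B (\<phi> m) (q - Polynomial.smult c (\<psi> m)) = 0"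
  proof (rule orthogonal_lower[OF order_refl])
    fix i assume "i \<ge> m"
    then show "coeff (q - Polynomial.smult c (\<psi> m)) i = 0"
      using lead_coeff_neq_0(3)[of m] assms
      by (cases "i = m") (simp_all add: c_def coeff_eq_0 degree)
  qed
  then show ?thesis by (simp add: diff_right smult_right biorth c_def coeff_eq)
qed

lemma pairing_monom: "i < m \<Longrightarrow> B (\<phi> m) (monom 1 i) = 0"
  "B (\<phi> m) (monom 1 m) = 1 / coeff (\<phi> m) m"
  by (rule orthogonal_lower[OF order_refl]) (auto simp: pairing_degree_le degree_monom_eq)

lemma swap: "biorthogonal_pair (\<lambda>p q. B q p) \<psi> \<phi>"
  by unfold_locales
     (auto simp: add_left add_right smult_left smult_right degree biorth coeff_eq)

text \<open>The form is not positive definite, so the remainder \<open>r\<close> is not paired with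
  itself but with \<open>\<psi> d\<close>, where \<open>d\<close> is its degree: this detects its
  leading coefficient, while the expansion of \<open>\<psi> d\<close> in monomials gives 0.\<close>

lemma multiple_of_orthogonal:
  assumes deg: "degree p \<le> n" and orth: "\<And>i. i < n \<Longrightarrow> B p (monom 1 i) = 0"
  shows "\<exists>l. p = Polynomial.smult l (\<phi> n)"
proof -
  interpret swapped: biorthogonal_pair "\<lambda>p q. B q p" \<psi> \<phi> by (rule swap)
  define l where "l = coeff p n / coeff (\<phi> n) n"
  define r where "r = p - Polynomial.smult l (\<phi> n)"
  have r_coeff: "coeff r i = 0" if "i \<ge> n" for i
    using that lead_coeff_neq_0(2)[of n] deg
    by (cases "i = n") (simp_all add: r_def l_def coeff_eq_0 degree)
  have "r = 0"
  proof (rule ccontr)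
    assume "r \<noteq> 0"
    define d where "d = degree r"
    have "d < n" using r_coeff[of d] \<open>r \<noteq> 0\<close> by (force simp: d_def)
    have "B r (\<psi> d) = coeff r d / coeff (\<psi> d) d"
      by (rule swapped.pairing_degree_le) (simp add: d_def)
    moreover have "B r (\<psi> d) = 0"
    proof -
      have B_sum: "B r (\<Sum>i\<in>I. g i) = (\<Sum>i\<in>I. B r (g i))" for g :: "nat \<Rightarrow> complex poly" and I
        by (induction I rule: infinite_finite_induct) (simp_all add: zero_right add_right)
      have "\<psi> d = (\<Sum>i\<le>d. Polynomial.smult (coeff (\<psi> d) i) (monom 1 i))"
        using poly_as_sum_of_monoms[of "\<psi> d"] by (simp add: degree smult_monom)
      then have "B r (\<psi> d) = (\<Sum>i\<le>d. coeff (\<psi> d) i * B r (monom 1 i))"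
        by (metis (no_types, lifting) B_sum smult_right sum.cong)
      also have "\<dots> = 0"
        using \<open>d < n\<close> by (intro sum.neutral) (auto simp: r_def diff_left smult_left orth pairing_monom)
      finally show ?thesis .
    qed
    ultimately show False using \<open>r \<noteq> 0\<close> lead_coeff_neq_0(3)[of d] by (simp add: d_def)
  qed
  then show ?thesis by (auto simp: r_def)
qed

end

section \<open>The pairing of a weight and its associated functions\<close>

definition circle_pairing :: "(complex \<Rightarrow> complex) \<Rightarrow> complex poly \<Rightarrow> complex poly \<Rightarrow> complex" where
  "circle_pairing w p q = wint w (\<lambda>\<zeta>. poly p \<zeta> * poly q (1 / \<zeta>))"

lemma continuous_on_poly_inverse:
  "continuous_on (sphere 0 1) (\<lambda>\<zeta>::complex. poly q (1 / \<zeta>))"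
  by (intro continuous_intros) auto

lemma biorthogonal_pair_circle_pairing:
  assumes w: "circle_weight w" and sys: "biorthogonal_system w \<phi> \<psi>"
  shows "biorthogonal_pair (circle_pairing w) \<phi> \<psi>"
proof
  have cont: "continuous_on (sphere 0 1) (\<lambda>\<zeta>. poly p \<zeta> * poly q (1 / \<zeta>))" for p q :: "complex poly"
    by (intro continuous_intros continuous_on_poly_inverse)
  show "circle_pairing w (p + p') q = circle_pairing w p q + circle_pairing w p' q" for p p' q
    using wint_add[OF w cont[of p q] cont[of p' q]] by (simp add: circle_pairing_def distrib_right)
  show "circle_pairing w p (q + q') = circle_pairing w p q + circle_pairing w p q'" for p q q'
    using wint_add[OF w cont[of p q] cont[of p q']] by (simp add: circle_pairing_def distrib_left)
  show "circle_pairing w (Polynomial.smult c p) q = c * circle_pairing w p q" for c p q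
    by (simp add: circle_pairing_def wint_cmult mult.assoc)
  show "circle_pairing w p (Polynomial.smult c q) = c * circle_pairing w p q" for c p q
    by (simp add: circle_pairing_def wint_cmult[symmetric] mult.left_commute)
  show "circle_pairing w (\<phi> m) (\<psi> n) = (if m = n then 1 else 0)" for m n
    using sys by (simp add: biorthogonal_system_def circle_pairing_def wint_def mult.assoc)
  show "degree (\<phi> n) = n" "degree (\<psi> n) = n" "lead_coeff (\<phi> n) = lead_coeff (\<psi> n)" for n
    using sys unfolding biorthogonal_system_def by blast+
qed

lemma wint_herglotz:
  assumes w: "circle_weight w" and g: "continuous_on (sphere 0 1) g" and z: "norm z \<noteq> 1"
  shows "wint w g + wint w (\<lambda>\<zeta>. (\<zeta> + z) / (\<zeta> - z) * g \<zeta>) = cauchy_transform w (\<lambda>\<zeta>. 2 * \<zeta> * g \<zeta>) z"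
    and "wint w g - wint w (\<lambda>\<zeta>. (\<zeta> + z) / (\<zeta> - z) * g \<zeta>) = z * cauchy_transform w (\<lambda>\<zeta>. - 2 * g \<zeta>) z"
proof -
  have c: "continuous_on (sphere 0 1) (\<lambda>\<zeta>. (\<zeta> + z) / (\<zeta> - z) * g \<zeta>)"
    using z by (auto intro!: continuous_intros g)
  show "wint w g + wint w (\<lambda>\<zeta>. (\<zeta> + z) / (\<zeta> - z) * g \<zeta>) = cauchy_transform w (\<lambda>\<zeta>. 2 * \<zeta> * g \<zeta>) z"
    unfolding cauchy_transform_def wint_add[OF w g c, symmetric]
  proof (rule wint_cong)
    fix \<zeta> :: complex assume "norm \<zeta> = 1"
    then have "\<zeta> - z \<noteq> 0" using z by auto
    then show "g \<zeta> + (\<zeta> + z) / (\<zeta> - z) * g \<zeta> = 2 * \<zeta> * g \<zeta> / (\<zeta> - z)"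
      by (simp add: divide_simps) (simp add: algebra_simps)
  qed
  show "wint w g - wint w (\<lambda>\<zeta>. (\<zeta> + z) / (\<zeta> - z) * g \<zeta>) = z * cauchy_transform w (\<lambda>\<zeta>. - 2 * g \<zeta>) z"
    unfolding cauchy_transform_def wint_diff[OF w g c, symmetric] wint_cmult[symmetric]
  proof (rule wint_cong)
    fix \<zeta> :: complex assume "norm \<zeta> = 1"
    then have "\<zeta> - z \<noteq> 0" using z by auto
    then show "g \<zeta> - (\<zeta> + z) / (\<zeta> - z) * g \<zeta> = z * (- 2 * g \<zeta> / (\<zeta> - z))"
      by (simp add: divide_simps) (simp add: algebra_simps)
  qed
qed

locale biorthogonal_weight =
  fixes w :: "complex \<Rightarrow> complex" and \<phi> \<psi> :: "nat \<Rightarrow> complex poly"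
  assumes weight: "circle_weight w" and system: "biorthogonal_system w \<phi> \<psi>"
begin

sublocale biorthogonal_pair "circle_pairing w" \<phi> \<psi>
  by (rule biorthogonal_pair_circle_pairing[OF weight system])

sublocale swapped: biorthogonal_pair "\<lambda>p q. circle_pairing w q p" \<psi> \<phi>
  by (rule swap)

lemma wint_phi: "wint w (\<lambda>\<zeta>. 2 * \<zeta> * poly p \<zeta> / \<zeta> ^ Suc i) = 2 * circle_pairing w p (monom 1 i)"
  unfolding circle_pairing_def wint_cmult[symmetric]
  by (rule wint_cong) (auto simp: poly_monom power_divide)

lemma wint_psi: "wint w (\<lambda>\<zeta>. poly q (1 / \<zeta>) * \<zeta> ^ i) = circle_pairing w (monom 1 i) q"
  unfolding circle_pairing_def by (simp add: poly_monom mult.commute)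

lemma poly_reciprocal: "\<zeta> \<noteq> 0 \<Longrightarrow> poly (reciprocal \<psi> m) \<zeta> = \<zeta> ^ m * poly (\<psi> m) (1 / \<zeta>)"
  by (simp add: reciprocal_def poly_reflect_poly_nz degree inverse_eq_divide)

text \<open>\<open>\<zeta> ^ m / \<zeta> ^ Suc i\<close> is \<open>\<zeta> ^ (m - Suc i)\<close>, so
  reversal permutes the test powers \<open>0, ..., m - 1\<close> and the claim is orthogonality of
  \<open>\<psi> m\<close> in the swapped pair.\<close>

lemma wint_reciprocal:
  assumes "i < m"
  shows "wint w (\<lambda>\<zeta>. - 2 * poly (reciprocal \<psi> m) \<zeta> / \<zeta> ^ Suc i) = 0"
proof -
  have "wint w (\<lambda>\<zeta>. - 2 * poly (reciprocal \<psi> m) \<zeta> / \<zeta> ^ Suc i) =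
      - 2 * wint w (\<lambda>\<zeta>. poly (\<psi> m) (1 / \<zeta>) * \<zeta> ^ (m - Suc i))"
    unfolding wint_cmult[symmetric]
  proof (rule wint_cong)
    fix \<zeta> :: complex assume "norm \<zeta> = 1"
    then have "\<zeta> \<noteq> 0" by auto
    then show "- 2 * poly (reciprocal \<psi> m) \<zeta> / \<zeta> ^ Suc i =
        - 2 * (poly (\<psi> m) (1 / \<zeta>) * \<zeta> ^ (m - Suc i))"
      using assms by (simp add: poly_reciprocal power_diff)
  qed
  then show ?thesis using assms by (simp add: wint_psi swapped.pairing_monom)
qed

text \<open>The normalisation at index 0. It is what removes \<open>w\<close> from the associated
  functions of negative index.\<close>

lemma lead_coeff_sq_moment: "coeff (\<phi> 0) 0 * coeff (\<phi> 0) 0 * moment w 0 = 1"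
proof -
  obtain a b where ab: "\<phi> 0 = [:a:]" "\<psi> 0 = [:b:]"
    using degree[of 0] by (meson degree_eq_zeroE)
  then have "b = a" using lead_coeff_eq[of 0] by simp
  then show ?thesis using biorth[of 0 0] wint_cmult[of w "a * a" "\<lambda>_. 1"]
    by (simp add: ab circle_pairing_def moment_def wint_def)
qed

text \<open>The extra moment in the definition at index 0 is the term that orthogonality makes
  vanish for \<open>m > 0\<close>; a single formula results.\<close>

lemma assoc_eq_cauchy_transform:
  assumes z: "norm z \<noteq> 1"
  shows "assoc w \<phi> m z = cauchy_transform w (\<lambda>\<zeta>. 2 * \<zeta> * poly (\<phi> m) \<zeta>) z"
proof -
  note herglotz = wint_herglotz(1)[OF weight _ z, of "poly (\<phi> m)", OF continuous_on_poly[OF continuous_on_id]]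
  show ?thesis
  proof (cases "m = 0")
    case True
    obtain a where a: "\<phi> 0 = [:a:]" using degree[of 0] by (meson degree_eq_zeroE)
    have "assoc w \<phi> 0 z = wint w (\<lambda>\<zeta>. a * 1) + wint w (\<lambda>\<zeta>. a * ((\<zeta> + z) / (\<zeta> - z)))"
      unfolding wint_cmult
      by (simp add: assoc_def a moment_def caratheodory_def wint_def distrib_left mult.commute)
    moreover have "poly [:a:] = (\<lambda>_. a)" by (simp add: fun_eq_iff)
    ultimately show ?thesis using True a herglotz by (simp add: mult.commute)
  next
    case False
    then have "wint w (poly (\<phi> m)) = 0"
      using pairing_monom(1)[of 0 m] by (simp add: circle_pairing_def poly_monom)
    moreover have "assoc w \<phi> m z = wint w (\<lambda>\<zeta>. (\<zeta> + z) / (\<zeta> - z) * poly (\<phi> m) \<zeta>)"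
      using False by (simp add: assoc_def wint_def mult_ac)
    ultimately show ?thesis using herglotz by simp
  qed
qed

text \<open>The definition has \<open>z ^ m\<close> outside and \<open>\<psi>(1 / \<zeta>)\<close>
  inside. The first \<open>m\<close> Taylor coefficients of the transform of
  \<open>reciprocal \<psi> m\<close> vanish, so its exact expansion consists of \<open>z ^ m\<close>
  times the remainder alone, which is that form.\<close>

lemma assoc_star_eq_cauchy_transform:
  assumes z: "norm z \<noteq> 1"
  shows "assoc_star w \<psi> m z = z * cauchy_transform w (\<lambda>\<zeta>. - 2 * poly (reciprocal \<psi> m) \<zeta>) z"
proof -
  note herglotz = wint_herglotz(2)[OF weight continuous_on_poly_inverse z, of "\<psi> m"]
  show ?thesis
  proof (cases "m = 0")
    case True
    obtain a where a: "\<psi> 0 = [:a:]" using degree(2)[of 0] by (meson degree_eq_zeroE)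
    have "assoc_star w \<psi> 0 z = wint w (\<lambda>\<zeta>. a * 1) - wint w (\<lambda>\<zeta>. a * ((\<zeta> + z) / (\<zeta> - z)))"
      unfolding wint_cmult
      by (simp add: assoc_star_def a moment_def caratheodory_def wint_def right_diff_distrib mult.commute)
    then show ?thesis using True a herglotz by (simp add: reciprocal_def mult.commute)
  next
    case False
    define g where "g = (\<lambda>\<zeta>. - 2 * poly (reciprocal \<psi> m) \<zeta>)"
    have g: "continuous_on (sphere 0 1) g" unfolding g_def by (intro continuous_intros)
    have "cauchy_transform w g z = z ^ m * cauchy_transform w (\<lambda>\<zeta>. g \<zeta> / \<zeta> ^ m) z"
      using cauchy_transform_expansion[OF weight g z, of m] wint_reciprocal[of _ m]
      by (simp add: g_def)
    also have "cauchy_transform w (\<lambda>\<zeta>. g \<zeta> / \<zeta> ^ m) z =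
        cauchy_transform w (\<lambda>\<zeta>. - 2 * poly (\<psi> m) (1 / \<zeta>)) z"
      unfolding cauchy_transform_def
    proof (rule wint_cong)
      fix \<zeta> :: complex assume "norm \<zeta> = 1"
      then have "\<zeta> \<noteq> 0" by auto
      then show "g \<zeta> / \<zeta> ^ m / (\<zeta> - z) = - 2 * poly (\<psi> m) (1 / \<zeta>) / (\<zeta> - z)"
        by (simp add: g_def poly_reciprocal)
    qed
    also have "z * (z ^ m * cauchy_transform w (\<lambda>\<zeta>. - 2 * poly (\<psi> m) (1 / \<zeta>)) z) =
        - (z ^ m) * wint w (\<lambda>\<zeta>. (\<zeta> + z) / (\<zeta> - z) * poly (\<psi> m) (1 / \<zeta>))"
    proof -
      have "wint w (\<lambda>\<zeta>. poly (\<psi> m) (1 / \<zeta>)) = 0"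
        using wint_psi[of "\<psi> m" 0] swapped.pairing_monom(1)[of 0 m] False by simp
      with herglotz have "z * cauchy_transform w (\<lambda>\<zeta>. - 2 * poly (\<psi> m) (1 / \<zeta>)) z =
          - wint w (\<lambda>\<zeta>. (\<zeta> + z) / (\<zeta> - z) * poly (\<psi> m) (1 / \<zeta>))" by simp
      then show ?thesis by (simp only: mult.left_commute[of z]) simp
    qed
    also have "\<dots> = assoc_star w \<psi> m z"
      using False by (simp add: assoc_star_def wint_def mult_ac)
    finally show ?thesis by (simp add: g_def)
  qed
qed

end

text \<open>Entry \<open>i\<close> describes index \<open>- i - 1\<close>: the first polynomial over
  \<open>z ^ Suc i\<close> and the second over \<open>z ^ i\<close>. The denominators differ by one
  power, hence \<open>pCons 0\<close>, multiplication by \<open>z\<close>, on the second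
  polynomial.\<close>

primrec neg_xi_polys ::
  "(int \<Rightarrow> complex) \<Rightarrow> (int \<Rightarrow> complex) \<Rightarrow> (int \<Rightarrow> complex) \<Rightarrow> nat \<Rightarrow> complex poly \<times> complex poly" where
  "neg_xi_polys k p q 0 = ([:2 / k (-1):], [:2 / k (-1):])"
| "neg_xi_polys k p q (Suc i) = (let (u, v) = neg_xi_polys k p q i; m = - int (Suc i) in
     (Polynomial.smult (1 / k (m - 1)) (Polynomial.smult (k m) u + pCons 0 (Polynomial.smult (p m) v)),
      Polynomial.smult (1 / k (m - 1)) (Polynomial.smult (q m) u + pCons 0 (Polynomial.smult (k m) v))))"

text \<open>Up to the nonzero prefactor, the new constant terms are \<open>k m\<close> and
  \<open>q m\<close> times that of \<open>u i\<close>, and the new top coefficients are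
  \<open>p m\<close> and \<open>k m\<close> times that of \<open>v i\<close>, as \<open>u i\<close>
  does not reach degree \<open>Suc i\<close>. None of these constants is zero.\<close>

lemma neg_xi_polys_degree_coeff:
  assumes "\<forall>m<0. k m \<noteq> 0 \<and> p m \<noteq> 0 \<and> q m \<noteq> 0"
  defines "u \<equiv> \<lambda>i. fst (neg_xi_polys k p q i)" and "v \<equiv> \<lambda>i. snd (neg_xi_polys k p q i)"
  shows "degree (u i) \<le> i \<and> coeff (u i) 0 \<noteq> 0 \<and> coeff (u i) i \<noteq> 0 \<and>
         degree (v i) \<le> i \<and> coeff (v i) 0 \<noteq> 0 \<and> coeff (v i) i \<noteq> 0"
proof (induction i)
  case 0
  then show ?case using assms(1) by (simp add: u_def v_def)
next
  case (Suc i)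
  define m where "m = - int (Suc i)"
  have m: "k m \<noteq> 0" "p m \<noteq> 0" "q m \<noteq> 0" "k (m - 1) \<noteq> 0" using assms(1) by (auto simp: m_def)
  have u: "u (Suc i) = Polynomial.smult (1 / k (m - 1))
       (Polynomial.smult (k m) (u i) + pCons 0 (Polynomial.smult (p m) (v i)))"
    and v: "v (Suc i) = Polynomial.smult (1 / k (m - 1))
       (Polynomial.smult (q m) (u i) + pCons 0 (Polynomial.smult (k m) (v i)))"
    unfolding u_def v_def m_def by (simp_all add: Let_def split: prod.split)
  have top: "coeff (u i) (Suc i) = 0" using Suc by (simp add: coeff_eq_0)
  have deg: "degree (Polynomial.smult c (Polynomial.smult a (u i) + pCons 0 (Polynomial.smult b (v i)))) \<le> Suc i"
    for a b c
  proof -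
    have "degree (pCons 0 (Polynomial.smult b (v i))) \<le> Suc i"
      using Suc degree_pCons_le[of 0 "Polynomial.smult b (v i)"] degree_smult_le[of b "v i"] by linarith
    moreover have "degree (Polynomial.smult a (u i)) \<le> Suc i"
      using Suc degree_smult_le[of a "u i"] by linarith
    ultimately show ?thesis using degree_smult_le degree_add_le order_trans by metis
  qed
  show ?case
    using Suc m top unfolding u v by (intro conjI deg) simp_all
qed

lemma (in biorthogonal_weight) neg_xi_eq:
  assumes z: "z \<noteq> 0" and k: "\<forall>m<0. k m \<noteq> 0 \<and> p m \<noteq> 0 \<and> q m \<noteq> 0"
  shows "neg_xi w \<phi> \<psi> k p q (- int (Suc i)) z =
    (poly (fst (neg_xi_polys k p q i)) z / z ^ Suc i, poly (snd (neg_xi_polys k p q i)) z / z ^ i)"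
proof (induction i)
  case 0
  have ne: "k (-1) \<noteq> 0" using k by simp
  have zero: "poly (\<phi> 0) 0 = coeff (\<phi> 0) 0" "poly (\<psi> 0) 0 = coeff (\<phi> 0) 0"
    "lead_coeff (\<phi> 0) = coeff (\<phi> 0) 0" "lead_coeff (\<psi> 0) = coeff (\<phi> 0) 0"
    using coeff_eq[of 0] degree[of 0] by (simp_all add: poly_0_coeff_0)
  \<comment> \<open>At index 0 the leading coefficients and the values at 0 of both polynomials
    coincide, so the backward step adds the two functions; \<open>caratheodory w z\<close> cancels
    and the normalisation leaves the constant 2.\<close>
  have "coeff (\<phi> 0) 0 * assoc w \<phi> 0 z + coeff (\<phi> 0) 0 * assoc_star w \<psi> 0 z =
      2 * (coeff (\<phi> 0) 0 * coeff (\<phi> 0) 0 * moment w 0)"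
    by (simp add: assoc_def assoc_star_def zero algebra_simps)
  then have "coeff (\<phi> 0) 0 * assoc w \<phi> 0 z + coeff (\<phi> 0) 0 * assoc_star w \<psi> 0 z = 2"
    by (simp only: lead_coeff_sq_moment mult_1_right)
  then show ?case
    by (simp add: neg_xi_def back_step_def lead_ext_def zero_ext_def zero)
next
  case (Suc i)
  define m where "m = - int (Suc i)"
  have m: "m < 0" "m - 1 < 0" "- int (Suc (Suc i)) = m - 1" by (auto simp: m_def)
  have "neg_xi w \<phi> \<psi> k p q (- int (Suc (Suc i))) z =
     back_step 1 (lead_ext \<phi> k) (zero_ext \<phi> p) (zero_ext \<psi> q) z (m - 1) (neg_xi w \<phi> \<psi> k p q m z)"
    unfolding neg_xi_def m_def
    by (simp only: nat_int minus_minus back_run.simps) (simp add: m_def[symmetric])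
  also have "neg_xi w \<phi> \<psi> k p q m z =
     (poly (fst (neg_xi_polys k p q i)) z / z ^ Suc i, poly (snd (neg_xi_polys k p q i)) z / z ^ i)"
    unfolding m_def by (rule Suc)
  finally show ?case
    using z m(1,2) k[rule_format, OF m(2)]
    by (simp add: back_step_def lead_ext_def zero_ext_def Let_def case_prod_unfold m_def[symmetric] field_simps
             del: of_nat_Suc)
qed

text \<open>At index 0 both starting values equal the common leading coefficient, and with the sign
  \<open>-1\<close> the first step cancels them; afterwards the step is linear.\<close>

lemma (in biorthogonal_weight) neg_phi_eq_0:
  "neg_phi \<phi> \<psi> k p q (- int (Suc i)) z = (0, 0)"
proof -
  obtain a where a: "\<phi> 0 = [:a:]" using degree(1)[of 0] by (meson degree_eq_zeroE)
  obtain b where b: "\<psi> 0 = [:b:]" using degree(2)[of 0] by (meson degree_eq_zeroE)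
  have "b = a" using lead_coeff_eq[of 0] by (simp add: a b)
  then have "back_run (-1) (lead_ext \<phi> k) (zero_ext \<phi> p) (zero_ext \<psi> q) z
      (poly (\<phi> 0) z, poly (reciprocal \<psi> 0) z) (Suc i) = (0, 0)"
    by (induction i)
       (simp_all add: a b reciprocal_def back_step_def lead_ext_def zero_ext_def)
  then show ?thesis by (simp add: neg_phi_def del: back_run.simps of_nat_Suc)
qed

lemma (in biorthogonal_weight) biorthogonal_family_phi:
  assumes generic: "generic_r \<phi> \<psi>" and k: "\<forall>m<0. k m \<noteq> 0 \<and> p m \<noteq> 0 \<and> q m \<noteq> 0"
  shows "biorthogonal_family w (\<lambda>\<zeta>. 2 * \<zeta>) 0 \<phi> (\<lambda>i. fst (neg_xi_polys k p q i))
    (phi_seq \<phi> \<psi> k p q) (xi_seq w \<phi> \<psi> k p q)"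
proof
  show "circle_weight w" by (rule weight)
  show "continuous_on (sphere 0 1) (\<lambda>\<zeta>::complex. 2 * \<zeta>)" by (intro continuous_intros)
  fix m :: nat and l :: int and z :: complex
  show "degree (\<phi> m) \<le> m" by (simp add: degree)
  show "coeff (\<phi> m) m \<noteq> 0" by (rule lead_coeff_neq_0)
  then show "coeff (\<phi> m) 0 \<noteq> 0"
    using generic by (cases "m = 0") (auto simp: generic_r_def poly_0_coeff_0 dest!: spec[of _ m])
  show "wint w (\<lambda>\<zeta>. 2 * \<zeta> * poly (\<phi> m) \<zeta> / \<zeta> ^ Suc i) = 0" if "i < m" for i
    unfolding wint_phi using pairing_monom(1)[OF that] by simp
  show "phi_seq \<phi> \<psi> k p q (int m) z = poly (\<phi> m) z" by (simp add: phi_seq_def)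
  show "phi_seq \<phi> \<psi> k p q l z = 0" if "l < 0"
    using that neg_phi_eq_0[of k p q "nat (- l - 1)" z] by (simp add: phi_seq_def)
  show "xi_seq w \<phi> \<psi> k p q (int m) z = z ^ 0 * cauchy_transform w (\<lambda>\<zeta>. 2 * \<zeta> * poly (\<phi> m) \<zeta>) z"
    if "norm z \<noteq> 1"
    using assoc_eq_cauchy_transform[OF that] by (simp add: xi_seq_def)
  show "xi_seq w \<phi> \<psi> k p q (- int (Suc m)) z =
      z ^ 0 * (poly (fst (neg_xi_polys k p q m)) z / z ^ Suc m)" if "z \<noteq> 0"
    using neg_xi_eq[OF that k, of m] by (simp add: xi_seq_def del: of_nat_Suc)
qed (use neg_xi_polys_degree_coeff[OF k] in auto)

text \<open>Reversal exchanges the ends: the constant coefficient is now the leading one of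
  \<open>\<psi> m\<close>, and the top one is \<open>\<psi> m\<close> at 0, nonzero by genericity.
  The denominator \<open>z ^ i\<close> at negative index is read as \<open>z / z ^ Suc i\<close>,
  which fits \<open>\<delta> = 1\<close>.\<close>

lemma (in biorthogonal_weight) biorthogonal_family_phi_star:
  assumes generic: "generic_r \<phi> \<psi>" and k: "\<forall>m<0. k m \<noteq> 0 \<and> p m \<noteq> 0 \<and> q m \<noteq> 0"
  shows "biorthogonal_family w (\<lambda>\<zeta>. - 2) 1 (reciprocal \<psi>) (\<lambda>i. snd (neg_xi_polys k p q i))
    (phi_star_seq \<phi> \<psi> k p q) (xi_star_seq w \<phi> \<psi> k p q)"
proof
  show "circle_weight w" by (rule weight)
  show "continuous_on (sphere 0 1) (\<lambda>\<zeta>::complex. - 2 :: complex)" by (intro continuous_intros)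
  fix m :: nat and l :: int and z :: complex
  show "degree (reciprocal \<psi> m) \<le> m"
    using degree_reflect_poly_le[of "\<psi> m"] by (simp add: reciprocal_def degree)
  show "coeff (reciprocal \<psi> m) 0 \<noteq> 0"
    using lead_coeff_neq_0(3)[of m] by (simp add: reciprocal_def degree)
  have "coeff (\<psi> m) 0 \<noteq> 0"
    using generic lead_coeff_neq_0(3)[of 0]
    by (cases "m = 0") (auto simp: generic_r_def poly_0_coeff_0 dest!: spec[of _ m])
  then show "coeff (reciprocal \<psi> m) m \<noteq> 0"
    by (simp add: reciprocal_def coeff_reflect_poly degree)
  show "wint w (\<lambda>\<zeta>. - 2 * poly (reciprocal \<psi> m) \<zeta> / \<zeta> ^ Suc i) = 0" if "i < m" for i
    by (rule wint_reciprocal[OF that])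
  show "phi_star_seq \<phi> \<psi> k p q (int m) z = poly (reciprocal \<psi> m) z" by (simp add: phi_star_seq_def)
  show "phi_star_seq \<phi> \<psi> k p q l z = 0" if "l < 0"
    using that neg_phi_eq_0[of k p q "nat (- l - 1)" z] by (simp add: phi_star_seq_def)
  show "xi_star_seq w \<phi> \<psi> k p q (int m) z =
      z ^ 1 * cauchy_transform w (\<lambda>\<zeta>. - 2 * poly (reciprocal \<psi> m) \<zeta>) z"
    if "norm z \<noteq> 1"
    using assoc_star_eq_cauchy_transform[OF that] by (simp add: xi_star_seq_def)
  show "xi_star_seq w \<phi> \<psi> k p q (- int (Suc m)) z =
      z ^ 1 * (poly (snd (neg_xi_polys k p q m)) z / z ^ Suc m)" if "z \<noteq> 0"
    using neg_xi_eq[OF that k, of m] that by (simp add: xi_star_seq_def del: of_nat_Suc)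
qed (use neg_xi_polys_degree_coeff[OF k] in auto)

section \<open>Uniqueness from orthogonality and the leading coefficient\<close>

lemma (in biorthogonal_weight) multiple_of_phi:
  assumes "degree h \<le> n" "\<And>i. i < n \<Longrightarrow> wint w (\<lambda>\<zeta>. 2 * \<zeta> * poly h \<zeta> / \<zeta> ^ Suc i) = 0"
  shows "\<exists>l. h = Polynomial.smult l (\<phi> n)"
  using assms by (intro multiple_of_orthogonal) (auto simp: wint_phi simp del: power_Suc)

lemma (in biorthogonal_weight) multiple_of_reciprocal:
  assumes deg: "degree h \<le> n" and orth: "\<And>i. i < n \<Longrightarrow> wint w (\<lambda>\<zeta>. - 2 * poly h \<zeta> / \<zeta> ^ Suc i) = 0"
  shows "\<exists>l. h = Polynomial.smult l (reciprocal \<psi> n)"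
proof -
  \<comment> \<open>This is \<open>z ^ n * h(1 / z)\<close>: \<open>reflect_poly\<close> reverses at
    the actual degree, so the power of \<open>z\<close> pads up to \<open>n\<close>. The test index
    \<open>i\<close> for \<open>r\<close> corresponds to \<open>n - Suc i\<close> for
    \<open>h\<close>.\<close>
  define r where "r = monom 1 (n - degree h) * reflect_poly h"
  have r: "poly r (1 / \<zeta>) = poly h \<zeta> / \<zeta> ^ n" if "\<zeta> \<noteq> 0" for \<zeta>
  proof -
    have "\<zeta> ^ n = \<zeta> ^ (n - degree h) * \<zeta> ^ degree h" using deg by (simp flip: power_add)
    then show ?thesis
      using that by (simp add: r_def poly_monom poly_reflect_poly_nz power_divide inverse_eq_divide)
  qed
  have "\<exists>l. r = Polynomial.smult l (\<psi> n)"
  proof (rule swapped.multiple_of_orthogonal)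
    have "degree r \<le> (n - degree h) + degree h"
      unfolding r_def using degree_mult_le[of "monom (1::complex) (n - degree h)" "reflect_poly h"]
        degree_reflect_poly_le[of h] degree_monom_le[of "1::complex" "n - degree h"] by linarith
    then show "degree r \<le> n" using deg by simp
    fix i assume i: "i < n"
    have "wint w (\<lambda>\<zeta>. - 2 * poly h \<zeta> / \<zeta> ^ Suc (n - Suc i)) =
        - 2 * wint w (\<lambda>\<zeta>. poly r (1 / \<zeta>) * \<zeta> ^ i)"
      unfolding wint_cmult[symmetric]
    proof (rule wint_cong)
      fix \<zeta> :: complex assume "norm \<zeta> = 1"
      then have "\<zeta> \<noteq> 0" by auto
      moreover have "\<zeta> ^ n = \<zeta> ^ Suc (n - Suc i) * \<zeta> ^ i" using i by (simp flip: power_add power_Suc)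
      ultimately show "- 2 * poly h \<zeta> / \<zeta> ^ Suc (n - Suc i) = - 2 * (poly r (1 / \<zeta>) * \<zeta> ^ i)"
        by (simp add: r del: power_Suc)
    qed
    then show "circle_pairing w (monom 1 i) r = 0"
      using orth[of "n - Suc i"] i by (simp add: wint_psi del: power_Suc)
  qed
  then obtain l where l: "r = Polynomial.smult l (\<psi> n)" by blast
  have "h - Polynomial.smult l (reciprocal \<psi> n) = 0"
  proof (rule poly_eq_0_off_circle)
    fix z :: complex assume "z \<noteq> 0"
    then show "poly (h - Polynomial.smult l (reciprocal \<psi> n)) z = 0"
      using r[of z] by (simp add: l poly_reciprocal field_simps)
  qed
  then show ?thesis by auto
qed

text \<open>The Taylor coefficient of order \<open>n\<close> is twice the pairing of
  \<open>\<phi> n\<close> with \<open>z ^ n\<close>, that is, 2 over the leading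
  coefficient.\<close>

lemma (in biorthogonal_weight) lead_coeff_from_assoc:
  "\<exists>F. assoc w \<phi> n has_fps_expansion F \<and>
     (lead_coeff (\<phi> n))\<^sup>2 = 2 * coeff (\<phi> n) n / fps_nth F n"
proof (intro exI conjI)
  let ?g = "\<lambda>\<zeta>. 2 * \<zeta> * poly (\<phi> n) \<zeta>"
  let ?F = "Abs_fps (\<lambda>i. wint w (\<lambda>\<zeta>. ?g \<zeta> / \<zeta> ^ Suc i))"
  have "cauchy_transform w ?g has_fps_expansion ?F"
    by (intro cauchy_transform_has_fps_expansion weight continuous_intros)
  moreover have "\<forall>\<^sub>F z in nhds 0. assoc w \<phi> n z = cauchy_transform w ?g z"
    unfolding eventually_nhds_metric
    by (intro exI[of _ "1/2"]) (auto intro!: assoc_eq_cauchy_transform)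
  ultimately show "assoc w \<phi> n has_fps_expansion ?F"
    by (subst has_fps_expansion_cong[OF _ refl])
  show "(lead_coeff (\<phi> n))\<^sup>2 = 2 * coeff (\<phi> n) n / fps_nth ?F n"
    using lead_coeff_neq_0(2)[of n]
    by (simp add: wint_phi pairing_monom degree power2_eq_square del: power_Suc)
qed

text \<open>The Herglotz kernel tends to -1 at infinity, so the limit is
  \<open>2 * wint w ?f\<close>, which is 2 over the leading coefficient. To see it, the starred
  function is rewritten by the other Herglotz identity, whose transform decays without a factor
  \<open>z\<close> in front.\<close>

lemma (in biorthogonal_weight) lead_coeff_from_assoc_star:
  "\<exists>l. (assoc_star w \<psi> n \<longlongrightarrow> l) at_infinity \<and>
     (lead_coeff (\<phi> n))\<^sup>2 = 2 * poly (reciprocal \<psi> n) 0 / l"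
proof (intro exI conjI)
  let ?f = "poly (reciprocal \<psi> n)"
  have f: "continuous_on (sphere 0 1) ?f" by (intro continuous_intros)
  have pair: "wint w ?f = 1 / coeff (\<phi> n) n"
  proof -
    have "wint w ?f = wint w (\<lambda>\<zeta>. poly (\<psi> n) (1 / \<zeta>) * \<zeta> ^ n)"
    proof (rule wint_cong)
      fix \<zeta> :: complex assume "norm \<zeta> = 1"
      then have "\<zeta> \<noteq> 0" by auto
      then show "?f \<zeta> = poly (\<psi> n) (1 / \<zeta>) * \<zeta> ^ n" by (simp add: poly_reciprocal)
    qed
    then show ?thesis by (simp add: wint_psi swapped.pairing_monom(2) coeff_eq)
  qed
  have cf: "continuous_on (sphere 0 1) (\<lambda>\<zeta>. 2 * \<zeta> * ?f \<zeta>)" by (intro continuous_intros f)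
  have "(cauchy_transform w (\<lambda>\<zeta>. 2 * \<zeta> * ?f \<zeta>) \<longlongrightarrow> 0) at_infinity"
  proof -
    obtain c where "\<forall>\<^sub>F z in at_infinity. norm (cauchy_transform w (\<lambda>\<zeta>. 2 * \<zeta> * ?f \<zeta>) z) \<le> norm (1 / z) * c"
      using cauchy_transform_bigo_infinity[OF weight cf] by (auto simp: bigo_def mult.commute)
    moreover have "((\<lambda>z. 1 / z) \<longlongrightarrow> (0::complex)) at_infinity"
      by (simp add: tendsto_inverse_0 divide_inverse)
    ultimately show ?thesis by (rule tendsto_0_le[rotated])
  qed
  then have "((\<lambda>z. 2 * wint w ?f - cauchy_transform w (\<lambda>\<zeta>. 2 * \<zeta> * ?f \<zeta>) z) \<longlongrightarrow> 2 * wint w ?f - 0) at_infinity"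
    by (intro tendsto_intros)
  also have "?this \<longleftrightarrow> (assoc_star w \<psi> n \<longlongrightarrow> 2 / coeff (\<phi> n) n) at_infinity"
  proof (rule filterlim_cong)
    show "\<forall>\<^sub>F z in at_infinity. 2 * wint w ?f - cauchy_transform w (\<lambda>\<zeta>. 2 * \<zeta> * ?f \<zeta>) z = assoc_star w \<psi> n z"
      using eventually_at_infinity_norm_ge[of 2]
    proof eventually_elim
      case (elim z)
      then have z: "norm z \<noteq> 1" by auto
      have "2 * wint w ?f - cauchy_transform w (\<lambda>\<zeta>. 2 * \<zeta> * ?f \<zeta>) z =
          wint w ?f - wint w (\<lambda>\<zeta>. (\<zeta> + z) / (\<zeta> - z) * ?f \<zeta>)"
        unfolding wint_herglotz(1)[OF weight f z, symmetric] by simp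
      also have "\<dots> = assoc_star w \<psi> n z"
        unfolding assoc_star_eq_cauchy_transform[OF z] by (rule wint_herglotz(2)[OF weight f z])
      finally show ?case .
    qed
  qed (simp_all add: pair)
  finally show "(assoc_star w \<psi> n \<longlongrightarrow> 2 / coeff (\<phi> n) n) at_infinity" .
  have "poly (reciprocal \<psi> n) 0 = coeff (\<phi> n) n"
    by (simp add: reciprocal_def poly_0_coeff_0 degree coeff_eq)
  then show "(lead_coeff (\<phi> n))\<^sup>2 = 2 * poly (reciprocal \<psi> n) 0 / (2 / coeff (\<phi> n) n)"
    using lead_coeff_neq_0(2)[of n] by (simp add: degree power2_eq_square)
qed

text \<open>Distinctness is imposed across each pair of lists: an entry common to
  \<open>\<alpha>\<close> and \<open>\<alpha>s\<close>, or to \<open>\<beta>\<close> and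
  \<open>\<beta>s\<close>, would produce two equal rows and a zero determinant. The second pair of
  formulas is claimed at \<open>z = 0\<close> only when no negative power and no negative index
  occurs in the determinant.\<close>

theorem mainTheorem1:
  fixes w :: "complex \<Rightarrow> complex"
    and \<phi> \<psi> \<Phi> \<Psi> :: "nat \<Rightarrow> complex poly"
    and \<alpha> \<alpha>s \<beta> \<beta>s :: "complex list"
    and k p q :: "int \<Rightarrow> complex"
    and n :: nat
  defines "w' \<equiv> modified_weight \<alpha> \<alpha>s \<beta> \<beta>s w"
    and "f \<equiv> phi_seq \<phi> \<psi> k p q"
    and "fs \<equiv> phi_star_seq \<phi> \<psi> k p q"
    and "x \<equiv> xi_seq w \<phi> \<psi> k p q"
    and "xs \<equiv> xi_star_seq w \<phi> \<psi> k p q"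
    and "D \<equiv> bordered_det \<alpha> \<alpha>s \<beta> \<beta>s n"
  assumes weight: "circle_weight w"
    and distinct: "distinct (\<alpha> @ \<alpha>s)" "distinct (\<beta> @ \<beta>s)"
    and alpha_entries: "\<alpha>s \<noteq> [] \<Longrightarrow> 0 \<notin> set (\<alpha> @ \<alpha>s)"
    and beta_entries: "0 \<notin> set (\<beta> @ \<beta>s)" "\<forall>b \<in> set (\<beta> @ \<beta>s). norm b \<noteq> 1"
    and exist: "\<forall>m. toeplitz_det w m \<noteq> 0" "\<forall>m. toeplitz_det w' m \<noteq> 0"
    and system: "biorthogonal_system w \<phi> \<psi>" "biorthogonal_system w' \<Phi> \<Psi>"
    and generic: "generic_r \<phi> \<psi>" "generic_r \<Phi> \<Psi>"
    and negative: "\<forall>m<0. k m \<noteq> 0 \<and> p m \<noteq> 0 \<and> q m \<noteq> 0"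
  shows "(\<exists>C Cs.
       (\<forall>z. z \<noteq> 0 \<or> \<alpha>s = [] \<longrightarrow>
          numer \<alpha> \<alpha>s z * poly (\<Phi> n) z = C * D f f x z \<and>
          numer \<alpha> \<alpha>s z * poly (reciprocal \<Psi> n) z = Cs * D fs fs xs z) \<and>
       (\<forall>z. norm z \<noteq> 1 \<and> (z \<noteq> 0 \<or> \<alpha>s = [] \<and> \<beta>s = [] \<and> length \<beta> \<le> n) \<longrightarrow>
          numer \<beta> \<beta>s z * assoc w' \<Phi> n z = C * D x f x z \<and>
          numer \<beta> \<beta>s z * assoc_star w' \<Psi> n z = Cs * D xs fs xs z))
     \<and> (\<exists>F. assoc w' \<Phi> n has_fps_expansion F \<and>
            (lead_coeff (\<Phi> n))\<^sup>2 = 2 * coeff (\<Phi> n) n / fps_nth F n)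
     \<and> (\<exists>l. (assoc_star w' \<Psi> n \<longlongrightarrow> l) at_infinity \<and>
            (lead_coeff (\<Phi> n))\<^sup>2 = 2 * poly (reciprocal \<Psi> n) 0 / l)"
proof -
  interpret W: biorthogonal_weight w \<phi> \<psi> using weight system(1) by unfold_locales
  interpret W': biorthogonal_weight w' \<Phi> \<Psi>
    using circle_weight_modified_weight[OF weight beta_entries(2)] system(2)
    by unfold_locales (simp_all add: w'_def)
  interpret F: biorthogonal_family w "\<lambda>\<zeta>. 2 * \<zeta>" 0 \<phi> "\<lambda>i. fst (neg_xi_polys k p q i)" f x
    unfolding f_def x_def by (rule W.biorthogonal_family_phi[OF generic(1) negative])
  interpret Fs: biorthogonal_family w "\<lambda>\<zeta>. - 2" 1 "reciprocal \<psi>" "\<lambda>i. snd (neg_xi_polys k p q i)" fs xs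
    unfolding fs_def xs_def by (rule W.biorthogonal_family_phi_star[OF generic(1) negative])
  note parameters = distinct(1) alpha_entries distinct(2) beta_entries
  obtain C where C: "\<forall>z. z \<noteq> 0 \<or> \<alpha>s = [] \<longrightarrow> numer \<alpha> \<alpha>s z * poly (\<Phi> n) z = C * D f f x z"
    "\<forall>z. norm z \<noteq> 1 \<and> (z \<noteq> 0 \<or> \<alpha>s = [] \<and> \<beta>s = [] \<and> length \<beta> \<le> n) \<longrightarrow>
       numer \<beta> \<beta>s z * assoc w' \<Phi> n z = C * D x f x z"
    using F.bordered_determinant_formula[OF parameters, where n = n and t = "\<Phi> n" and y = "assoc w' \<Phi> n"]
      W'.multiple_of_phi[of _ n] W'.assoc_eq_cauchy_transform[of _ n]
    unfolding D_def w'_def by auto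
  obtain Cs where Cs: "\<forall>z. z \<noteq> 0 \<or> \<alpha>s = [] \<longrightarrow>
       numer \<alpha> \<alpha>s z * poly (reciprocal \<Psi> n) z = Cs * D fs fs xs z"
    "\<forall>z. norm z \<noteq> 1 \<and> (z \<noteq> 0 \<or> \<alpha>s = [] \<and> \<beta>s = [] \<and> length \<beta> \<le> n) \<longrightarrow>
       numer \<beta> \<beta>s z * assoc_star w' \<Psi> n z = Cs * D xs fs xs z"
    using Fs.bordered_determinant_formula[OF parameters, where n = n and t = "reciprocal \<Psi> n"
        and y = "assoc_star w' \<Psi> n"]
      W'.multiple_of_reciprocal[of _ n] W'.assoc_star_eq_cauchy_transform[of _ n]
    unfolding D_def w'_def by auto
  show ?thesis
    using C Cs W'.lead_coeff_from_assoc[of n] W'.lead_coeff_from_assoc_star[of n] by blast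
qed

end
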